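(* For every separable reflexive Banach space $X$ there exists a unique ordinal $\xi<\omega_1$ such that: (i) for all ordinals $\zeta$ with $\xi\le\zeta<\omega_1$ the space $X$ has the $\zeta$-Banach–Saks property; (ii) for every $\zeta<\xi$ the space $X$ fails the $\zeta$-Banach–Saks property.
   Context: Notation: $\mathbb N=\{1,2,\dots\}$. For an infinite $N\subset\mathbb N$, $[N]$ is the set of all infinite subsets of $N$. $(e_n)$ is the unit vector basis of $\ell^1(\mathbb N)$. For each (nonzero) countable limit ordinal $\xi$ fix once and for all a strictly increasing sequence $(\xi_n)_{n\in\mathbb N}$ of successor ordinals with $\sup_n\xi_n=\xi$. Repeated Averages (RA) Hierarchy: for $M\in[\mathbb N]$ and $\xi<\omega_1$ one defines a sequence $(\xi^M_n)_{n\in\mathbb N}$ of finitely supported elements of the positive part $S^+_{\ell^1}$ of the unit sphere of $\ell^1(\mathbb N)$ (with successive supports whose union is $M$) by induction on $\xi$. (i) $0^M_n=e_{m_n}$ where $m_1<m_2<\cdots$ enumerates $M$. (ii) If $\xi=\zeta+1$: put $k_1=0$, $s_1=\min\operatorname{supp}\zeta^M_1$, and for $n\ge2$ put $k_n=k_{n-1}+s_{n-1}$, $s_n=\min\operatorname{supp}\zeta^M_{k_n+1}$; then $\xi^M_n=\frac1{s_n}\left(\zeta^M_{k_n+1}+\cdots+\zeta^M_{k_n+s_n}\right)$. (iii) If $\xi$ is a limit ordinal with fixed sequence $(\xi_n)$: put $M_1=M$, $n_1=\min M_1$, and inductively $M_{k+1}=M_k\setminus\operatorname{supp}(\xi_{n_k})^{M_k}_1$,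 $n_{k+1}=\min M_{k+1}$; then $\xi^M_k=(\xi_{n_k})^{M_k}_1$. Summability: for a bounded sequence $H=(x_n)$ in $X$ and $A=(a_n)\in S^+_{\ell^1}$ put $A\cdot H=\sum_na_nx_n$. $H$ is $(M,\xi)$ summable if $(\xi^M_n\cdot H)_{n\in\mathbb N}$ is Cesàro summable, i.e. $\frac1n\sum_{k=1}^n\xi^M_k\cdot H$ converges in norm as $n\to\infty$. $X$ has the $\xi$-Banach–Saks property ($\xi$-BS) if for every bounded sequence $(x_n)_{n\in\mathbb N}$ in $X$ there exists $L\in[\mathbb N]$ such that $(x_n)_{n\in\mathbb N}$ is $(L,\xi)$ summable. *)

theory Defs
  imports "HOL-Analysis.Analysis" "HOL-Library.Countable_Set_Type"
begin

section \<open>Countable ordinals\<close>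

text \<open>
  The elements of the following well-ordered type are the ordinals below the first uncountable one:
  the cardinal successor of \<open>natLeq\<close> is a well-order of order type \<open>\<omega>\<^sub>1\<close>.
\<close>

unbundle cardinal_syntax

typedef countable_ordinal = "Field (cardSuc natLeq)"
proof -
  have "Field (cardSuc natLeq) \<noteq> {}"
    using cardSuc_finite[OF natLeq_Card_order] infinite_UNIV_nat by (metis Field_natLeq finite.emptyI)
  then show ?thesis by blast
qed

lemma cardSuc_natLeq_Well_order: "Well_order (cardSuc natLeq)"
  using cardSuc_Card_order[OF natLeq_Card_order] card_order_on_def by blast

instantiation countable_ordinal :: wellorder
begin

definition less_eq_countable_ordinal :: "countable_ordinal \<Rightarrow> countable_ordinal \<Rightarrow> bool"
  where "\<xi> \<le> \<eta> \<longleftrightarrow> (Rep_countable_ordinal \<xi>, Rep_countable_ordinal \<eta>) \<in> cardSuc natLeq"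

definition less_countable_ordinal :: "countable_ordinal \<Rightarrow> countable_ordinal \<Rightarrow> bool"
  where "\<xi> < \<eta> \<longleftrightarrow> \<xi> \<le> \<eta> \<and> \<not> \<eta> \<le> (\<xi> :: countable_ordinal)"

instance
proof
  let ?r = "cardSuc natLeq"
  interpret wo_rel ?r
    using cardSuc_natLeq_Well_order by (simp add: wo_rel_def)
  fix x y z :: countable_ordinal
  show "x < y \<longleftrightarrow> x \<le> y \<and> \<not> y \<le> x"
    by (rule less_countable_ordinal_def)
  show "x \<le> x"
    unfolding less_eq_countable_ordinal_def
    using REFL Rep_countable_ordinal refl_onD by fastforce
  show "x \<le> z" if "x \<le> y" "y \<le> z"
    using that TRANS unfolding less_eq_countable_ordinal_def by (meson transD)
  show "x = y" if "x \<le> y" "y \<le> x"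
    using that ANTISYM Rep_countable_ordinal_inject
    unfolding less_eq_countable_ordinal_def by (meson antisymD)
  show "x \<le> y \<or> y \<le> x"
    unfolding less_eq_countable_ordinal_def
    using TOTALS Rep_countable_ordinal by blast
next
  let ?r = "cardSuc natLeq"
  fix P :: "countable_ordinal \<Rightarrow> bool" and a
  assume step: "\<And>x. (\<And>y. y < x \<Longrightarrow> P y) \<Longrightarrow> P x"
  have wf: "wf (?r - Id)"
    using cardSuc_natLeq_Well_order by (simp add: well_order_on_def)
  have "wf (inv_image (?r - Id) Rep_countable_ordinal)"
    using wf by (rule wf_inv_image)
  moreover have "(y, x) \<in> inv_image (?r - Id) Rep_countable_ordinal" if "y < x" for x y
    using that unfolding less_countable_ordinal_def less_eq_countable_ordinal_def by auto
  ultimately show "P a"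
    by (induction a rule: wf_induct_rule) (use step in blast)
qed

end

lemma countable_lessThan_countable_ordinal: "countable {..< \<xi> :: countable_ordinal}"
proof -
  let ?r = "cardSuc natLeq" and ?x = "Rep_countable_ordinal \<xi>"
  have "|underS ?r ?x| <o ?r"
    by (rule card_of_underS[OF cardSuc_Card_order[OF natLeq_Card_order] Rep_countable_ordinal])
  then have "|underS ?r ?x| \<le>o natLeq"
    using cardSuc_ordLeq_ordLess[OF natLeq_Card_order card_of_Card_order] by blast
  then have "countable (underS ?r ?x)"
    by (simp add: countable_card_le_natLeq)
  moreover have "Rep_countable_ordinal ` {..<\<xi>} \<subseteq> underS ?r ?x"
    by (auto simp: underS_def less_countable_ordinal_def less_eq_countable_ordinal_def)
  ultimately have "countable (Rep_countable_ordinal ` {..<\<xi>})"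
    using countable_subset by blast
  then show ?thesis
    by (rule countable_image_inj_on) (simp add: inj_on_def Rep_countable_ordinal_inject)
qed

lemma uncountable_UNIV_countable_ordinal: "uncountable (UNIV :: countable_ordinal set)"
proof
  let ?r = "cardSuc natLeq"
  assume "countable (UNIV :: countable_ordinal set)"
  then have "countable (Field ?r)"
    using countable_image[of UNIV Rep_countable_ordinal]
      type_definition.Rep_range[OF type_definition_countable_ordinal] by simp
  then have "|Field ?r| \<le>o natLeq"
    by (simp add: countable_card_le_natLeq)
  moreover have "|Field ?r| =o ?r"
    by (rule card_of_Field_ordIso[OF cardSuc_Card_order[OF natLeq_Card_order]])
  ultimately have "?r \<le>o natLeq"
    using ordIso_symmetric ordIso_ordLeq_trans by blast
  then show False
    using cardSuc_greater[OF natLeq_Card_order] not_ordLess_ordLeq by blast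
qed

unbundle no cardinal_syntax

lemma bounded_countable_ordinal:
  assumes "countable A"
  shows "\<exists>\<xi> :: countable_ordinal. \<forall>\<eta>\<in>A. \<eta> < \<xi>"
proof (rule ccontr)
  assume "\<not> ?thesis"
  then have "(UNIV :: countable_ordinal set) = A \<union> (\<Union>\<eta>\<in>A. {..<\<eta>})"
    by (fastforce simp: not_less order_le_less)
  moreover have "countable (A \<union> (\<Union>\<eta>\<in>A. {..<\<eta>}))"
    using assms countable_lessThan_countable_ordinal by blast
  ultimately show False
    using uncountable_UNIV_countable_ordinal by simp
qed

instantiation countable_ordinal :: zero
begin
definition zero_countable_ordinal :: countable_ordinal
  where "zero_countable_ordinal = (LEAST \<xi>. True)"
instance ..
end

definition ord_succ :: "countable_ordinal \<Rightarrow> countable_ordinal"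
  where "ord_succ \<zeta> = (LEAST \<xi>. \<zeta> < \<xi>)"

definition is_succ_ord :: "countable_ordinal \<Rightarrow> bool"
  where "is_succ_ord \<xi> \<longleftrightarrow> (\<exists>\<zeta>. \<xi> = ord_succ \<zeta>)"

definition is_limit_ord :: "countable_ordinal \<Rightarrow> bool"
  where "is_limit_ord \<xi> \<longleftrightarrow> \<xi> \<noteq> 0 \<and> \<not> is_succ_ord \<xi>"

definition ord_pred :: "countable_ordinal \<Rightarrow> countable_ordinal"
  where "ord_pred \<xi> = (THE \<zeta>. \<xi> = ord_succ \<zeta>)"

lemma less_ord_succ: "\<zeta> < ord_succ \<zeta>"
  unfolding ord_succ_def using bounded_countable_ordinal[of "{\<zeta>}"] by (auto intro: LeastI_ex)

lemma ord_succ_le_iff: "ord_succ \<zeta> \<le> \<xi> \<longleftrightarrow> \<zeta> < \<xi>"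
  using less_ord_succ by (metis Least_le less_le_trans ord_succ_def)

lemma ord_succ_inject: "ord_succ \<zeta> = ord_succ \<eta> \<longleftrightarrow> \<zeta> = \<eta>"
  by (metis less_ord_succ linorder_neqE not_less ord_succ_le_iff)

lemma ord_pred_succ: "ord_pred (ord_succ \<zeta>) = \<zeta>"
  unfolding ord_pred_def by (simp add: ord_succ_inject)

lemma ord_pred_less: "is_succ_ord \<xi> \<Longrightarrow> ord_pred \<xi> < \<xi>"
  unfolding is_succ_ord_def using ord_pred_succ less_ord_succ by auto

lemma zero_le_countable_ordinal: "0 \<le> (\<xi> :: countable_ordinal)"
  unfolding zero_countable_ordinal_def by (simp add: Least_le)

lemma ord_succ_neq_0: "ord_succ \<zeta> \<noteq> 0"
  using less_ord_succ zero_le_countable_ordinal by (metis not_less)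

text \<open>
  A choice, for every countable limit ordinal \<open>\<xi>\<close>, of a strictly increasing sequence
  \<open>(\<xi>\<^sub>n)\<^sub>n\<close> of successor ordinals with supremum \<open>\<xi>\<close>.  Here, and for all sequences below,
  indices range over \<open>{1..}\<close>; the value at index 0 is irrelevant.
\<close>

definition ladder_system :: "(countable_ordinal \<Rightarrow> nat \<Rightarrow> countable_ordinal) \<Rightarrow> bool"
  where "ladder_system lad \<longleftrightarrow> (\<forall>\<xi>. is_limit_ord \<xi> \<longrightarrow>
     strict_mono_on {1..} (lad \<xi>) \<and>
     (\<forall>n\<ge>1. is_succ_ord (lad \<xi> n)) \<and>
     (\<forall>n\<ge>1. lad \<xi> n \<le> \<xi>) \<and> (\<forall>\<upsilon>. (\<forall>n\<ge>1. lad \<xi> n \<le> \<upsilon>) \<longrightarrow> \<xi> \<le> \<upsilon>))"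

lemma ladder_less:
  assumes "ladder_system lad" "is_limit_ord \<xi>" "n \<ge> 1"
  shows "lad \<xi> n < \<xi>"
proof -
  have "lad \<xi> n < lad \<xi> (Suc n)" "lad \<xi> (Suc n) \<le> \<xi>"
    using assms unfolding ladder_system_def strict_mono_on_def by auto
  then show ?thesis by simp
qed

lemma ladder_system_exists: "\<exists>lad. ladder_system lad"
proof -
  have "\<exists>f :: nat \<Rightarrow> countable_ordinal. strict_mono_on {1..} f \<and> (\<forall>n\<ge>1. is_succ_ord (f n)) \<and> (\<forall>n\<ge>1. f n \<le> \<xi>) \<and>
      (\<forall>\<upsilon>. (\<forall>n\<ge>1. f n \<le> \<upsilon>) \<longrightarrow> \<xi> \<le> \<upsilon>)" if lim: "is_limit_ord \<xi>" for \<xi>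
  proof -
    have ne: "{..<\<xi>} \<noteq> {}"
      using lim zero_le_countable_ordinal[of \<xi>] unfolding is_limit_ord_def
      by (metis emptyE lessThan_iff order_le_neq_trans)
    define e where "e = from_nat_into {..<\<xi>}"
    have range_e: "range e = {..<\<xi>}"
      unfolding e_def using ne countable_lessThan_countable_ordinal by (rule range_from_nat_into)
    then have e_less: "e n < \<xi>" for n by blast
    have succ_less: "ord_succ \<eta> < \<xi>" if "\<eta> < \<xi>" for \<eta>
      using that lim ord_succ_le_iff[of \<eta> \<xi>] unfolding is_limit_ord_def is_succ_ord_def
      by (metis le_neq_trans)
    define f where "f = rec_nat (ord_succ 0) (\<lambda>n a. ord_succ (max a (e n)))"
    have f_Suc: "f (Suc n) = ord_succ (max (f n) (e n))" for n by (simp add: f_def)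
    have f_less: "f n < \<xi>" for n
    proof (induction n)
      case 0
      then show ?case using ne zero_le_countable_ordinal succ_less unfolding f_def
        by simp (metis e_less le_less_trans)
    next
      case (Suc n)
      then show ?case by (simp add: f_Suc succ_less e_less)
    qed
    have "strict_mono f"
      by (rule strict_monoI_Suc) (metis f_Suc less_ord_succ max.cobounded1 le_less_trans)
    moreover have "is_succ_ord (f n)" for n
      by (cases n) (auto simp: f_def is_succ_ord_def)
    moreover have "\<xi> \<le> \<upsilon>" if "\<forall>n\<ge>1. f n \<le> \<upsilon>" for \<upsilon>
    proof (rule ccontr)
      assume "\<not> \<xi> \<le> \<upsilon>"
      then obtain n where "\<upsilon> = e n" using range_e by (metis imageE lessThan_iff not_le)
      moreover have "e n < f (Suc n)"
        by (metis f_Suc less_ord_succ max.cobounded2 le_less_trans)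
      ultimately show False using that by (metis le_add1 not_le plus_1_eq_Suc)
    qed
    ultimately show ?thesis
      using f_less by - (rule exI[of _ f], auto simp: strict_mono_on_def strict_mono_def less_imp_le)
  qed
  then show ?thesis unfolding ladder_system_def by metis
qed


section \<open>The repeated averages hierarchy\<close>

text \<open>
  Elements of \<open>\<ell>\<^sup>1(\<nat>)\<close>, \<open>\<nat> = {1, 2, \<dots>}\<close>, are given by their coordinates \<open>nat \<Rightarrow> real\<close>; all those
  occurring below vanish at coordinate 0.
\<close>

definition inf_subsets :: "nat set \<Rightarrow> nat set set"
  where "inf_subsets N = {L. L \<subseteq> N \<and> infinite L}"

definition supp :: "(nat \<Rightarrow> real) \<Rightarrow> nat set"
  where "supp a = {i. a i \<noteq> 0}"

definition ra_zero :: "nat set \<Rightarrow> nat \<Rightarrow> nat \<Rightarrow> real"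
  where "ra_zero M n = indicator {enumerate M (n - 1)}"

text \<open>
  In the next two definitions \<open>z\<close> is the sequence \<open>(\<zeta>\<^sup>M\<^sub>n)\<^sub>n\<close>, and \<open>ra_succ_idx z n\<close> is \<open>k\<^sub>n\<close>.
\<close>

fun ra_succ_idx :: "(nat \<Rightarrow> nat \<Rightarrow> real) \<Rightarrow> nat \<Rightarrow> nat"
  where
    "ra_succ_idx z 0 = 0"
  | "ra_succ_idx z (Suc 0) = 0"
  | "ra_succ_idx z (Suc (Suc n)) =
       ra_succ_idx z (Suc n) + Inf (supp (z (ra_succ_idx z (Suc n) + 1)))"

definition ra_succ :: "(nat \<Rightarrow> nat \<Rightarrow> real) \<Rightarrow> nat \<Rightarrow> nat \<Rightarrow> real"
  where "ra_succ z n =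
    (let k = ra_succ_idx z n; s = Inf (supp (z (k + 1)))
     in (\<lambda>i. (1 / real s) * (\<Sum>j=1..s. z (k + j) i)))"

text \<open>
  In the next two definitions \<open>F n M k\<close> is \<open>(\<xi>\<^sub>n)\<^sup>M\<^sub>k\<close>, and \<open>ra_limit_set F M k\<close> is \<open>M\<^sub>k\<close>, so that
  \<open>n\<^sub>k = Inf (ra_limit_set F M k)\<close>.
\<close>

fun ra_limit_set :: "(nat \<Rightarrow> nat set \<Rightarrow> nat \<Rightarrow> nat \<Rightarrow> real) \<Rightarrow> nat set \<Rightarrow> nat \<Rightarrow> nat set"
  where
    "ra_limit_set F M 0 = M"
  | "ra_limit_set F M (Suc 0) = M"
  | "ra_limit_set F M (Suc (Suc k)) =
       (let M' = ra_limit_set F M (Suc k) in M' - supp (F (Inf M') M' 1))"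

definition ra_limit :: "(nat \<Rightarrow> nat set \<Rightarrow> nat \<Rightarrow> nat \<Rightarrow> real) \<Rightarrow> nat set \<Rightarrow> nat \<Rightarrow> nat \<Rightarrow> real"
  where "ra_limit F M k = (let M' = ra_limit_set F M k in F (Inf M') M' 1)"

text \<open>
  \<open>ra lad \<xi> M n\<close> is \<open>\<xi>\<^sup>M\<^sub>n\<close> relative to the choice \<open>lad\<close>.  The guard in the limit case only makes the
  recursion terminate for arbitrary \<open>lad\<close>; lemma \<open>ra_limit_ord\<close> removes it for ladder systems.
\<close>

function ra :: "(countable_ordinal \<Rightarrow> nat \<Rightarrow> countable_ordinal) \<Rightarrow> countable_ordinal \<Rightarrow>
    nat set \<Rightarrow> nat \<Rightarrow> nat \<Rightarrow> real"
  where "ra lad \<xi> =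
    (if \<xi> = 0 then ra_zero
     else if is_succ_ord \<xi> then (\<lambda>M. ra_succ (ra lad (ord_pred \<xi>) M))
     else ra_limit (\<lambda>n. if lad \<xi> n < \<xi> then ra lad (lad \<xi> n) else undefined))"
  by pat_completeness auto
termination
  by (relation "inv_image {(x, y). x < y} snd") (auto simp: wf ord_pred_less wf_inv_image)

declare ra.simps [simp del]

lemma ra_0: "ra lad 0 M n = indicator {enumerate M (n - 1)}"
  by (simp add: ra.simps ra_zero_def)

lemma ra_ord_succ: "ra lad (ord_succ \<zeta>) M n = ra_succ (ra lad \<zeta> M) n"
  by (subst ra.simps) (auto simp: ord_succ_neq_0 ord_pred_succ is_succ_ord_def)

lemma ra_limit_set_in_inf_subsets:
  assumes "\<And>n L. n \<ge> 1 \<Longrightarrow> L \<in> inf_subsets {1..} \<Longrightarrow> finite (supp (F n L 1))"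
    and "M \<in> inf_subsets {1..}"
  shows "ra_limit_set F M k \<in> inf_subsets {1..} \<and> Inf (ra_limit_set F M k) \<ge> 1"
proof -
  have Inf: "Inf L \<ge> 1" if "L \<in> inf_subsets {1..}" for L :: "nat set"
    using that Inf_nat_def1[of L] unfolding inf_subsets_def by force
  have "ra_limit_set F M k \<in> inf_subsets {1..}"
    using assms
  proof (induction F M k rule: ra_limit_set.induct)
    case (3 F M k)
    then have L: "ra_limit_set F M (Suc k) \<in> inf_subsets {1..}" by blast
    have "finite (supp (F (Inf (ra_limit_set F M (Suc k))) (ra_limit_set F M (Suc k)) 1))"
      using "3.prems"(1) L Inf by blast
    then show ?case
      using L by (auto simp: Let_def inf_subsets_def)
  qed auto
  then show ?thesis using Inf by blast
qed

lemma ra_limit_set_cong: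
  assumes "\<And>n L. n \<ge> 1 \<Longrightarrow> L \<in> inf_subsets {1..} \<Longrightarrow> finite (supp (F n L 1))"
    and "M \<in> inf_subsets {1..}" and "\<And>n. n \<ge> 1 \<Longrightarrow> F n = G n"
  shows "ra_limit_set F M k = ra_limit_set G M k"
  using assms
proof (induction F M k rule: ra_limit_set.induct)
  case (3 F M k)
  then have "ra_limit_set F M (Suc k) = ra_limit_set G M (Suc k)" by blast
  moreover have "Inf (ra_limit_set F M (Suc k)) \<ge> 1"
    using ra_limit_set_in_inf_subsets[of F M "Suc k"] "3.prems"(1,2) by blast
  ultimately show ?case
    using "3.prems"(3) by (simp add: Let_def)
qed auto

lemma finite_supp_ra:
  assumes lad: "ladder_system lad"
  shows "M \<in> inf_subsets {1..} \<Longrightarrow> finite (supp (ra lad \<xi> M n))"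
proof (induction \<xi> arbitrary: M n rule: less_induct)
  case (less \<xi>)
  consider "\<xi> = 0" | \<zeta> where "\<xi> = ord_succ \<zeta>" | "is_limit_ord \<xi>"
    unfolding is_limit_ord_def is_succ_ord_def by blast
  then show ?case
  proof cases
    case 1
    have "supp (ra lad \<xi> M n) \<subseteq> {enumerate M (n - 1)}"
      by (auto simp: 1 ra_0 supp_def indicator_def)
    then show ?thesis using finite_subset by blast
  next
    case 2
    define k s where "k = ra_succ_idx (ra lad \<zeta> M) n" and "s = Inf (supp (ra lad \<zeta> M (k + 1)))"
    have "supp (ra lad \<xi> M n) \<subseteq> (\<Union>j\<in>{1..s}. supp (ra lad \<zeta> M (k + j)))"
      unfolding 2 ra_ord_succ ra_succ_def Let_def k_def[symmetric] s_def[symmetric]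
      by (auto simp: supp_def dest: sum.not_neutral_contains_not_neutral)
    moreover have "finite (\<Union>j\<in>{1..s}. supp (ra lad \<zeta> M (k + j)))"
      using less 2 less_ord_succ by auto
    ultimately show ?thesis using finite_subset by blast
  next
    case 3
    define F where "F = (\<lambda>n. if lad \<xi> n < \<xi> then ra lad (lad \<xi> n) else undefined)"
    have eq: "ra lad \<xi> = ra_limit F"
      unfolding F_def by (subst ra.simps) (use 3 in \<open>auto simp: is_limit_ord_def\<close>)
    have fin: "finite (supp (F n L k))" if "n \<ge> 1" "L \<in> inf_subsets {1..}" for n L k
      using that less.IH ladder_less[OF lad 3] by (simp add: F_def)
    show ?thesis
      using ra_limit_set_in_inf_subsets[of F M n] fin less.prems
      by (simp add: eq ra_limit_def Let_def)
  qed
qed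

lemma ra_limit_ord:
  assumes "ladder_system lad" "is_limit_ord \<xi>" "M \<in> inf_subsets {1..}"
  shows "ra lad \<xi> M k = ra_limit (\<lambda>n. ra lad (lad \<xi> n)) M k"
proof -
  define F where "F = (\<lambda>n. if lad \<xi> n < \<xi> then ra lad (lad \<xi> n) else undefined)"
  have eq: "ra lad \<xi> = ra_limit F"
    unfolding F_def by (subst ra.simps) (use assms(2) in \<open>auto simp: is_limit_ord_def\<close>)
  have F: "F n = ra lad (lad \<xi> n)" if "n \<ge> 1" for n
    using that ladder_less[OF assms(1,2)] by (simp add: F_def)
  then have fin: "finite (supp (F n L 1))" if "n \<ge> 1" "L \<in> inf_subsets {1..}" for n L
    using that finite_supp_ra[OF assms(1)] by simp
  have "ra_limit_set F M k = ra_limit_set (\<lambda>n. ra lad (lad \<xi> n)) M k"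
    using fin assms(3) F by (rule ra_limit_set_cong)
  moreover have "Inf (ra_limit_set F M k) \<ge> 1"
    using ra_limit_set_in_inf_subsets[of F M k] fin assms(3) by blast
  ultimately show ?thesis
    using F by (simp add: eq ra_limit_def Let_def)
qed


section \<open>Summability and the \<open>\<xi>\<close>-Banach--Saks property\<close>

text \<open>\<open>A \<cdot> H\<close> for \<open>A = a\<close> and \<open>H = (x\<^sub>n)\<^sub>n\<close>.\<close>

definition weighted_sum :: "(nat \<Rightarrow> real) \<Rightarrow> (nat \<Rightarrow> 'a::real_normed_vector) \<Rightarrow> 'a"
  where "weighted_sum a x = (\<Sum>\<^sub>\<infinity>n\<in>{1..}. a n *\<^sub>R x n)"

definition cesaro_summable :: "(nat \<Rightarrow> 'a::real_normed_vector) \<Rightarrow> bool"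
  where "cesaro_summable y \<longleftrightarrow> convergent (\<lambda>n. (1 / real n) *\<^sub>R (\<Sum>k=1..n. y k))"

definition ra_summable :: "(countable_ordinal \<Rightarrow> nat \<Rightarrow> countable_ordinal) \<Rightarrow> nat set \<Rightarrow>
    countable_ordinal \<Rightarrow> (nat \<Rightarrow> 'a::real_normed_vector) \<Rightarrow> bool"
  where "ra_summable lad M \<xi> x \<longleftrightarrow> cesaro_summable (\<lambda>n. weighted_sum (ra lad \<xi> M n) x)"

definition banach_saks :: "(countable_ordinal \<Rightarrow> nat \<Rightarrow> countable_ordinal) \<Rightarrow>
    countable_ordinal \<Rightarrow> 'a::real_normed_vector itself \<Rightarrow> bool"
  where "banach_saks lad \<xi> T \<longleftrightarrow>
    (\<forall>x :: nat \<Rightarrow> 'a. bounded (x ` {1..}) \<longrightarrow> (\<exists>L \<in> inf_subsets {1..}. ra_summable lad L \<xi> x))"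


section \<open>Reflexivity\<close>

definition canonical_embedding :: "'a::real_normed_vector \<Rightarrow> (('a \<Rightarrow>\<^sub>L real) \<Rightarrow>\<^sub>L real)"
  where "canonical_embedding x = Blinfun (\<lambda>f. blinfun_apply f x)"

lemma canonical_embedding_apply [simp]: "blinfun_apply (canonical_embedding x) f = blinfun_apply f x"
  unfolding canonical_embedding_def
  by (simp add: bounded_linear_Blinfun_apply blinfun.bounded_linear_left)

definition reflexive_space :: "'a::real_normed_vector itself \<Rightarrow> bool"
  where "reflexive_space T \<longleftrightarrow> surj (canonical_embedding :: 'a \<Rightarrow> (('a \<Rightarrow>\<^sub>L real) \<Rightarrow>\<^sub>L real))"

end

(*
  For a bounded sequence x let x0 be a weak cluster point and w = x - x0. The key notion is that the
  first averages of order zeta along subsets L of M tend to 0 uniformly as min L grows, tested against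
  a family of functions; for the family of all sequences f(w i), f in the dual ball, this gives (M, zeta)
  summability of x. It passes from xi to every zeta >= xi after shrinking M, and it is implied by the
  same statement for the indicators of the families F(eps) of finite sets on which some f in the dual
  ball satisfies f(w i) >= eps.

  Existence: label w by a countable dense set. The F(eps) then embed into a tree of finite sequences
  whose initial and final segments have separated convex hulls. Reflexivity makes this tree
  well-founded, and an induction along it, with suprema of countably many ordinals, produces one
  countable xi that works for all x.

  Monotonicity: for a hereditary family F of finite sets and any eta, either the averages of order eta
  are uniformly null on F along some M, or some sparse M has all spreads of supports of eta-averages in
  F. If the second alternative holds for some F(eps) and eta = xi + 1, then a subsequence of x is not
  (L, xi) summable for any L. So the xi-Banach-Saks property forces uniform nullity of order xi + 1.
*)
theory Submission
  imports Defs "HOL-Library.Nat_Bijection" "HOL-Library.Sublist"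
begin

section \<open>Structure of the repeated averages\<close>

text \<open>Two obstacles shape the proof. Summability concerns one sequence of averages along one
  set. Uniform nullity speaks of all subsets at once and only of those with large minimum, so it is
  inherited by subsets and ignores finite changes; countably many such conditions can then be met by
  one diagonal set, as limit orders and the parameter eps require. Secondly, one countable order has
  to serve uncountably many sequences. The families F(eps) depend on x and x0, but separation of
  hulls involves only differences u - v, in which x0 cancels. Hence only labels from the dense set
  matter, and one tree for each eps = 1 / (k + 1) and each integer norm bound is enough. The order
  \<xi> + 1 comes from Cesaro means: the averages of order \<xi> with indices from k to 2k - 1 are k
  in number, and k is below the minimum of the set that remains after k averages, so they all live
  on the support of a single average of order \<xi> + 1. The increment is harmless, since every
  order above \<xi> is at least \<xi> + 1.\<close>

lemma inf_subsetsI: "L \<subseteq> N \<Longrightarrow> infinite L \<Longrightarrow> L \<in> inf_subsets N"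
  by (simp add: inf_subsets_def)

lemma inf_subsetsD:
  assumes "L \<in> inf_subsets N"
  shows inf_subsets_subset: "L \<subseteq> N" and inf_subsets_infinite: "infinite L"
    and inf_subsets_nonempty: "L \<noteq> {}"
  using assms by (auto simp: inf_subsets_def)

lemma inf_subsets_trans: "L \<in> inf_subsets M \<Longrightarrow> M \<in> inf_subsets N \<Longrightarrow> L \<in> inf_subsets N"
  by (auto simp: inf_subsets_def)

lemma inf_subsets_refl: "M \<in> inf_subsets N \<Longrightarrow> M \<in> inf_subsets M"
  by (auto simp: inf_subsets_def)

lemma Inf_in_inf_subsets: "L \<in> inf_subsets N \<Longrightarrow> Inf L \<in> (L :: nat set)"
  by (metis Inf_nat_def1 inf_subsets_nonempty)

lemma Inf_nat_le: "i \<in> (L :: nat set) \<Longrightarrow> Inf L \<le> i"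
  by (simp add: wellorder_Inf_le1)

lemma Inf_ge_1: "L \<in> inf_subsets {1..} \<Longrightarrow> 1 \<le> (Inf L :: nat)"
  using Inf_in_inf_subsets inf_subsets_subset by fastforce

lemma ord_cases:
  obtains (zero) "\<xi> = 0" | (succ) \<zeta> where "\<xi> = ord_succ \<zeta>" | (limit) "is_limit_ord \<xi>"
  unfolding is_limit_ord_def is_succ_ord_def by blast

lemma less_ord_succ_iff: "\<xi> < ord_succ \<zeta> \<longleftrightarrow> \<xi> \<le> \<zeta>"
  by (metis not_le ord_succ_le_iff)

locale ladder =
  fixes lad :: "countable_ordinal \<Rightarrow> nat \<Rightarrow> countable_ordinal"
  assumes lad: "ladder_system lad"
begin

definition fst_avg :: "countable_ordinal \<Rightarrow> nat set \<Rightarrow> nat \<Rightarrow> real"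
  where "fst_avg \<xi> L = ra lad \<xi> L 1"

primrec rest :: "countable_ordinal \<Rightarrow> nat set \<Rightarrow> nat \<Rightarrow> nat set"
  where
    "rest \<xi> L 0 = L"
  | "rest \<xi> L (Suc k) = rest \<xi> L k - supp (fst_avg \<xi> (rest \<xi> L k))"

text \<open>The invariant for the induction on \<xi>. By its last conjunct, deleting the first
  support shifts the sequence by one; this turns every average into a first average of a tail
  (\<open>regular_ra\<close>), so that later arguments quantify over first averages of all infinite
  sets.\<close>

definition regular :: "countable_ordinal \<Rightarrow> bool"
  where "regular \<xi> \<longleftrightarrow> (\<forall>L \<in> inf_subsets {1..}.
    (\<exists>b\<ge>Inf L. supp (fst_avg \<xi> L) = L \<inter> {..b}) \<and> (\<forall>i. 0 \<le> fst_avg \<xi> L i) \<and>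
    sum (fst_avg \<xi> L) (supp (fst_avg \<xi> L)) = 1 \<and>
    (\<forall>n\<ge>1. ra lad \<xi> L (Suc n) = ra lad \<xi> (L - supp (fst_avg \<xi> L)) n))"

lemma regular_supp:
  assumes "regular \<xi>" "L \<in> inf_subsets {1..}"
  obtains b where "Inf L \<le> b" "supp (fst_avg \<xi> L) = L \<inter> {..b}"
  using assms unfolding regular_def by blast

text \<open>Each support is a nonempty initial segment of what remains, so the cutting point moves
  up by at least one per step. The growth \<open>Inf L + k\<close> later pushes averages beyond any
  threshold.\<close>

lemma regular_rest:
  assumes "regular \<xi>" "L \<in> inf_subsets {1..}"
  shows "rest \<xi> L k \<in> inf_subsets L \<and> (\<exists>b. rest \<xi> L k = L \<inter> {b..} \<and> b \<ge> Inf L + k)"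
proof (induction k)
  case 0
  then show ?case using assms by (auto simp: inf_subsets_def Inf_nat_le intro!: exI[of _ "Inf L"])
next
  case (Suc k)
  then obtain b where b: "rest \<xi> L k = L \<inter> {b..}" "b \<ge> Inf L + k" by blast
  have R: "rest \<xi> L k \<in> inf_subsets {1..}"
    using Suc assms(2) inf_subsets_trans by blast
  then obtain c where c: "Inf (rest \<xi> L k) \<le> c" "supp (fst_avg \<xi> (rest \<xi> L k)) = rest \<xi> L k \<inter> {..c}"
    using regular_supp[OF assms(1)] by blast
  have "b \<le> c" using Inf_in_inf_subsets[OF R] b c by auto
  have "rest \<xi> L (Suc k) = L \<inter> {b..} - L \<inter> {b..} \<inter> {..c}"
    by (simp only: rest.simps b(1) c(2)[unfolded b(1)])
  also have "\<dots> = L \<inter> {Suc c..}"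
    using \<open>b \<le> c\<close> by auto
  finally have eq: "rest \<xi> L (Suc k) = L \<inter> {Suc c..}" .
  have "infinite (L - {..c})"
    using assms(2) by (simp add: inf_subsets_def)
  moreover have "L - {..c} = L \<inter> {Suc c..}" by auto
  ultimately show ?case
    using b \<open>b \<le> c\<close> unfolding eq inf_subsets_def by (intro conjI exI[of _ "Suc c"]) auto
qed

lemma regular_ra:
  assumes "regular \<xi>" "L \<in> inf_subsets {1..}" "n \<ge> 1"
  shows "ra lad \<xi> L (k + n) = ra lad \<xi> (rest \<xi> L k) n"
  using assms(3)
proof (induction k arbitrary: n)
  case (Suc k)
  have R: "rest \<xi> L k \<in> inf_subsets {1..}"
    using regular_rest[OF assms(1,2)] assms(2) inf_subsets_trans by blast
  have "ra lad \<xi> L (Suc k + n) = ra lad \<xi> (rest \<xi> L k) (Suc n)"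
    using Suc.IH[of "Suc n"] by simp
  also have "\<dots> = ra lad \<xi> (rest \<xi> L (Suc k)) n"
    using assms(1) R Suc.prems unfolding regular_def by simp
  finally show ?case .
qed simp

lemma regular_Inf_supp:
  assumes "regular \<xi>" "L \<in> inf_subsets {1..}"
  shows "Inf (supp (fst_avg \<xi> L)) = Inf L"
proof -
  obtain b where b: "Inf L \<le> b" "supp (fst_avg \<xi> L) = L \<inter> {..b}"
    using regular_supp[OF assms] .
  then have "Inf L \<in> supp (fst_avg \<xi> L)"
    using Inf_in_inf_subsets[OF assms(2)] by simp
  moreover have "Inf L \<le> i" if "i \<in> supp (fst_avg \<xi> L)" for i
    using that b Inf_nat_le by simp
  ultimately show ?thesis by (rule cInf_eq_minimum)
qed

lemma fst_avg_zero: "fst_avg 0 L = indicator {Inf L}"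
  by (simp add: fst_avg_def ra_0 enumerate_0 Inf_nat_def)

lemma regular_zero: "regular 0"
  unfolding regular_def
proof (intro ballI conjI allI impI)
  fix L :: "nat set" assume L: "L \<in> inf_subsets {1..}"
  have s: "supp (fst_avg 0 L) = {Inf L}"
    by (auto simp: fst_avg_zero supp_def indicator_def)
  show "\<exists>b\<ge>Inf L. supp (fst_avg 0 L) = L \<inter> {..b}"
    using Inf_in_inf_subsets[OF L] Inf_nat_le[of _ L] unfolding s
    by (intro exI[of _ "Inf L"]) force
  show "0 \<le> fst_avg 0 L i" for i by (simp add: fst_avg_zero)
  show "sum (fst_avg 0 L) (supp (fst_avg 0 L)) = 1" unfolding s by (simp add: fst_avg_zero)
  fix n :: nat assume n: "n \<ge> 1"
  have "enumerate L n = enumerate (L - {Inf L}) (n - 1)"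
    using enumerate_Suc[of L "n - 1"] n by (simp add: Inf_nat_def)
  then show "ra lad 0 L (Suc n) = ra lad 0 (L - supp (fst_avg 0 L)) n"
    unfolding s by (auto simp: ra_0)
qed

lemma fst_avg_succ:
  assumes "regular \<zeta>" "L \<in> inf_subsets {1..}"
  shows "fst_avg (ord_succ \<zeta>) L i = (\<Sum>j<Inf L. fst_avg \<zeta> (rest \<zeta> L j) i) / real (Inf L)"
proof -
  have "fst_avg (ord_succ \<zeta>) L i = (\<Sum>j=1..Inf L. ra lad \<zeta> L j i) / real (Inf L)"
    using regular_Inf_supp[OF assms] by (simp add: fst_avg_def ra_ord_succ ra_succ_def Let_def)
  also have "(\<Sum>j=1..Inf L. ra lad \<zeta> L j i) = (\<Sum>j<Inf L. ra lad \<zeta> L (Suc j) i)"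
    by (simp add: sum.atLeast_Suc_atMost_Suc_shift sum.atLeast1_atMost_eq)
  also have "\<dots> = (\<Sum>j<Inf L. fst_avg \<zeta> (rest \<zeta> L j) i)"
    using regular_ra[OF assms, of 1] by (simp add: fst_avg_def)
  finally show ?thesis .
qed

lemma in_rest_if_in_supp:
  assumes "i \<in> supp (fst_avg \<xi> (rest \<xi> L k))" "regular \<xi>" "L \<in> inf_subsets {1..}"
  shows "i \<in> rest \<xi> L k"
proof -
  have "rest \<xi> L k \<in> inf_subsets {1..}"
    using regular_rest[OF assms(2,3)] assms(3) inf_subsets_trans by blast
  then show ?thesis using assms(1) regular_supp[OF assms(2)] by blast
qed

lemma Un_supp_avg:
  assumes "regular \<xi>" "L \<in> inf_subsets {1..}"
  shows "(\<Union>j<k. supp (fst_avg \<xi> (rest \<xi> L j))) = L - rest \<xi> L k"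
proof (induction k)
  case (Suc k)
  have "supp (fst_avg \<xi> (rest \<xi> L k)) \<subseteq> rest \<xi> L k"
    using in_rest_if_in_supp[OF _ assms] by blast
  moreover have "rest \<xi> L k \<subseteq> L"
    using regular_rest[OF assms] inf_subsets_subset by blast
  ultimately show ?case using Suc by (auto simp: lessThan_Suc)
qed simp

lemma supp_fst_avg_succ:
  assumes "regular \<zeta>" "L \<in> inf_subsets {1..}"
  shows "supp (fst_avg (ord_succ \<zeta>) L) = (\<Union>j<Inf L. supp (fst_avg \<zeta> (rest \<zeta> L j)))"
proof -
  have pos: "Inf L \<ge> 1" using assms(2) by (rule Inf_ge_1)
  have nonneg: "0 \<le> fst_avg \<zeta> (rest \<zeta> L j) i" for i j
    using assms regular_rest[OF assms] inf_subsets_trans unfolding regular_def by blast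
  have "fst_avg (ord_succ \<zeta>) L i = 0 \<longleftrightarrow> (\<forall>j<Inf L. fst_avg \<zeta> (rest \<zeta> L j) i = 0)" for i
    using pos nonneg by (auto simp: fst_avg_succ[OF assms] sum_nonneg_eq_0_iff)
  then show ?thesis by (auto simp: supp_def)
qed

text \<open>The first average of the successor order uses up exactly the first \<open>Inf L\<close>
  averages of order \<zeta>, so the set that remains is a \<open>rest\<close> of order \<zeta>, on
  which the following averages can be computed.\<close>

lemma regular_succ:
  assumes reg: "regular \<zeta>"
  shows "regular (ord_succ \<zeta>)"
  unfolding regular_def
proof (intro ballI conjI allI impI)
  fix L :: "nat set" assume L: "L \<in> inf_subsets {1..}"
  let ?s = "Inf L" and ?A = "\<lambda>j. fst_avg \<zeta> (rest \<zeta> L j)"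
  have R: "rest \<zeta> L j \<in> inf_subsets {1..}" for j
    using regular_rest[OF reg L] L inf_subsets_trans by blast
  have pos: "?s \<ge> 1" using L by (rule Inf_ge_1)
  have s: "supp (fst_avg (ord_succ \<zeta>) L) = L - rest \<zeta> L ?s"
    by (simp add: supp_fst_avg_succ[OF reg L] Un_supp_avg[OF reg L])
  obtain b where b: "rest \<zeta> L ?s = L \<inter> {b..}" "b \<ge> ?s + ?s"
    using regular_rest[OF reg L] by blast
  show "\<exists>b\<ge>?s. supp (fst_avg (ord_succ \<zeta>) L) = L \<inter> {..b}"
  proof (intro exI[of _ "b - 1"] conjI)
    show "?s \<le> b - 1" using b(2) pos by linarith
    show "supp (fst_avg (ord_succ \<zeta>) L) = L \<inter> {..b - 1}"
      unfolding s b(1) using b(2) pos by (auto simp: not_le)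
  qed
  show "0 \<le> fst_avg (ord_succ \<zeta>) L i" for i
    using reg R by (simp add: fst_avg_succ[OF reg L] regular_def sum_nonneg)
  let ?U = "\<Union>j<?s. supp (?A j)"
  have fin: "finite (supp (?A j))" for j
    using regular_supp[OF reg R[of j]] by (metis finite_Int finite_atMost)
  have "sum (fst_avg (ord_succ \<zeta>) L) ?U = (\<Sum>j<?s. sum (?A j) ?U) / real ?s"
    by (subst sum.swap) (simp add: fst_avg_succ[OF reg L] sum_divide_distrib)
  also have "(\<Sum>j<?s. sum (?A j) ?U) = (\<Sum>j<?s. sum (?A j) (supp (?A j)))"
    using fin by (intro sum.cong refl sum.mono_neutral_right) (auto simp: supp_def)
  also have "\<dots> = real ?s"
    using reg R by (simp add: regular_def)
  finally show "sum (fst_avg (ord_succ \<zeta>) L) (supp (fst_avg (ord_succ \<zeta>) L)) = 1"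
    using pos by (simp add: supp_fst_avg_succ[OF reg L])
  fix n :: nat assume n: "n \<ge> 1"
  let ?z = "ra lad \<zeta> L" and ?L = "rest \<zeta> L ?s"
  have L': "L - supp (fst_avg (ord_succ \<zeta>) L) = ?L"
    using regular_rest[OF reg L, of ?s] inf_subsets_subset unfolding s by blast
  let ?z' = "ra lad \<zeta> ?L"
  have z': "?z' m = ?z (?s + m)" if "m \<ge> 1" for m
    using regular_ra[OF reg L that] by simp
  \<comment> \<open>From the second block on, the block indices along \<open>L\<close> are those
    along \<open>?L\<close>, shifted by the \<open>?s\<close> averages of the first block. The case
    \<open>m = 0\<close> is excluded because \<open>ra_succ_idx\<close> has a dummy value at
    0.\<close>
  have idx: "ra_succ_idx ?z (Suc m) = ?s + ra_succ_idx ?z' m" if "m \<ge> 1" for m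
    using that
  proof (induction m rule: dec_induct)
    case base
    show ?case using regular_Inf_supp[OF reg L] by (simp add: fst_avg_def)
  next
    case (step m)
    then obtain m' where m': "m = Suc m'" by (cases m) auto
    show ?case using step unfolding m' by (simp add: z')
  qed
  show "ra lad (ord_succ \<zeta>) L (Suc n) = ra lad (ord_succ \<zeta>) (L - supp (fst_avg (ord_succ \<zeta>) L)) n"
    unfolding L' by (simp add: ra_ord_succ ra_succ_def idx[OF n] z' Let_def add.assoc cong: sum.cong_simp)
qed

lemma fst_avg_limit:
  assumes "is_limit_ord \<xi>" "L \<in> inf_subsets {1..}"
  shows "fst_avg \<xi> L = fst_avg (lad \<xi> (Inf L)) L"
  by (simp add: fst_avg_def ra_limit_ord[OF lad assms] ra_limit_def)

text \<open>At a limit, the order of each average is read off the minimum of the current remainder.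
  So the first average inherits its properties from one ladder order below \<xi>, and the shift
  holds because the limit recursion restarts on the remainder.\<close>

lemma regular_limit:
  assumes lim: "is_limit_ord \<xi>" and reg: "\<And>\<zeta>. \<zeta> < \<xi> \<Longrightarrow> regular \<zeta>"
  shows "regular \<xi>"
  unfolding regular_def
proof (intro ballI)
  fix L :: "nat set" assume L: "L \<in> inf_subsets {1..}"
  let ?F = "\<lambda>n. ra lad (lad \<xi> n)" and ?L = "L - supp (fst_avg \<xi> L)"
  have reg': "regular (lad \<xi> (Inf L))"
    using ladder_less[OF lad lim Inf_ge_1[OF L]] by (rule reg)
  have fa: "fst_avg \<xi> L = fst_avg (lad \<xi> (Inf L)) L"
    using fst_avg_limit[OF lim L] .
  then have L': "?L \<in> inf_subsets {1..}"
    using regular_rest[OF reg' L, of 1] L inf_subsets_trans by simp blast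
  have lset: "ra_limit_set ?F L (Suc n) = ra_limit_set ?F ?L n" if "n \<ge> 1" for n
    using that
  proof (induction n rule: dec_induct)
    case base
    show ?case unfolding fa by (simp add: fst_avg_def)
  next
    case (step m)
    then obtain m' where m': "m = Suc m'" by (cases m) auto
    show ?case using step unfolding m' by (simp add: Let_def)
  qed
  have "ra lad \<xi> L (Suc n) = ra lad \<xi> ?L n" if "n \<ge> 1" for n
    using lset[OF that] by (simp add: ra_limit_ord[OF lad lim L] ra_limit_ord[OF lad lim L'] ra_limit_def)
  moreover have "(\<exists>b\<ge>Inf L. supp (fst_avg \<xi> L) = L \<inter> {..b}) \<and> (\<forall>i. 0 \<le> fst_avg \<xi> L i) \<and>
    sum (fst_avg \<xi> L) (supp (fst_avg \<xi> L)) = 1"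
    using reg' L unfolding fa regular_def by blast
  ultimately show "(\<exists>b\<ge>Inf L. supp (fst_avg \<xi> L) = L \<inter> {..b}) \<and> (\<forall>i. 0 \<le> fst_avg \<xi> L i) \<and>
    sum (fst_avg \<xi> L) (supp (fst_avg \<xi> L)) = 1 \<and>
    (\<forall>n\<ge>1. ra lad \<xi> L (Suc n) = ra lad \<xi> ?L n)" by blast
qed

lemma regular: "regular \<xi>"
proof (induction \<xi> rule: less_induct)
  case (less \<xi>)
  show ?case
    by (cases \<xi> rule: ord_cases) (use less less_ord_succ regular_zero regular_succ regular_limit in auto)
qed

section \<open>Consequences of regularity at every order\<close>

lemma rest_in_inf_subsets: "L \<in> inf_subsets {1..} \<Longrightarrow> rest \<xi> L k \<in> inf_subsets L"
  using regular_rest[OF regular] by blast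

lemma rest_in_inf_subsets': "L \<in> inf_subsets {1..} \<Longrightarrow> rest \<xi> L k \<in> inf_subsets {1..}"
  using rest_in_inf_subsets inf_subsets_trans by blast

lemma Inf_rest_ge: "L \<in> inf_subsets {1..} \<Longrightarrow> Inf L + k \<le> Inf (rest \<xi> L k)"
  using regular_rest[OF regular, of L \<xi> k] Inf_in_inf_subsets[of "rest \<xi> L k" L] by auto

lemma ra_eq_fst_avg: "L \<in> inf_subsets {1..} \<Longrightarrow> ra lad \<xi> L (Suc k) = fst_avg \<xi> (rest \<xi> L k)"
  using regular_ra[OF regular, of L 1 \<xi> k] by (simp add: fst_avg_def)

lemma supp_fst_avg:
  assumes "L \<in> inf_subsets {1..}"
  obtains b where "Inf L \<le> b" "supp (fst_avg \<xi> L) = L \<inter> {..b}"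
  using regular_supp[OF regular assms] .

lemma finite_supp_fst_avg [simp]: "L \<in> inf_subsets {1..} \<Longrightarrow> finite (supp (fst_avg \<xi> L))"
  using supp_fst_avg by (metis finite_Int finite_atMost)

lemma supp_fst_avg_subset: "L \<in> inf_subsets {1..} \<Longrightarrow> supp (fst_avg \<xi> L) \<subseteq> L"
  using supp_fst_avg by (metis Int_lower1)

lemma Inf_in_supp_fst_avg: "L \<in> inf_subsets {1..} \<Longrightarrow> Inf L \<in> supp (fst_avg \<xi> L)"
  using supp_fst_avg Inf_in_inf_subsets by (metis IntI atMost_iff)

lemma fst_avg_nonneg [simp]: "L \<in> inf_subsets {1..} \<Longrightarrow> 0 \<le> fst_avg \<xi> L i"
  using regular unfolding regular_def by blast

lemma sum_fst_avg: "L \<in> inf_subsets {1..} \<Longrightarrow> sum (fst_avg \<xi> L) (supp (fst_avg \<xi> L)) = 1"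
  using regular unfolding regular_def by blast

lemma supp_fst_avg_less_rest:
  assumes L: "L \<in> inf_subsets {1..}" and "j < k"
    and "i \<in> supp (fst_avg \<xi> (rest \<xi> L j))" "i' \<in> rest \<xi> L k"
  shows "i < i'"
proof -
  obtain b where b: "rest \<xi> L k = L \<inter> {b..}"
    using regular_rest[OF regular L, of \<xi> k] by blast
  have "i \<in> L - rest \<xi> L k"
    using Un_supp_avg[OF regular L, of \<xi> k] assms by blast
  moreover have "b \<le> i'"
    using assms(4) unfolding b by simp
  ultimately show ?thesis unfolding b by auto
qed

end

section \<open>Uniformly null averages\<close>

text \<open>A new element is related to all numbers up to the preceding element, not only to the
  chosen ones. The next choice thus depends on the last element alone, and iterating one function
  \<open>g\<close> suffices.\<close>

lemma greedy_subset:
  fixes M :: "nat set"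
  assumes "\<And>n. \<exists>m>n. m \<in> M \<and> (\<forall>i\<le>n. R i m)"
  obtains M' where "M' \<in> inf_subsets M" "\<And>a b. a \<in> M' \<Longrightarrow> b \<in> M' \<Longrightarrow> a < b \<Longrightarrow> R a b"
proof -
  obtain g where g: "\<And>n. n < g n" "\<And>n. g n \<in> M" "\<And>n i. i \<le> n \<Longrightarrow> R i (g n)"
    using assms by metis
  define f where "f = rec_nat (g 0) (\<lambda>_. g)"
  have f_Suc: "f (Suc n) = g (f n)" for n by (simp add: f_def)
  have mono: "strict_mono f" by (rule strict_monoI_Suc) (simp add: f_Suc g)
  have "f n \<in> M" for n by (cases n) (auto simp: f_def g)
  moreover have "infinite (range f)"
    using mono strict_mono_imp_inj_on finite_imageD by blast
  ultimately have "range f \<in> inf_subsets M" by (auto intro: inf_subsetsI)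
  moreover have "R (f i) (f j)" if "f i < f j" for i j
  proof -
    have "i < j" using that mono strict_mono_less by blast
    then obtain j' where "j = Suc j'" "i \<le> j'" by (cases j) auto
    then show ?thesis using g(3) mono by (simp add: f_Suc strict_mono_less_eq)
  qed
  ultimately show thesis using that[of "range f"] by blast
qed

lemma sparse_subset:
  fixes M :: "nat set"
  assumes "infinite M" "\<And>i. \<exists>h. \<forall>m\<ge>h. R i m"
  obtains M' where "M' \<in> inf_subsets M" "\<And>a b. a \<in> M' \<Longrightarrow> b \<in> M' \<Longrightarrow> a < b \<Longrightarrow> R a b"
proof (rule greedy_subset)
  fix n
  obtain h where h: "\<And>i m. h i \<le> m \<Longrightarrow> R i m" using assms(2) by metis
  obtain m where m: "m \<in> M" "m > n + Max (h ` {..n})"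
    using assms(1) infinite_nat_iff_unbounded by blast
  have "h i \<le> m" if "i \<le> n" for i
  proof -
    have "h i \<le> Max (h ` {..n})" using that by simp
    then show ?thesis using m(2) by linarith
  qed
  then show "\<exists>m>n. m \<in> M \<and> (\<forall>i\<le>n. R i m)" using m h by (intro exI[of _ m]) auto
qed blast

lemma pseudo_intersection_decreasing:
  fixes N :: "nat \<Rightarrow> nat set"
  assumes "\<And>n. N (Suc n) \<subseteq> N n" "\<And>n. infinite (N n)"
  obtains M' where "M' \<in> inf_subsets (N 0)" "\<And>n. finite (M' - N n)"
proof -
  have dec: "N n \<subseteq> N m" if "m \<le> n" for m n
    using assms(1) that by (metis lift_Suc_antimono_le)
  have "\<exists>m>n. m \<in> N 0 \<and> (\<forall>i\<le>n. m \<in> N i)" for n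
    using assms(2)[of n] dec infinite_nat_iff_unbounded by (metis in_mono zero_le)
  \<comment> \<open>The stages are indexed by the elements of \<open>M'\<close>: everything after
    \<open>a\<close> lies in \<open>N a\<close>, so only elements up to some \<open>a > n\<close>
    can miss \<open>N n\<close>.\<close>
  then obtain M' where M': "M' \<in> inf_subsets (N 0)" "\<And>a b. a \<in> M' \<Longrightarrow> b \<in> M' \<Longrightarrow> a < b \<Longrightarrow> b \<in> N a"
    using greedy_subset[of "N 0" "\<lambda>i m. m \<in> N i"] by metis
  have "finite (M' - N n)" for n
  proof -
    obtain a where a: "a \<in> M'" "a > n"
      using inf_subsets_infinite[OF M'(1)] infinite_nat_iff_unbounded by blast
    have "M' - N n \<subseteq> {..a}"
    proof
      fix b assume b: "b \<in> M' - N n"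
      show "b \<in> {..a}"
      proof (rule ccontr)
        assume "b \<notin> {..a}"
        then have "b \<in> N a" using M'(2) a b by auto
        then show False using dec[of n a] a b by auto
      qed
    qed
    then show ?thesis using finite_subset by blast
  qed
  then show thesis using that M' by blast
qed

text \<open>The diagonal set is only almost contained in each stage, hence the heredity under finite
  differences. This device meets countably many conditions at once wherever orders, finite sets,
  labels or tolerances are enumerated.\<close>

lemma pseudo_intersection:
  fixes P :: "nat \<Rightarrow> nat set \<Rightarrow> bool"
  assumes inf: "infinite M"
    and hered: "\<And>n M1 M2. P n M1 \<Longrightarrow> M1 \<in> inf_subsets M \<Longrightarrow> M2 \<in> inf_subsets M \<Longrightarrow> finite (M2 - M1) \<Longrightarrow> P n M2"
    and dense: "\<And>n M1. M1 \<in> inf_subsets M \<Longrightarrow> \<exists>M2 \<in> inf_subsets M1. P n M2"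
  obtains M' where "M' \<in> inf_subsets M" "\<And>n. P n M'"
proof -
  have M: "M \<in> inf_subsets M" using inf by (simp add: inf_subsets_def)
  have "\<exists>N. \<forall>n. (N n \<in> inf_subsets M \<and> P n (N n)) \<and> N (Suc n) \<subseteq> N n"
  proof (rule dependent_nat_choice)
    show "\<exists>x. x \<in> inf_subsets M \<and> P 0 x" using dense[OF M] by blast
  next
    fix x n assume "x \<in> inf_subsets M \<and> P n x"
    then show "\<exists>y. (y \<in> inf_subsets M \<and> P (Suc n) y) \<and> y \<subseteq> x"
      using dense[of x "Suc n"] inf_subsets_trans[of _ x M] inf_subsets_subset by metis
  qed
  then obtain N where N: "\<And>n. N n \<in> inf_subsets M" "\<And>n. P n (N n)" "\<And>n. N (Suc n) \<subseteq> N n"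
    by blast
  obtain M' where M': "M' \<in> inf_subsets (N 0)" "\<And>n. finite (M' - N n)"
    using pseudo_intersection_decreasing[of N] N inf_subsets_infinite by metis
  have "M' \<in> inf_subsets M" using M'(1) N(1) inf_subsets_trans by blast
  then show thesis using that hered N M' by blast
qed

section \<open>Averages paired with functions, and uniform nullity\<close>

definition pairing :: "(nat \<Rightarrow> real) \<Rightarrow> (nat \<Rightarrow> real) \<Rightarrow> real"
  where "pairing a g = (\<Sum>i\<in>supp a. a i * g i)"

lemma pairing_eq: "finite B \<Longrightarrow> supp a \<subseteq> B \<Longrightarrow> pairing a g = (\<Sum>i\<in>B. a i * g i)"
  unfolding pairing_def by (rule sum.mono_neutral_left) (auto simp: supp_def)

lemma pairing_cong: "(\<And>i. i \<in> supp a \<Longrightarrow> g i = h i) \<Longrightarrow> pairing a g = pairing a h"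
  unfolding pairing_def by (rule sum.cong) auto

context ladder
begin

lemma pairing_succ:
  assumes L: "L \<in> inf_subsets {1..}"
  shows "pairing (fst_avg (ord_succ \<zeta>) L) g =
    (\<Sum>j<Inf L. pairing (fst_avg \<zeta> (rest \<zeta> L j)) g) / real (Inf L)"
proof -
  let ?A = "\<lambda>j. fst_avg \<zeta> (rest \<zeta> L j)"
  let ?U = "\<Union>j<Inf L. supp (?A j)"
  have fin: "finite ?U" using rest_in_inf_subsets'[OF L] by simp
  have "pairing (fst_avg (ord_succ \<zeta>) L) g = (\<Sum>i\<in>?U. (\<Sum>j<Inf L. ?A j i * g i) / real (Inf L))"
    unfolding pairing_def supp_fst_avg_succ[OF regular L] fst_avg_succ[OF regular L]
    by (simp add: sum_distrib_right)
  also have "\<dots> = (\<Sum>j<Inf L. \<Sum>i\<in>?U. ?A j i * g i) / real (Inf L)"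
    by (subst sum.swap) (simp add: sum_divide_distrib)
  also have "(\<Sum>j<Inf L. \<Sum>i\<in>?U. ?A j i * g i) = (\<Sum>j<Inf L. pairing (?A j) g)"
    using fin by (intro sum.cong refl pairing_eq[symmetric]) auto
  finally show ?thesis .
qed

lemma pairing_fst_avg_le:
  assumes L: "L \<in> inf_subsets {1..}" and "\<And>i. i \<in> supp (fst_avg \<zeta> L) \<Longrightarrow> g i \<le> C"
  shows "pairing (fst_avg \<zeta> L) g \<le> C"
proof -
  have "pairing (fst_avg \<zeta> L) g \<le> (\<Sum>i\<in>supp (fst_avg \<zeta> L). fst_avg \<zeta> L i * C)"
    unfolding pairing_def using assms by (intro sum_mono mult_left_mono) auto
  also have "\<dots> = C" using sum_fst_avg[OF L] by (simp flip: sum_distrib_right)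
  finally show ?thesis .
qed

text \<open>A one-sided estimate suffices: the pairing with an indicator is nonnegative, and the
  dual ball is symmetric.\<close>

definition unif_null :: "countable_ordinal \<Rightarrow> nat set \<Rightarrow> (nat \<Rightarrow> real) set \<Rightarrow> bool"
  where "unif_null \<zeta> M \<Phi> \<longleftrightarrow> (\<forall>e>0. \<exists>h. \<forall>L \<in> inf_subsets M. h \<le> Inf L \<longrightarrow>
    (\<forall>g\<in>\<Phi>. pairing (fst_avg \<zeta> L) g \<le> e))"

lemma unif_nullE:
  assumes "unif_null \<zeta> M \<Phi>" "e > 0"
  obtains h where "\<And>L g. L \<in> inf_subsets M \<Longrightarrow> h \<le> Inf L \<Longrightarrow> g \<in> \<Phi> \<Longrightarrow> pairing (fst_avg \<zeta> L) g \<le> e"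
  using assms unfolding unif_null_def by metis

lemma unif_null_mono:
  assumes null: "unif_null \<zeta> M \<Phi>" and fin: "finite (M' - M)" and "\<Phi>' \<subseteq> \<Phi>"
  shows "unif_null \<zeta> M' \<Phi>'"
  unfolding unif_null_def
proof (intro allI impI)
  fix e :: real assume "e > 0"
  then obtain h where h: "\<And>L g. L \<in> inf_subsets M \<Longrightarrow> h \<le> Inf L \<Longrightarrow> g \<in> \<Phi> \<Longrightarrow> pairing (fst_avg \<zeta> L) g \<le> e"
    using unif_nullE[OF null] by blast
  obtain b where b: "\<And>i. i \<in> M' - M \<Longrightarrow> i < b"
    using fin[unfolded finite_nat_set_iff_bounded] by blast
  have "L \<in> inf_subsets M" if "L \<in> inf_subsets M'" "b \<le> Inf L" for L
  proof (rule inf_subsetsI)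
    show "infinite L" using that(1) by (rule inf_subsets_infinite)
    show "L \<subseteq> M"
    proof
      fix i assume i: "i \<in> L"
      then have "b \<le> i" "i \<in> M'"
        using that Inf_nat_le[OF i] inf_subsets_subset[OF that(1)] by auto
      then show "i \<in> M" using b[of i] by fastforce
    qed
  qed
  then show "\<exists>h. \<forall>L \<in> inf_subsets M'. h \<le> Inf L \<longrightarrow> (\<forall>g\<in>\<Phi>'. pairing (fst_avg \<zeta> L) g \<le> e)"
    using h \<open>\<Phi>' \<subseteq> \<Phi>\<close> by (intro exI[of _ "max h b"]) auto
qed

lemma unif_null_subset: "unif_null \<zeta> M \<Phi> \<Longrightarrow> M' \<in> inf_subsets M \<Longrightarrow> unif_null \<zeta> M' \<Phi>"
  by (rule unif_null_mono) (auto simp: inf_subsets_def Diff_eq_empty_iff[THEN iffD2])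

text \<open>Averages of successor order lead to bounds of this form: \<open>Inf L\<close> averages
  with total at most \<open>C\<close> are divided by their number.\<close>

lemma unif_nullI:
  assumes "C \<ge> 0"
    and "\<And>L g. L \<in> inf_subsets M \<Longrightarrow> n1 \<le> Inf L \<Longrightarrow> g \<in> \<Phi> \<Longrightarrow> pairing (fst_avg \<zeta> L) g \<le> C / real (Inf L)"
  shows "unif_null \<zeta> M \<Phi>"
  unfolding unif_null_def
proof (intro allI impI)
  fix e :: real assume "e > 0"
  obtain h where h: "C / e < real h" using reals_Archimedean2 by blast
  have "C / real n \<le> e" if "max 1 h \<le> n" for n
  proof -
    have "C / e \<le> real n" using h that by linarith
    then show ?thesis using \<open>e > 0\<close> that by (simp add: field_simps)
  qed
  then show "\<exists>h. \<forall>L \<in> inf_subsets M. h \<le> Inf L \<longrightarrow> (\<forall>g\<in>\<Phi>. pairing (fst_avg \<zeta> L) g \<le> e)"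
    using assms(2) by (intro exI[of _ "max n1 (max 1 h)"]) (fastforce intro: order_trans)
qed

lemma unif_null_succ:
  assumes M: "M \<in> inf_subsets {1..}" and null: "unif_null \<zeta> M \<Phi>"
  shows "unif_null (ord_succ \<zeta>) M \<Phi>"
  unfolding unif_null_def
proof (intro allI impI)
  fix e :: real assume "e > 0"
  then obtain h where h: "\<And>L g. L \<in> inf_subsets M \<Longrightarrow> h \<le> Inf L \<Longrightarrow> g \<in> \<Phi> \<Longrightarrow> pairing (fst_avg \<zeta> L) g \<le> e"
    using unif_nullE[OF null] by blast
  have "pairing (fst_avg (ord_succ \<zeta>) L) g \<le> e"
    if L: "L \<in> inf_subsets M" "h \<le> Inf L" and g: "g \<in> \<Phi>" for L g
  proof -
    have L1: "L \<in> inf_subsets {1..}" using L M inf_subsets_trans by blast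
    have "pairing (fst_avg \<zeta> (rest \<zeta> L j)) g \<le> e" for j
    proof (rule h[OF _ _ g])
      show "rest \<zeta> L j \<in> inf_subsets M" using rest_in_inf_subsets[OF L1] L inf_subsets_trans by blast
      show "h \<le> Inf (rest \<zeta> L j)" using Inf_rest_ge[OF L1, of j \<zeta>] L by linarith
    qed
    then have "(\<Sum>j<Inf L. pairing (fst_avg \<zeta> (rest \<zeta> L j)) g) \<le> of_nat (card {..<Inf L}) * e"
      by (intro sum_bounded_above) auto
    then show ?thesis
      unfolding pairing_succ[OF L1] using Inf_ge_1[OF L1] by (simp add: field_simps)
  qed
  then show "\<exists>h. \<forall>L \<in> inf_subsets M. h \<le> Inf L \<longrightarrow> (\<forall>g\<in>\<Phi>. pairing (fst_avg (ord_succ \<zeta>) L) g \<le> e)"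
    by blast
qed

lemma limit_ladder_above:
  assumes lim: "is_limit_ord \<zeta>" and "\<xi> < \<zeta>"
  obtains n1 \<eta> where "n1 \<ge> 1" "\<And>n. n \<ge> n1 \<Longrightarrow> lad \<zeta> n = ord_succ (\<eta> n) \<and> \<xi> \<le> \<eta> n \<and> \<eta> n < \<zeta>"
proof -
  obtain n1 where n1: "n1 \<ge> 1" "\<xi> < lad \<zeta> n1"
    using lad assms unfolding ladder_system_def by (meson not_le)
  have "\<exists>\<eta>. lad \<zeta> n = ord_succ \<eta> \<and> \<xi> \<le> \<eta> \<and> \<eta> < \<zeta>" if "n \<ge> n1" for n
  proof -
    have "lad \<zeta> n1 \<le> lad \<zeta> n"
      using lad lim n1 that unfolding ladder_system_def strict_mono_on_def
      by (metis atLeast_iff le_trans less_imp_le order_le_less)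
    moreover obtain \<eta> where \<eta>: "lad \<zeta> n = ord_succ \<eta>"
    proof -
      have "is_succ_ord (lad \<zeta> n)"
        using lad lim n1(1) \<open>n \<ge> n1\<close> unfolding ladder_system_def by (meson le_trans)
      then show thesis using that unfolding is_succ_ord_def by blast
    qed
    moreover have "lad \<zeta> n < \<zeta>" using ladder_less[OF lad lim] n1 that by simp
    ultimately show ?thesis
      using n1 less_ord_succ[of \<eta>] by (metis less_le_trans less_ord_succ_iff less_trans)
  qed
  then obtain \<eta> where "\<And>n. n \<ge> n1 \<Longrightarrow> lad \<zeta> n = ord_succ (\<eta> n) \<and> \<xi> \<le> \<eta> n \<and> \<eta> n < \<zeta>"
    by metis
  then show thesis using that n1 by blast
qed

text \<open>In the limit case an average of order \<zeta> along a set with large minimum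
  \<open>n\<close> is a mean of \<open>n\<close> averages of order \<open>\<eta> n\<close>. The
  threshold for nullity of order \<open>\<eta> n\<close> varies with \<open>n\<close>, so the set is
  thinned until the elements after \<open>n\<close> lie beyond that threshold.\<close>

lemma unif_null_increasing:
  assumes "\<xi> \<le> \<zeta>" "M \<in> inf_subsets {1..}" "unif_null \<xi> M \<Phi>"
    and C: "\<And>g i. g \<in> \<Phi> \<Longrightarrow> g i \<le> C"
  shows "\<exists>M' \<in> inf_subsets M. unif_null \<zeta> M' \<Phi>"
  using assms(1-3)
proof (induction \<zeta> arbitrary: M rule: less_induct)
  case (less \<zeta>)
  note M = less.prems(2)
  show ?case
  proof (cases "\<zeta> = \<xi>")
    case True
    then show ?thesis using less inf_subsets_refl by blast
  next
    case False
    then have "\<xi> < \<zeta>" using less by simp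
    show ?thesis
    proof (cases \<zeta> rule: ord_cases)
      case zero
      then show ?thesis using \<open>\<xi> < \<zeta>\<close> zero_le_countable_ordinal not_le by blast
    next
      case (succ \<eta>)
      then obtain M' where "M' \<in> inf_subsets M" "unif_null \<eta> M' \<Phi>"
        using less \<open>\<xi> < \<zeta>\<close> less_ord_succ less_ord_succ_iff by metis
      then show ?thesis
        using succ unif_null_succ[of M'] inf_subsets_trans[OF _ M] by blast
    next
      case limit
      obtain n1 \<eta> where \<eta>: "n1 \<ge> 1" "\<And>n. n \<ge> n1 \<Longrightarrow> lad \<zeta> n = ord_succ (\<eta> n) \<and> \<xi> \<le> \<eta> n \<and> \<eta> n < \<zeta>"
        using limit_ladder_above[OF limit \<open>\<xi> < \<zeta>\<close>] by metis
      obtain M1 where M1: "M1 \<in> inf_subsets M" "\<And>n. n \<ge> n1 \<longrightarrow> unif_null (\<eta> n) M1 \<Phi>"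
      proof (rule pseudo_intersection[of M "\<lambda>n M'. n \<ge> n1 \<longrightarrow> unif_null (\<eta> n) M' \<Phi>"])
        show "infinite M" using M by (simp add: inf_subsets_def)
        show "n \<ge> n1 \<longrightarrow> unif_null (\<eta> n) M2 \<Phi>"
          if "n \<ge> n1 \<longrightarrow> unif_null (\<eta> n) M1 \<Phi>" "finite (M2 - M1)" for n M1 M2
          using that unif_null_mono by blast
        show "\<exists>M2 \<in> inf_subsets M1. n \<ge> n1 \<longrightarrow> unif_null (\<eta> n) M2 \<Phi>"
          if "M1 \<in> inf_subsets M" for n M1
          using less.IH[of "\<eta> n" M1] \<eta>(2)[of n] that inf_subsets_trans[OF that M]
            unif_null_subset[OF less.prems(3) that] inf_subsets_refl by blast
      qed blast
      have "\<exists>h. \<forall>m\<ge>h. n \<ge> n1 \<longrightarrow> (\<forall>L\<in>inf_subsets M1. m \<le> Inf L \<longrightarrow> (\<forall>g\<in>\<Phi>. pairing (fst_avg (\<eta> n) L) g \<le> 1 / real n))"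
        for n
      proof (cases "n \<ge> n1")
        case True
        then have "unif_null (\<eta> n) M1 \<Phi>" "1 / real n > 0" using M1 \<eta>(1) by auto
        then obtain h where "\<And>L g. L \<in> inf_subsets M1 \<Longrightarrow> h \<le> Inf L \<Longrightarrow> g \<in> \<Phi> \<Longrightarrow> pairing (fst_avg (\<eta> n) L) g \<le> 1 / real n"
          using unif_nullE by blast
        then show ?thesis by (meson le_trans)
      qed auto
      then obtain M' where M': "M' \<in> inf_subsets M1"
        "\<And>n m. n \<in> M' \<Longrightarrow> m \<in> M' \<Longrightarrow> n < m \<Longrightarrow> n \<ge> n1 \<longrightarrow>
          (\<forall>L\<in>inf_subsets M1. m \<le> Inf L \<longrightarrow> (\<forall>g\<in>\<Phi>. pairing (fst_avg (\<eta> n) L) g \<le> 1 / real n))"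
        using sparse_subset[OF inf_subsets_infinite[OF M1(1)], where R = "\<lambda>n m. n \<ge> n1 \<longrightarrow>
          (\<forall>L\<in>inf_subsets M1. m \<le> Inf L \<longrightarrow> (\<forall>g\<in>\<Phi>. pairing (fst_avg (\<eta> n) L) g \<le> 1 / real n))"]
        by blast
      have "unif_null \<zeta> M' \<Phi>"
      proof (rule unif_nullI[where C = "max C 0 + 1"])
        fix L g assume L: "L \<in> inf_subsets M'" "n1 \<le> Inf L" and g: "g \<in> \<Phi>"
        have L1: "L \<in> inf_subsets {1..}"
          using L(1) M'(1) M1(1) M inf_subsets_trans by blast
        define n where "n = Inf L"
        let ?p = "\<lambda>j. pairing (fst_avg (\<eta> n) (rest (\<eta> n) L j)) g"
        have n: "n \<ge> n1" "n \<in> M'" "n \<ge> 1"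
          using L Inf_in_inf_subsets[OF L(1)] inf_subsets_subset[OF L(1)] \<eta>(1) by (auto simp: n_def)
        \<comment> \<open>The first of the \<open>n\<close> averages starts at \<open>n\<close>
          itself, where sparseness gives nothing, and is bounded by \<open>max C 0\<close>; each
          other one starts at a later element of \<open>M'\<close> and is at most
          \<open>1 / real n\<close>. This explains the constant \<open>max C 0 + 1\<close>.\<close>
        have p: "?p j \<le> max C 0 * (if j = 0 then 1 else 0) + 1 / real n" for j
        proof (cases j)
          case 0
          have "?p 0 \<le> max C 0"
            using pairing_fst_avg_le[OF rest_in_inf_subsets'[OF L1]] C[OF g] by (meson max.coboundedI1)
          then show ?thesis using 0 by simp (metis add_increasing2 divide_nonneg_nonneg of_nat_0_le_iff zero_le_one)
        next
          case (Suc j')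
          have R: "rest (\<eta> n) L j \<in> inf_subsets L" using rest_in_inf_subsets[OF L1] .
          have "n < Inf (rest (\<eta> n) L j)" using Inf_rest_ge[OF L1, of j "\<eta> n"] Suc by (simp add: n_def)
          moreover have "Inf (rest (\<eta> n) L j) \<in> M'"
            using Inf_in_inf_subsets[OF R] inf_subsets_subset[OF R] inf_subsets_subset[OF L(1)] by blast
          moreover have "rest (\<eta> n) L j \<in> inf_subsets M1"
            using R L(1) M'(1) inf_subsets_trans by blast
          ultimately have "?p j \<le> 1 / real n" using M'(2)[OF n(2)] n(1) g by blast
          then show ?thesis using Suc by simp
        qed
        have "fst_avg \<zeta> L = fst_avg (ord_succ (\<eta> n)) L"
          using fst_avg_limit[OF limit L1] \<eta>(2) n by (simp add: n_def)
        then have "pairing (fst_avg \<zeta> L) g = (\<Sum>j<n. ?p j) / real n"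
          using pairing_succ[OF L1] by (simp add: n_def)
        also have "\<dots> \<le> (\<Sum>j<n. max C 0 * (if j = 0 then 1 else 0) + 1 / real n) / real n"
          using p by (intro divide_right_mono sum_mono) auto
        also have "(\<Sum>j<n. max C 0 * (if j = 0 then 1 else 0) + 1 / real n) = max C 0 + 1"
          using n by (simp add: sum.distrib flip: sum_distrib_left)
        finally show "pairing (fst_avg \<zeta> L) g \<le> (max C 0 + 1) / real (Inf L)" by (simp add: n_def)
      qed simp
      then show ?thesis using M'(1) M1(1) inf_subsets_trans by blast
    qed
  qed
qed

end

section \<open>The dichotomy for hereditary families\<close>

definition hereditary :: "nat set set \<Rightarrow> bool"
  where "hereditary \<F> \<longleftrightarrow> (\<forall>F\<in>\<F>. \<forall>E\<subseteq>F. E \<in> \<F>)"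

definition residual :: "nat set set \<Rightarrow> nat set \<Rightarrow> nat set set"
  where "residual \<F> E = {H. E \<union> H \<in> \<F>}"

definition indicators :: "nat set set \<Rightarrow> (nat \<Rightarrow> real) set"
  where "indicators \<F> = indicator ` \<F>"

lemma hereditaryD: "hereditary \<F> \<Longrightarrow> F \<in> \<F> \<Longrightarrow> E \<subseteq> F \<Longrightarrow> E \<in> \<F>"
  unfolding hereditary_def by blast

lemma hereditary_residual: "hereditary \<F> \<Longrightarrow> hereditary (residual \<F> E)"
  unfolding hereditary_def[of "residual \<F> E"]
  by (auto simp: residual_def elim!: hereditaryD)

lemma residual_antimono: "hereditary \<F> \<Longrightarrow> E' \<subseteq> E \<Longrightarrow> residual \<F> E \<subseteq> residual \<F> E'"
  by (auto simp: residual_def elim!: hereditaryD)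

lemma indicators_mono: "\<F> \<subseteq> \<G> \<Longrightarrow> indicators \<F> \<subseteq> indicators \<G>"
  unfolding indicators_def by blast

lemma indicators_le_1: "g \<in> indicators \<F> \<Longrightarrow> g i \<le> 1"
  unfolding indicators_def by (auto simp: indicator_def)

context ladder
begin

text \<open>The growth bound \<open>h\<close> makes the property invariant under finite changes of \<open>M\<close>.\<close>

definition spreads_into :: "countable_ordinal \<Rightarrow> nat set \<Rightarrow> nat set set \<Rightarrow> bool"
  where "spreads_into \<zeta> M \<F> \<longleftrightarrow> (\<exists>h. \<forall>L \<in> inf_subsets {1..}. \<forall>\<psi>.
    strict_mono_on (supp (fst_avg \<zeta> L)) \<psi> \<longrightarrow>
    (\<forall>i \<in> supp (fst_avg \<zeta> L). \<psi> i \<in> M \<and> h i \<le> \<psi> i) \<longrightarrow> \<psi> ` supp (fst_avg \<zeta> L) \<in> \<F>)"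

definition large :: "countable_ordinal \<Rightarrow> nat set \<Rightarrow> nat set set \<Rightarrow> bool"
  where "large \<zeta> M \<F> \<longleftrightarrow> (\<forall>M' \<in> inf_subsets M. \<not> unif_null \<zeta> M' (indicators \<F>))"

lemma large_mono:
  assumes "large \<zeta> M \<F>" "M' \<in> inf_subsets {1..}" "finite (M' - M)" "\<F> \<subseteq> \<F>'"
  shows "large \<zeta> M' \<F>'"
  unfolding large_def
proof (intro ballI notI)
  fix K assume K: "K \<in> inf_subsets M'" "unif_null \<zeta> K (indicators \<F>')"
  have "finite (K - M)"
    using assms(3) inf_subsets_subset[OF K(1)] by (meson Diff_mono finite_subset order_refl)
  then have "infinite (K \<inter> M)"
    using inf_subsets_infinite[OF K(1)] by (metis Un_Diff_Int finite_Un)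
  then have "K \<inter> M \<in> inf_subsets M" by (auto intro: inf_subsetsI)
  moreover have "unif_null \<zeta> (K \<inter> M) (indicators \<F>)"
    using K(2) by (rule unif_null_mono) (auto intro!: indicators_mono assms(4) simp: Diff_eq_empty_iff[THEN iffD2])
  ultimately show False using assms(1) unfolding large_def by blast
qed

lemma spreads_into_mono:
  assumes "spreads_into \<zeta> M \<F>" "finite (M' - M)"
  shows "spreads_into \<zeta> M' \<F>"
proof -
  obtain h where h: "\<And>L \<psi>. L \<in> inf_subsets {1..} \<Longrightarrow> strict_mono_on (supp (fst_avg \<zeta> L)) \<psi> \<Longrightarrow>
    (\<And>i. i \<in> supp (fst_avg \<zeta> L) \<Longrightarrow> \<psi> i \<in> M \<and> h i \<le> \<psi> i) \<Longrightarrow> \<psi> ` supp (fst_avg \<zeta> L) \<in> \<F>"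
    using assms(1) unfolding spreads_into_def by blast
  obtain b where b: "\<And>i. i \<in> M' - M \<Longrightarrow> i < b"
    using assms(2)[unfolded finite_nat_set_iff_bounded] by blast
  show ?thesis unfolding spreads_into_def
  proof (intro exI[of _ "\<lambda>i. max b (h i)"] ballI allI impI)
    fix L \<psi> assume L: "L \<in> inf_subsets {1..}" "strict_mono_on (supp (fst_avg \<zeta> L)) \<psi>"
      and \<psi>: "\<forall>i\<in>supp (fst_avg \<zeta> L). \<psi> i \<in> M' \<and> max b (h i) \<le> \<psi> i"
    show "\<psi> ` supp (fst_avg \<zeta> L) \<in> \<F>"
    proof (rule h[OF L])
      fix i assume "i \<in> supp (fst_avg \<zeta> L)"
      then have "\<psi> i \<in> M'" "b \<le> \<psi> i" "h i \<le> \<psi> i" using \<psi> by auto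
      then show "\<psi> i \<in> M \<and> h i \<le> \<psi> i" using b[of "\<psi> i"] by fastforce
    qed
  qed
qed

text \<open>If a residual is not large, some subset makes it null, and both outcomes survive almost
  inclusion. The finite sets are countably many, coded by \<open>set_decode\<close>, so one set
  decides them all.\<close>

lemma stabilize:
  assumes M: "M \<in> inf_subsets {1..}"
  obtains M' where "M' \<in> inf_subsets M"
    "\<And>E. finite E \<Longrightarrow> unif_null \<zeta> M' (indicators (residual \<G> E)) \<or> large \<zeta> M' (residual \<G> E)"
proof (rule pseudo_intersection[of M "\<lambda>n M'. unif_null \<zeta> M' (indicators (residual \<G> (set_decode n)))
      \<or> large \<zeta> M' (residual \<G> (set_decode n))"])
  let ?P = "\<lambda>n M'. unif_null \<zeta> M' (indicators (residual \<G> (set_decode n)))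
      \<or> large \<zeta> M' (residual \<G> (set_decode n))"
  show "infinite M" using M by (rule inf_subsets_infinite)
  show "?P n M2" if "?P n M1" "M2 \<in> inf_subsets M" "finite (M2 - M1)" for n M1 M2
    using that unif_null_mono[of \<zeta> M1 _ M2] large_mono[of \<zeta> M1 _ M2] inf_subsets_trans[OF that(2) M] by blast
  show "\<exists>M2\<in>inf_subsets M1. ?P n M2" if "M1 \<in> inf_subsets M" for n M1
    unfolding large_def using inf_subsets_refl[OF that] by blast
  fix M' assume M': "M' \<in> inf_subsets M" "\<And>n. ?P n M'"
  have "?P (set_encode E) M'" for E using M' by blast
  then show thesis using M'(1) by (intro that[of M']) (metis set_encode_inverse)+
qed

text \<open>Along an average of order \<open>\<zeta> + 1\<close>, the trace of a member of \<open>\<G> 0\<close> can drop to a lower level at most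
  \<open>k\<close> times; between two drops its \<open>\<zeta>\<close>-averages are small.\<close>

lemma unif_null_succ_of_levels:
  fixes \<G> :: "nat \<Rightarrow> nat set set" and N :: "nat \<Rightarrow> nat set"
  assumes N: "\<And>i. N i \<in> inf_subsets {1..}" "\<And>i. N (Suc i) \<subseteq> N i"
    and \<G>: "\<And>i. hereditary (\<G> i)" "\<And>i. \<G> (Suc i) \<subseteq> \<G> i"
    and null: "\<And>i E. finite E \<Longrightarrow> E \<in> \<G> i \<Longrightarrow> E \<notin> \<G> (Suc i) \<Longrightarrow>
      unif_null \<zeta> (N (Suc i)) (indicators (residual (\<G> i) E))"
    and k: "{} \<notin> \<G> k"
  shows "\<exists>M' \<in> inf_subsets (N k). unif_null (ord_succ \<zeta>) M' (indicators (\<G> 0))"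
proof -
  define Q where "Q c i E d \<longleftrightarrow> E \<in> \<G> i \<and> E \<notin> \<G> (Suc i) \<longrightarrow> (\<forall>L\<in>inf_subsets (N (Suc i)). d \<le> Inf L \<longrightarrow>
    (\<forall>F\<in>residual (\<G> i) E. pairing (fst_avg \<zeta> L) (indicator F) \<le> 1 / (real c + 1)))"
    for c i :: nat and E d
  have Q: "\<exists>h. \<forall>d\<ge>h. \<forall>x\<in>{..<k} \<times> Pow {..c}. Q c (fst x) (snd x) d" for c
    unfolding eventually_sequentially[symmetric]
  proof (rule eventually_ball_finite)
    show "\<forall>y\<in>{..<k} \<times> Pow {..c}. \<forall>\<^sub>F x in sequentially. Q c (fst y) (snd y) x"
    proof
      fix y assume y: "y \<in> {..<k} \<times> Pow {..c}"
      show "\<forall>\<^sub>F x in sequentially. Q c (fst y) (snd y) x"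
      proof (cases "snd y \<in> \<G> (fst y) \<and> snd y \<notin> \<G> (Suc (fst y))")
        case True
        have "finite (snd y)" using y finite_subset[of "snd y" "{..c}"] by auto
        then have "unif_null \<zeta> (N (Suc (fst y))) (indicators (residual (\<G> (fst y)) (snd y)))"
          using null True by blast
        moreover have "1 / (real c + 1) > 0" by simp
        ultimately obtain h where "\<And>L g. L \<in> inf_subsets (N (Suc (fst y))) \<Longrightarrow> h \<le> Inf L \<Longrightarrow>
            g \<in> indicators (residual (\<G> (fst y)) (snd y)) \<Longrightarrow> pairing (fst_avg \<zeta> L) g \<le> 1 / (real c + 1)"
          using unif_nullE by blast
        then show ?thesis unfolding eventually_sequentially Q_def indicators_def
          by (intro exI[of _ h]) auto
      qed (auto simp: Q_def)
    qed
  qed simp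
  obtain M' where M': "M' \<in> inf_subsets (N k)"
    "\<And>c d. c \<in> M' \<Longrightarrow> d \<in> M' \<Longrightarrow> c < d \<Longrightarrow> \<forall>x\<in>{..<k} \<times> Pow {..c}. Q c (fst x) (snd x) d"
    using sparse_subset[OF inf_subsets_infinite[OF N(1)[of k]], where R = "\<lambda>c d. \<forall>x\<in>{..<k} \<times> Pow {..c}. Q c (fst x) (snd x) d", OF Q]
    by blast
  have Ndec: "N j \<subseteq> N i" if "i \<le> j" for i j
    using N(2) that by (metis lift_Suc_antimono_le)
  \<comment> \<open>The levels decrease, so for \<open>E\<close> in \<open>\<G> 0\<close> this is
    the last index up to \<open>k\<close> whose level contains \<open>E\<close>.\<close>
  define lev where "lev E = card {i. i < k \<and> E \<in> \<G> (Suc i)}" for E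
  have lev_le: "lev E \<le> k" for E
    unfolding lev_def by (rule order_trans[OF card_mono[of "{..<k}"]]) auto
  have "unif_null (ord_succ \<zeta>) M' (indicators (\<G> 0))"
  proof (rule unif_nullI[where C = "real k + 2"])
    fix L g assume L: "L \<in> inf_subsets M'" and "g \<in> indicators (\<G> 0)"
    then obtain F where F: "F \<in> \<G> 0" "g = indicator F" unfolding indicators_def by blast
    have L1: "L \<in> inf_subsets {1..}" using L M'(1) N(1) inf_subsets_trans by blast
    define s where "s = Inf L"
    have s: "s \<ge> 1" using Inf_ge_1[OF L1] by (simp add: s_def)
    let ?L = "rest \<zeta> L"
    let ?S = "\<lambda>j. supp (fst_avg \<zeta> (?L j))"
    let ?p = "\<lambda>j. pairing (fst_avg \<zeta> (?L j)) g"
    note R = rest_in_inf_subsets[OF L1, of \<zeta>] and R1 = rest_in_inf_subsets'[OF L1, of \<zeta>]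
    define E where "E j = F \<inter> (\<Union>i<j. ?S i)" for j
    have E0: "E j \<in> \<G> 0" for j
      using \<G>(1) F(1) by (rule hereditaryD) (auto simp: E_def)
    have E_fin: "finite (E j)" for j using R1 by (simp add: E_def)
    have E_Suc: "E (Suc j) = E j \<union> F \<inter> ?S j" for j
      by (auto simp: E_def lessThan_Suc)
    have sub: "{i. i < k \<and> E (Suc j) \<in> \<G> (Suc i)} \<subseteq> {i. i < k \<and> E j \<in> \<G> (Suc i)}" for j
      using hereditaryD[OF \<G>(1)] E_Suc by blast
    then have lev_dec: "lev (E (Suc j)) \<le> lev (E j)" for j
      unfolding lev_def by (rule card_mono[rotated]) auto
    have p1: "?p j \<le> 1" for j
      using R1 by (rule pairing_fst_avg_le) (auto simp: F indicator_def)
    \<comment> \<open>Blocks at which the trace loses a level are paid for by the telescoping drop,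
      block 0 by the extra 1 since it has no predecessor to supply \<open>c\<close>, and all others
      by \<open>1 / real s\<close>. Since \<open>lev\<close> is at most \<open>k\<close>, the total
      is at most \<open>k + 2\<close>.\<close>
    have p: "?p j \<le> real (lev (E j)) - real (lev (E (Suc j))) + (if j = 0 then 1 else 0) + 1 / real s" for j
    proof (cases "j = 0 \<or> lev (E (Suc j)) \<noteq> lev (E j)")
      case True
      then have "1 \<le> real (lev (E j)) - real (lev (E (Suc j))) + (if j = 0 then 1 else 0)"
        using lev_dec[of j] by auto
      moreover have "0 \<le> 1 / real s" by simp
      ultimately show ?thesis using p1[of j] by linarith
    next
      case False
      then have eq: "{i. i < k \<and> E (Suc j) \<in> \<G> (Suc i)} = {i. i < k \<and> E j \<in> \<G> (Suc i)}"
        using sub[of j] unfolding lev_def by (intro card_subset_eq) auto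
      \<comment> \<open>\<open>E j\<close> lies in level \<open>i\<close> but not in the next one.
        As no level is lost at this block, \<open>E (Suc j)\<close> is still in
        \<open>\<G> i\<close>; so the new part of the trace belongs to a residual that is null by
        assumption.\<close>
      define i where "i = (LEAST i. E j \<notin> \<G> (Suc i))"
      have "E j \<notin> \<G> k" using k hereditaryD[OF \<G>(1)] by blast
      moreover have "k \<noteq> 0" using calculation E0 by metis
      ultimately have ex: "E j \<notin> \<G> (Suc (k - 1))" by simp
      have i: "E j \<notin> \<G> (Suc i)" unfolding i_def using ex by (rule LeastI)
      have "i \<le> k - 1" unfolding i_def using ex by (rule Least_le)
      then have "i < k" using \<open>k \<noteq> 0\<close> by simp
      have both: "E j \<in> \<G> i \<and> E (Suc j) \<in> \<G> i"
      proof (cases i)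
        case 0
        then show ?thesis using E0 by simp
      next
        case (Suc i')
        then have "E j \<in> \<G> (Suc i')"
          using not_less_Least[of i' "\<lambda>i. E j \<notin> \<G> (Suc i)", folded i_def] by blast
        then show ?thesis using eq Suc \<open>i < k\<close> Suc_lessD by blast
      qed
      then have F': "F \<inter> ?S j \<in> residual (\<G> i) (E j)" by (simp add: residual_def E_Suc)
      obtain j' where j': "j = Suc j'" using False by (cases j) auto
      \<comment> \<open>The last point of the preceding support: an element of \<open>M'\<close>
        that bounds the old trace and lies before the present block, as the sparseness of
        \<open>M'\<close> requires.\<close>
      define c where "c = Max (?S j')"
      have "c \<in> ?S j'" unfolding c_def using R1[of j'] Inf_in_supp_fst_avg[OF R1[of j']]
        by (intro Max_in) auto
      then have cL: "c \<in> L" using supp_fst_avg_subset[OF R1] inf_subsets_subset[OF R] by blast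
      then have "c \<in> M'" "s \<le> c" using inf_subsets_subset[OF L] Inf_nat_le by (auto simp: s_def)
      have Inf_R: "Inf (?L j) \<in> ?L j" using Inf_in_inf_subsets[OF R] .
      have "Inf (?L j) \<in> M'"
        using Inf_R inf_subsets_subset[OF R] inf_subsets_subset[OF L] by blast
      have "c < Inf (?L j)"
        using supp_fst_avg_less_rest[OF L1 _ \<open>c \<in> ?S j'\<close> Inf_R] j' by simp
      have "E j \<subseteq> {..c}"
      proof
        fix x assume "x \<in> E j"
        then obtain l where l: "l < j" "x \<in> ?S l" unfolding E_def by blast
        show "x \<in> {..c}"
        proof (cases "l = j'")
          case True
          then show ?thesis using l R1 by (simp add: c_def)
        next
          case False
          have "c \<in> ?L j'" using \<open>c \<in> ?S j'\<close> supp_fst_avg_subset[OF R1] by blast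
          moreover have "l < j'" using False l(1) j' by simp
          ultimately have "x < c" using supp_fst_avg_less_rest[OF L1 _ l(2)] by blast
          then show ?thesis by simp
        qed
      qed
      then have "Q c i (E j) (Inf (?L j))"
        using M'(2)[OF \<open>c \<in> M'\<close> \<open>Inf (?L j) \<in> M'\<close> \<open>c < Inf (?L j)\<close>] \<open>i < k\<close> by auto
      moreover have "?L j \<in> inf_subsets (N (Suc i))"
        using R[of j] L M'(1) Ndec[of "Suc i" k] \<open>i < k\<close> unfolding inf_subsets_def by auto
      ultimately have "pairing (fst_avg \<zeta> (?L j)) (indicator (F \<inter> ?S j)) \<le> 1 / (real c + 1)"
        using both i F' unfolding Q_def by blast
      also have "pairing (fst_avg \<zeta> (?L j)) (indicator (F \<inter> ?S j)) = ?p j"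
        by (rule pairing_cong) (auto simp: F indicator_def)
      also have "1 / (real c + 1) \<le> 1 / real s"
        using s \<open>s \<le> c\<close> by (intro divide_left_mono) auto
      finally show ?thesis using False by simp
    qed
    have "(\<Sum>j<s. ?p j) \<le> (\<Sum>j<s. real (lev (E j)) - real (lev (E (Suc j))) + (if j = 0 then 1 else 0) + 1 / real s)"
      using p by (rule sum_mono)
    also have "\<dots> = real (lev (E 0)) - real (lev (E s)) + 2"
      using s sum_lessThan_telescope'[of "\<lambda>j. real (lev (E j))" s] by (simp add: sum.distrib)
    also have "\<dots> \<le> real k + 2" using lev_le[of "E 0"] by simp
    finally show "pairing (fst_avg (ord_succ \<zeta>) L) g \<le> (real k + 2) / real (Inf L)"
      unfolding pairing_succ[OF L1] using s by (intro divide_right_mono) (auto simp: s_def)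
  qed simp
  then show ?thesis using M'(1) by blast
qed

text \<open>The support of an average of order \<zeta> + 1 consists of \<open>s = Inf L\<close>
  blocks. They are placed one at a time, each at the cost of one level: after \<open>j\<close>
  blocks the image lies in \<open>\<G> (s - j)\<close>. As \<open>s\<close> is arbitrary, the start
  requires the empty set in every level.\<close>

lemma spreads_into_succ_of_levels:
  fixes \<G> :: "nat \<Rightarrow> nat set set" and N :: "nat \<Rightarrow> nat set"
  assumes N: "\<And>i. N i \<in> inf_subsets {1..}" "\<And>i. N (Suc i) \<subseteq> N i"
    and \<G>: "\<And>i. hereditary (\<G> i)"
    and lrg: "\<And>i E. E \<in> \<G> (Suc i) \<Longrightarrow> finite E \<and> large \<zeta> (N (Suc i)) (residual (\<G> i) E)"
    and empty: "\<And>i. {} \<in> \<G> i"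
    and dich: "\<And>\<F> M. hereditary \<F> \<Longrightarrow> M \<in> inf_subsets {1..} \<Longrightarrow> large \<zeta> M \<F> \<Longrightarrow>
      \<exists>M' \<in> inf_subsets M. spreads_into \<zeta> M' \<F>"
  shows "\<exists>M' \<in> inf_subsets (N 0). spreads_into (ord_succ \<zeta>) M' (\<G> 0)"
proof -
  obtain M0 where M0: "M0 \<in> inf_subsets (N 0)" "\<And>n. finite (M0 - N n)"
    using pseudo_intersection_decreasing[of N] N inf_subsets_infinite by metis
  have M01: "M0 \<in> inf_subsets {1..}" using M0(1) N(1) inf_subsets_trans by blast
  define P where "P k E M' \<longleftrightarrow> E \<in> \<G> (Suc k) \<longrightarrow> spreads_into \<zeta> M' (residual (\<G> k) E)" for k E M'
  define dec where "dec n = (fst (prod_decode n), set_decode (snd (prod_decode n)))" for n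
  obtain M1 where M1: "M1 \<in> inf_subsets M0" "\<And>n. case_prod P (dec n) M1"
  proof (rule pseudo_intersection[of M0 "\<lambda>n. case_prod P (dec n)"])
    show "infinite M0" using M0 inf_subsets_infinite by blast
    show "case_prod P (dec n) K2" if "case_prod P (dec n) K1" "finite (K2 - K1)" for n K1 K2
      using that spreads_into_mono by (auto simp: P_def split: prod.splits)
    fix n K1 assume K1: "K1 \<in> inf_subsets M0"
    obtain k E where d: "dec n = (k, E)" by fastforce
    show "\<exists>K2\<in>inf_subsets K1. case_prod P (dec n) K2"
    proof (cases "E \<in> \<G> (Suc k)")
      case True
      let ?K = "K1 \<inter> N (Suc k)"
      have "K1 - N (Suc k) \<subseteq> M0 - N (Suc k)" using inf_subsets_subset[OF K1] by blast
      then have "infinite ?K"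
        using M0(2)[of "Suc k"] inf_subsets_infinite[OF K1] by (metis Un_Diff_Int finite_Un finite_subset)
      then have K: "?K \<in> inf_subsets {1..}" "?K \<in> inf_subsets K1"
        using K1 M01 by (auto simp: inf_subsets_def)
      have "large \<zeta> ?K (residual (\<G> k) E)"
        by (rule large_mono[OF conjunct2[OF lrg[OF True]] K(1)]) (auto simp: Diff_eq_empty_iff[THEN iffD2])
      then obtain K2 where "K2 \<in> inf_subsets ?K" "spreads_into \<zeta> K2 (residual (\<G> k) E)"
        using dich[OF hereditary_residual[OF \<G>] K(1)] by blast
      then show ?thesis using inf_subsets_trans[OF _ K(2)] d by (auto simp: P_def)
    next
      case False
      then show ?thesis using inf_subsets_refl[OF K1] d by (auto simp: P_def)
    qed
  qed blast
  have "spreads_into \<zeta> M1 (residual (\<G> k) E)" if "E \<in> \<G> (Suc k)" for k E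
  proof -
    have "dec (prod_encode (k, set_encode E)) = (k, E)"
      using lrg[OF that] by (simp add: dec_def)
    then show ?thesis using M1(2)[of "prod_encode (k, set_encode E)"] that by (simp add: P_def)
  qed
  then have "\<forall>k E. \<exists>h. E \<in> \<G> (Suc k) \<longrightarrow> (\<forall>L \<in> inf_subsets {1..}. \<forall>\<psi>.
    strict_mono_on (supp (fst_avg \<zeta> L)) \<psi> \<longrightarrow>
    (\<forall>i \<in> supp (fst_avg \<zeta> L). \<psi> i \<in> M1 \<and> h i \<le> \<psi> i) \<longrightarrow> \<psi> ` supp (fst_avg \<zeta> L) \<in> residual (\<G> k) E)"
    unfolding spreads_into_def by blast
  then obtain H where H: "\<And>k E L \<psi>. E \<in> \<G> (Suc k) \<Longrightarrow> L \<in> inf_subsets {1..} \<Longrightarrow>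
    strict_mono_on (supp (fst_avg \<zeta> L)) \<psi> \<Longrightarrow>
    (\<And>i. i \<in> supp (fst_avg \<zeta> L) \<Longrightarrow> \<psi> i \<in> M1 \<and> H k E i \<le> \<psi> i) \<Longrightarrow>
    \<psi> ` supp (fst_avg \<zeta> L) \<in> residual (\<G> k) E"
    by metis
  \<comment> \<open>All growth bounds whose data are limited by \<open>c\<close>; they are finitely
    many, so every large \<open>d\<close> dominates them. The slack in \<open>Suc c\<close> is the
    one position lost in \<open>pred\<close>.\<close>
  define R where "R c d \<longleftrightarrow> (\<forall>k\<le>Suc c. \<forall>E\<subseteq>{..c}. \<forall>i\<le>Suc c. H k E i \<le> d)" for c d
  have "\<exists>h. \<forall>d\<ge>h. R c d" for c
  proof -
    let ?S = "(\<lambda>(k, E, i). H k E i) ` ({..Suc c} \<times> Pow {..c} \<times> {..Suc c})"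
    have "R c d" if "d \<ge> Max ?S" for d
      unfolding R_def
    proof (intro allI impI)
      fix k E i assume "k \<le> Suc c" "E \<subseteq> {..c}" "i \<le> Suc c"
      then have "H k E i \<in> ?S" by (intro image_eqI[of _ _ "(k, E, i)"]) auto
      then have "H k E i \<le> Max ?S" by (intro Max_ge) auto
      then show "H k E i \<le> d" using that by linarith
    qed
    then show ?thesis by blast
  qed
  then obtain M' where M': "M' \<in> inf_subsets M1" "\<And>c d. c \<in> M' \<Longrightarrow> d \<in> M' \<Longrightarrow> c < d \<Longrightarrow> R c d"
    using sparse_subset[OF inf_subsets_infinite[OF M1(1)], where R = R] by blast
  have infM': "infinite M'" using M'(1) by (rule inf_subsets_infinite)
  have "spreads_into (ord_succ \<zeta>) M' (\<G> 0)"
    unfolding spreads_into_def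
  proof (intro exI[of _ "enumerate M'"] ballI allI impI)
    fix L \<psi> assume L: "L \<in> inf_subsets {1..}"
    let ?L = "rest \<zeta> L"
    let ?S = "\<lambda>j. supp (fst_avg \<zeta> (?L j))"
    let ?T = "supp (fst_avg (ord_succ \<zeta>) L)"
    define s where "s = Inf L"
    assume mono: "strict_mono_on ?T \<psi>" and \<psi>: "\<forall>i\<in>?T. \<psi> i \<in> M' \<and> enumerate M' i \<le> \<psi> i"
    note R1 = rest_in_inf_subsets'[OF L, of \<zeta>]
    have T: "?T = (\<Union>j<s. ?S j)" using supp_fst_avg_succ[OF regular L] by (simp add: s_def)
    have TL: "?T \<subseteq> L" using supp_fst_avg_subset[OF L] .
    \<comment> \<open>Since \<open>\<psi> i\<close> is at least the element of \<open>M'\<close>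
      with index \<open>i\<close>, counted from 0, its predecessor \<open>c\<close> in
      \<open>M'\<close> has index at least \<open>i - 1\<close>, whence
      \<open>i \<le> Suc c\<close>. All points placed earlier are at most \<open>c\<close>.\<close>
    have pred: "\<exists>c\<in>M'. c < \<psi> i \<and> i \<le> Suc c \<and> (\<forall>m\<in>M'. m < \<psi> i \<longrightarrow> m \<le> c)" if "i \<in> ?T" for i
    proof -
      have i: "1 \<le> i" using that TL inf_subsets_subset[OF L] by auto
      obtain i' where i': "enumerate M' i' = \<psi> i"
        using enumerate_Ex[OF infM', of "\<psi> i"] \<psi> \<open>i \<in> ?T\<close> by blast
      have "i \<le> i'" using \<psi> that infM' by (metis i' enumerate_mono_le_iff)
      then obtain l where l: "i' = Suc l" using i by (cases i') auto
      have "m \<le> enumerate M' l" if m: "m \<in> M'" "m < \<psi> i" for m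
      proof -
        obtain m' where m': "enumerate M' m' = m" using enumerate_Ex[OF infM' m(1)] by blast
        then have "m' < Suc l" using m(2) i' l infM' by (metis enumerate_mono_iff)
        then show ?thesis using m' infM' by (metis enumerate_mono_le_iff less_Suc_eq_le)
      qed
      moreover have "enumerate M' l < \<psi> i" using i' l infM' enumerate_step by metis
      moreover have "i \<le> Suc (enumerate M' l)" using le_enumerate[OF infM', of l] \<open>i \<le> i'\<close> l by simp
      ultimately show ?thesis using enumerate_in_set[OF infM'] by blast
    qed
    have "\<psi> ` (\<Union>l<j. ?S l) \<in> \<G> (s - j)" if "j \<le> s" for j
      using that
    proof (induction j)
      case 0
      then show ?case using empty by simp
    next
      case (Suc j)
      let ?E = "\<psi> ` (\<Union>l<j. ?S l)"
      obtain k where k: "s - j = Suc k" "s - Suc j = k" using Suc.prems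
        by (metis Suc_diff_Suc Suc_le_lessD)
      have E: "?E \<in> \<G> (Suc k)" using Suc k by simp
      have SjT: "?S j \<subseteq> ?T" unfolding T using Suc.prems by (intro UN_upper) simp
      have "\<psi> ` ?S j \<in> residual (\<G> k) ?E"
      proof (rule H[OF E R1])
        show "strict_mono_on (?S j) \<psi>" using mono SjT unfolding strict_mono_on_def by blast
        fix i assume i: "i \<in> ?S j"
        then have iT: "i \<in> ?T" using SjT by blast
        then obtain c where c: "c \<in> M'" "c < \<psi> i" "i \<le> Suc c" "\<And>m. m \<in> M' \<Longrightarrow> m < \<psi> i \<Longrightarrow> m \<le> c"
          using pred by metis
        have "?E \<subseteq> {..c}"
        proof
          fix m assume "m \<in> ?E"
          then obtain l i2 where l: "l < j" "i2 \<in> ?S l" "m = \<psi> i2" by blast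
          have "i \<in> ?L j" using i supp_fst_avg_subset[OF R1] by blast
          then have "i2 < i" using supp_fst_avg_less_rest[OF L l(1,2)] by blast
          moreover have "i2 \<in> ?T" unfolding T using l Suc.prems by auto
          ultimately have "m < \<psi> i" "m \<in> M'"
            using mono iT l(3) \<psi> unfolding strict_mono_on_def by auto
          then show "m \<in> {..c}" using c by simp
        qed
        moreover have "k \<le> Suc c"
        proof -
          have "k \<le> s" using k by linarith
          also have "s \<le> i" unfolding s_def using TL iT by (intro Inf_nat_le) auto
          finally show ?thesis using c by simp
        qed
        moreover have "\<psi> i \<in> M'" using \<psi> iT by blast
        ultimately have "H k ?E i \<le> \<psi> i"
          using M'(2)[OF c(1) _ c(2)] c(3) unfolding R_def by blast
        then show "\<psi> i \<in> M1 \<and> H k ?E i \<le> \<psi> i"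
          using \<open>\<psi> i \<in> M'\<close> inf_subsets_subset[OF M'(1)] by blast
      qed
      then have "?E \<union> \<psi> ` ?S j \<in> \<G> k" by (simp add: residual_def)
      also have "?E \<union> \<psi> ` ?S j = \<psi> ` (\<Union>l<Suc j. ?S l)" by (auto simp: lessThan_Suc)
      finally show ?case using k by simp
    qed
    from this[of s] show "\<psi> ` ?T \<in> \<G> 0" by (simp add: T)
  qed
  moreover have "M' \<in> inf_subsets (N 0)" using M'(1) M1(1) M0(1) inf_subsets_trans by blast
  ultimately show ?thesis by blast
qed

text \<open>A derivation in the manner of Cantor and Bendixson: after stabilizing,
  \<open>\<G> (Suc i)\<close> keeps the finite sets in \<open>\<G> i\<close> whose residual is still
  large. If the empty set is lost after finitely many steps, \<F> is null of order \<zeta> + 1 on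
  some subset, against largeness; otherwise there are enough levels to place any number of
  blocks.\<close>

lemma dichotomy_succ:
  assumes dich: "\<And>\<F> M. hereditary \<F> \<Longrightarrow> M \<in> inf_subsets {1..} \<Longrightarrow> large \<zeta> M \<F> \<Longrightarrow>
      \<exists>M' \<in> inf_subsets M. spreads_into \<zeta> M' \<F>"
    and her: "hereditary \<F>" and M: "M \<in> inf_subsets {1..}"
    and lrg: "large (ord_succ \<zeta>) M \<F>"
  shows "\<exists>M' \<in> inf_subsets M. spreads_into (ord_succ \<zeta>) M' \<F>"
proof -
  define st where "st K \<G> = (SOME K'. K' \<in> inf_subsets K \<and> (\<forall>E. finite E \<longrightarrow>
    unif_null \<zeta> K' (indicators (residual \<G> E)) \<or> large \<zeta> K' (residual \<G> E)))" for K \<G>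
  have st: "st K \<G> \<in> inf_subsets K \<and> (\<forall>E. finite E \<longrightarrow>
    unif_null \<zeta> (st K \<G>) (indicators (residual \<G> E)) \<or> large \<zeta> (st K \<G>) (residual \<G> E))"
    if "K \<in> inf_subsets {1..}" for K \<G>
    unfolding st_def by (rule someI_ex) (metis stabilize[OF that])
  define lv where "lv = rec_nat (M, \<F>) (\<lambda>_ (K, \<G>).
    (st K \<G>, {E \<in> \<G>. finite E \<and> large \<zeta> (st K \<G>) (residual \<G> E)}))"
  define N \<G> where "N i = fst (lv i)" and "\<G> i = snd (lv i)" for i
  have N0: "N 0 = M" "\<G> 0 = \<F>" by (simp_all add: N_def \<G>_def lv_def)
  have N_Suc: "N (Suc i) = st (N i) (\<G> i)" for i
    by (simp add: N_def \<G>_def lv_def split: prod.splits)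
  have G_Suc: "\<G> (Suc i) = {E \<in> \<G> i. finite E \<and> large \<zeta> (N (Suc i)) (residual (\<G> i) E)}" for i
    unfolding N_Suc by (simp add: N_def \<G>_def lv_def split: prod.splits)
  have N1: "N i \<in> inf_subsets {1..}" for i
  proof (induction i)
    case (Suc i)
    then show ?case using conjunct1[OF st[OF Suc]] inf_subsets_trans unfolding N_Suc by blast
  qed (simp only: N0 M)
  have dec: "N (Suc i) \<subseteq> N i" for i
    unfolding N_Suc using st[OF N1] inf_subsets_subset by blast
  have herG: "hereditary (\<G> i)" for i
  proof (induction i)
    case (Suc i)
    show ?case unfolding hereditary_def
    proof (intro ballI allI impI)
      fix E E' assume E: "E \<in> \<G> (Suc i)" "E' \<subseteq> E"
      have EG: "E \<in> \<G> i" "finite E" "large \<zeta> (N (Suc i)) (residual (\<G> i) E)"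
        using E(1) unfolding G_Suc by auto
      have "large \<zeta> (N (Suc i)) (residual (\<G> i) E')"
        by (rule large_mono[OF EG(3) N1 _ residual_antimono[OF Suc E(2)]]) simp
      moreover have "E' \<in> \<G> i" using hereditaryD[OF Suc EG(1) E(2)] .
      moreover have "finite E'" using E(2) EG(2) by (rule finite_subset)
      ultimately show "E' \<in> \<G> (Suc i)" unfolding G_Suc by blast
    qed
  qed (simp add: N0 her)
  show ?thesis
  proof (cases "\<exists>k. {} \<notin> \<G> k")
    case True
    then obtain k where k: "{} \<notin> \<G> k" by blast
    have "\<exists>M' \<in> inf_subsets (N k). unif_null (ord_succ \<zeta>) M' (indicators (\<G> 0))"
    proof (rule unif_null_succ_of_levels[where N = N and \<G> = \<G>, OF N1 dec herG _ _ k])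
      show "\<G> (Suc i) \<subseteq> \<G> i" for i by (auto simp: G_Suc)
      show "unif_null \<zeta> (N (Suc i)) (indicators (residual (\<G> i) E))"
        if "finite E" "E \<in> \<G> i" "E \<notin> \<G> (Suc i)" for i E
        using that st[OF N1, of i "\<G> i"] by (auto simp: G_Suc simp flip: N_Suc)
    qed
    moreover have "N k \<subseteq> M"
      using dec N0 lift_Suc_antimono_le[of N 0 k] by auto
    ultimately show ?thesis using lrg N0 unfolding large_def inf_subsets_def by blast
  next
    case False
    have "\<exists>M' \<in> inf_subsets (N 0). spreads_into (ord_succ \<zeta>) M' (\<G> 0)"
    proof (rule spreads_into_succ_of_levels[where N = N and \<G> = \<G>, OF N1 dec herG _ _ dich])
      show "finite E \<and> large \<zeta> (N (Suc i)) (residual (\<G> i) E)" if "E \<in> \<G> (Suc i)" for i E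
        using that by (simp add: G_Suc)
      show "{} \<in> \<G> i" for i using False by blast
    qed
    then show ?thesis by (simp add: N0)
  qed
qed

text \<open>Averages of order 0 are point masses, so only singletons of \<F> matter: finitely many
  of them can be discarded from \<open>M\<close>, and infinitely many form the required set.\<close>

lemma dichotomy_zero:
  assumes her: "hereditary \<F>" and M: "M \<in> inf_subsets {1..}" and lrg: "large 0 M \<F>"
  shows "\<exists>M' \<in> inf_subsets M. spreads_into 0 M' \<F>"
proof (cases "finite {n \<in> M. {n} \<in> \<F>}")
  case True
  let ?K = "M - {n \<in> M. {n} \<in> \<F>}"
  have K: "?K \<in> inf_subsets M"
    using True inf_subsets_infinite[OF M] by (intro inf_subsetsI) auto
  have "unif_null 0 ?K (indicators \<F>)"
  proof (rule unif_nullI[where C = 0])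
    fix L g assume L: "L \<in> inf_subsets ?K" and "g \<in> indicators \<F>"
    then obtain F where F: "F \<in> \<F>" "g = indicator F" unfolding indicators_def by blast
    have "Inf L \<notin> F"
    proof
      assume "Inf L \<in> F"
      then have "{Inf L} \<in> \<F>" using hereditaryD[OF her F(1)] by blast
      then show False using Inf_in_inf_subsets[OF L] inf_subsets_subset[OF L] by blast
    qed
    moreover have "supp (fst_avg 0 L) = {Inf L}"
      by (auto simp: fst_avg_zero supp_def indicator_def)
    ultimately show "pairing (fst_avg 0 L) g \<le> 0 / real (Inf L)"
      by (simp add: pairing_def F)
  qed simp
  then show ?thesis using lrg K unfolding large_def by blast
next
  case False
  let ?K = "{n \<in> M. {n} \<in> \<F>}"
  have "spreads_into 0 ?K \<F>"
    unfolding spreads_into_def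
  proof (intro exI[of _ "\<lambda>_. 0"] ballI allI impI)
    fix L \<psi> assume \<psi>: "\<forall>i\<in>supp (fst_avg 0 L). \<psi> i \<in> ?K \<and> 0 \<le> \<psi> i"
    have "supp (fst_avg 0 L) = {Inf L}"
      by (auto simp: fst_avg_zero supp_def indicator_def)
    then show "\<psi> ` supp (fst_avg 0 L) \<in> \<F>" using \<psi> by simp
  qed
  then show ?thesis using False by (auto intro!: bexI[of _ ?K] inf_subsetsI)
qed

text \<open>Nullity passes up to \<xi>, so largeness passes down to every ladder order. The order
  used along \<open>L\<close> is the ladder term at \<open>Inf L\<close>, and
  \<open>Inf L \<le> i\<close> for each point \<open>i\<close> of the support; hence the maximum of
  the growth bounds over \<open>n \<le> i\<close> dominates the one that is needed.\<close>

lemma dichotomy_limit: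
  assumes lim: "is_limit_ord \<xi>"
    and dich: "\<And>n M. n \<ge> 1 \<Longrightarrow> M \<in> inf_subsets {1..} \<Longrightarrow> large (lad \<xi> n) M \<F> \<Longrightarrow>
      \<exists>M' \<in> inf_subsets M. spreads_into (lad \<xi> n) M' \<F>"
    and M: "M \<in> inf_subsets {1..}" and lrg: "large \<xi> M \<F>"
  shows "\<exists>M' \<in> inf_subsets M. spreads_into \<xi> M' \<F>"
proof -
  have lrg_n: "large (lad \<xi> n) M \<F>" if "n \<ge> 1" for n
    unfolding large_def
  proof (intro ballI notI)
    fix K assume K: "K \<in> inf_subsets M" "unif_null (lad \<xi> n) K (indicators \<F>)"
    then obtain K' where "K' \<in> inf_subsets K" "unif_null \<xi> K' (indicators \<F>)"
      using unif_null_increasing[of "lad \<xi> n" \<xi> K "indicators \<F>" 1] ladder_less[OF lad lim \<open>n \<ge> 1\<close>]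
        inf_subsets_trans[OF K(1) M] indicators_le_1 less_imp_le by blast
    then show False using lrg K inf_subsets_trans unfolding large_def by blast
  qed
  obtain M' where M': "M' \<in> inf_subsets M" "\<And>n. n \<ge> 1 \<longrightarrow> spreads_into (lad \<xi> n) M' \<F>"
  proof (rule pseudo_intersection[of M "\<lambda>n M'. n \<ge> 1 \<longrightarrow> spreads_into (lad \<xi> n) M' \<F>"])
    show "infinite M" using M by (rule inf_subsets_infinite)
    show "n \<ge> 1 \<longrightarrow> spreads_into (lad \<xi> n) M2 \<F>"
      if "n \<ge> 1 \<longrightarrow> spreads_into (lad \<xi> n) M1 \<F>" "finite (M2 - M1)" for n M1 M2
      using that spreads_into_mono by blast
    fix n M1 assume M1: "M1 \<in> inf_subsets M"
    show "\<exists>M2\<in>inf_subsets M1. n \<ge> 1 \<longrightarrow> spreads_into (lad \<xi> n) M2 \<F>"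
    proof (cases "n \<ge> 1")
      case True
      have M11: "M1 \<in> inf_subsets {1..}" using M1 M inf_subsets_trans by blast
      have "finite (M1 - M)" using inf_subsets_subset[OF M1] by (simp add: Diff_eq_empty_iff[THEN iffD2])
      then have "large (lad \<xi> n) M1 \<F>" using large_mono[OF lrg_n[OF True] M11] by blast
      then show ?thesis using dich[OF True M11] by blast
    next
      case False
      then show ?thesis using inf_subsets_refl[OF M1] by blast
    qed
  qed blast
  have "\<forall>n. \<exists>h. n \<ge> 1 \<longrightarrow> (\<forall>L \<in> inf_subsets {1..}. \<forall>\<psi>. strict_mono_on (supp (fst_avg (lad \<xi> n) L)) \<psi> \<longrightarrow>
    (\<forall>i \<in> supp (fst_avg (lad \<xi> n) L). \<psi> i \<in> M' \<and> h i \<le> \<psi> i) \<longrightarrow> \<psi> ` supp (fst_avg (lad \<xi> n) L) \<in> \<F>)"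
    using M'(2) unfolding spreads_into_def by blast
  then obtain H where H: "\<And>n L \<psi>. n \<ge> 1 \<Longrightarrow> L \<in> inf_subsets {1..} \<Longrightarrow> strict_mono_on (supp (fst_avg (lad \<xi> n) L)) \<psi> \<Longrightarrow>
    (\<And>i. i \<in> supp (fst_avg (lad \<xi> n) L) \<Longrightarrow> \<psi> i \<in> M' \<and> H n i \<le> \<psi> i) \<Longrightarrow> \<psi> ` supp (fst_avg (lad \<xi> n) L) \<in> \<F>"
    by metis
  have "spreads_into \<xi> M' \<F>"
    unfolding spreads_into_def
  proof (intro exI[of _ "\<lambda>i. Max ((\<lambda>n. H n i) ` {..i})"] ballI allI impI)
    fix L \<psi> assume L: "L \<in> inf_subsets {1..}" and mono: "strict_mono_on (supp (fst_avg \<xi> L)) \<psi>"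
      and \<psi>: "\<forall>i\<in>supp (fst_avg \<xi> L). \<psi> i \<in> M' \<and> Max ((\<lambda>n. H n i) ` {..i}) \<le> \<psi> i"
    have eq: "fst_avg \<xi> L = fst_avg (lad \<xi> (Inf L)) L" using fst_avg_limit[OF lim L] .
    show "\<psi> ` supp (fst_avg \<xi> L) \<in> \<F>"
      unfolding eq
    proof (rule H[OF Inf_ge_1[OF L] L])
      show "strict_mono_on (supp (fst_avg (lad \<xi> (Inf L)) L)) \<psi>" using mono unfolding eq .
      fix i assume "i \<in> supp (fst_avg (lad \<xi> (Inf L)) L)"
      then have i: "i \<in> supp (fst_avg \<xi> L)" unfolding eq .
      then have "Inf L \<le> i" using supp_fst_avg_subset[OF L] by (intro Inf_nat_le) auto
      then have "H (Inf L) i \<le> Max ((\<lambda>n. H n i) ` {..i})" by (intro Max_ge) auto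
      then show "\<psi> i \<in> M' \<and> H (Inf L) i \<le> \<psi> i" using \<psi> i by (meson order_trans)
    qed
  qed
  then show ?thesis using M'(1) by blast
qed

theorem dichotomy:
  assumes "hereditary \<F>" "M \<in> inf_subsets {1..}" "large \<xi> M \<F>"
  shows "\<exists>M' \<in> inf_subsets M. spreads_into \<xi> M' \<F>"
  using assms
proof (induction \<xi> arbitrary: \<F> M rule: less_induct)
  case (less \<xi>)
  show ?case
  proof (cases \<xi> rule: ord_cases)
    case zero
    then show ?thesis using dichotomy_zero less by blast
  next
    case (succ \<zeta>)
    show ?thesis unfolding succ
    proof (rule dichotomy_succ[OF _ less.prems(1,2)])
      show "large (ord_succ \<zeta>) M \<F>" using less.prems(3) unfolding succ .
    qed (use less.IH[of \<zeta>] succ less_ord_succ in blast)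
  next
    case limit
    show ?thesis
      by (rule dichotomy_limit[OF limit _ less.prems(2,3)])
        (use less.IH[OF ladder_less[OF lad limit]] less.prems(1) in blast)
  qed
qed

end

section \<open>Well-founded trees of labels\<close>

text \<open>The prefix \<open>t\<close> selects a subtree, as the induction along the tree needs.
  The labelling \<phi> separates the countable tree from the particular sequence whose terms it
  labels.\<close>

definition label_family :: "'b list set \<Rightarrow> 'b list \<Rightarrow> (nat \<Rightarrow> 'b) \<Rightarrow> nat set set"
  where "label_family T t \<phi> = {F. finite F \<and> t @ map \<phi> (sorted_list_of_set F) \<in> T}"

lemma subseq_sorted_list_of_set:
  fixes F :: "nat set"
  assumes "finite F" "E \<subseteq> F"
  shows "subseq (sorted_list_of_set E) (sorted_list_of_set F)"
proof -
  have "sorted_list_of_set E = filter (\<lambda>x. x \<in> E) (sorted_list_of_set F)"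
    using assms finite_subset[OF assms(2,1)]
    by (intro sorted_distinct_set_unique) (auto intro: sorted_wrt_filter)
  then show ?thesis by simp
qed

context ladder
begin

text \<open>The order must not depend on \<phi>. Each child of \<open>t\<close> has its own order;
  there are countably many labels, so some \<eta> exceeds all these orders, and \<eta> + 1 works at
  \<open>t\<close>. Fixing a point \<open>n\<close> of \<open>F\<close> moves the part of
  \<open>F\<close> after \<open>n\<close> into the child labelled \<open>\<phi> n\<close>.\<close>

lemma unif_null_label_family:
  fixes T :: "'b::countable list set"
  assumes sub: "\<And>s s'. s \<in> T \<Longrightarrow> subseq s' s \<Longrightarrow> s' \<in> T"
    and wf: "wf {(t @ [d], t) | t d. t @ [d] \<in> T}"
  shows "\<exists>\<xi>. \<forall>\<phi>. \<forall>M \<in> inf_subsets {1..}. \<exists>M' \<in> inf_subsets M.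
    unif_null \<xi> M' (indicators (label_family T t \<phi>))"
  using wf
proof (induction t rule: wf_induct_rule)
  case (less t)
  have "\<exists>\<xi>. \<forall>\<phi>. \<forall>M \<in> inf_subsets {1..}. \<exists>M' \<in> inf_subsets M.
    unif_null \<xi> M' (indicators (label_family T (t @ [d]) \<phi>))" for d
  proof (cases "t @ [d] \<in> T")
    case True
    then show ?thesis using less by blast
  next
    case False
    have "label_family T (t @ [d]) \<phi> = {}" for \<phi>
      using False sub[of "(t @ [d]) @ _" "t @ [d]"] unfolding label_family_def
      by (auto simp: subseq_rev_drop_many simp del: append_assoc)
    then show ?thesis
      using inf_subsets_refl by (intro exI[of _ 0]) (fastforce simp: unif_null_def indicators_def)
  qed
  then obtain \<Xi> where \<Xi>: "\<And>d \<phi> M. M \<in> inf_subsets {1..} \<Longrightarrow> \<exists>M' \<in> inf_subsets M.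
    unif_null (\<Xi> d) M' (indicators (label_family T (t @ [d]) \<phi>))" by metis
  obtain \<eta> where \<eta>: "\<And>d. \<Xi> d < \<eta>"
    using bounded_countable_ordinal[of "range \<Xi>"] by auto
  show ?case
  proof (intro exI[of _ "ord_succ \<eta>"] allI ballI)
    fix \<phi> M assume M: "M \<in> inf_subsets {1..}"
    let ?N = "\<lambda>n K. unif_null \<eta> K (indicators (label_family T (t @ [\<phi> n]) \<phi>))"
    obtain M1 where M1: "M1 \<in> inf_subsets M" "\<And>n. ?N n M1"
    proof (rule pseudo_intersection[of M ?N])
      show "infinite M" using M by (rule inf_subsets_infinite)
      show "?N n M2" if "?N n M1" "finite (M2 - M1)" for n M1 M2
        using that unif_null_mono by blast
      fix n M1 assume "M1 \<in> inf_subsets M"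
      then have M1: "M1 \<in> inf_subsets {1..}" using M inf_subsets_trans by blast
      obtain M2 where M2: "M2 \<in> inf_subsets M1"
        "unif_null (\<Xi> (\<phi> n)) M2 (indicators (label_family T (t @ [\<phi> n]) \<phi>))" using \<Xi> M1 by metis
      have "\<exists>M' \<in> inf_subsets M2. ?N n M'"
        using unif_null_increasing[OF less_imp_le[OF \<eta>[of "\<phi> n"]] inf_subsets_trans[OF M2(1) M1] M2(2), where C = 1]
          indicators_le_1 by blast
      then show "\<exists>M2 \<in> inf_subsets M1. ?N n M2" using M2(1) inf_subsets_trans by blast
    qed blast
    define R where "R c d \<longleftrightarrow> (\<forall>L\<in>inf_subsets M1. d \<le> Inf L \<longrightarrow>
      (\<forall>F\<in>label_family T (t @ [\<phi> c]) \<phi>. pairing (fst_avg \<eta> L) (indicator F) \<le> 1 / (real c + 1)))" for c d :: nat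
    have "\<exists>h. \<forall>d\<ge>h. R c d" for c
    proof -
      have "1 / (real c + 1) > 0" by simp
      with M1(2) obtain h where "\<And>L g. L \<in> inf_subsets M1 \<Longrightarrow> h \<le> Inf L \<Longrightarrow>
        g \<in> indicators (label_family T (t @ [\<phi> c]) \<phi>) \<Longrightarrow> pairing (fst_avg \<eta> L) g \<le> 1 / (real c + 1)"
        using unif_nullE by blast
      then show ?thesis unfolding R_def indicators_def by (intro exI[of _ h]) auto
    qed
    then obtain M' where M': "M' \<in> inf_subsets M1" "\<And>c d. c \<in> M' \<Longrightarrow> d \<in> M' \<Longrightarrow> c < d \<Longrightarrow> R c d"
      using sparse_subset[OF inf_subsets_infinite[OF M1(1)], where R = R] by blast
    have "unif_null (ord_succ \<eta>) M' (indicators (label_family T t \<phi>))"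
    proof (rule unif_nullI[where C = 2])
      fix L g assume L: "L \<in> inf_subsets M'" and "g \<in> indicators (label_family T t \<phi>)"
      then obtain F where F: "finite F" "t @ map \<phi> (sorted_list_of_set F) \<in> T" and g: "g = indicator F"
        unfolding indicators_def label_family_def by blast
      have L1: "L \<in> inf_subsets {1..}" using L M'(1) M1(1) M inf_subsets_trans by blast
      define s where "s = Inf L"
      have s: "s \<ge> 1" using Inf_ge_1[OF L1] by (simp add: s_def)
      let ?L = "rest \<eta> L"
      let ?S = "\<lambda>j. supp (fst_avg \<eta> (?L j))"
      let ?p = "\<lambda>j. pairing (fst_avg \<eta> (?L j)) g"
      note R = rest_in_inf_subsets[OF L1, of \<eta>] and R1 = rest_in_inf_subsets'[OF L1, of \<eta>]
      \<comment> \<open>The first block meeting \<open>F\<close> contributes at most 1. A point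
        \<open>n\<close> of it puts every later trace into a child family, on which the averages of
        order \<eta> are at most \<open>1 / real s\<close>. Hence the constant 2.\<close>
      define j0 where "j0 = (LEAST j. F \<inter> ?S j \<noteq> {})"
      have p: "?p j \<le> (if j = j0 then 1 else 0) + 1 / real s" for j
      proof (cases "F \<inter> ?S j = {}")
        case True
        then have "?p j = pairing (fst_avg \<eta> (?L j)) (\<lambda>_. 0)"
          by (intro pairing_cong) (auto simp: g indicator_def)
        then show ?thesis by (simp add: pairing_def)
      next
        case False
        show ?thesis
        proof (cases "j = j0")
          case True
          have "?p j \<le> 1" using R1 by (rule pairing_fst_avg_le) (auto simp: g indicator_def)
          then show ?thesis using True by (simp add: add_increasing2)
        next
          case j: False
          have "j0 \<le> j" unfolding j0_def using False by (rule Least_le)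
          then have "j0 < j" using j by simp
          have "F \<inter> ?S j0 \<noteq> {}" unfolding j0_def using False by (rule LeastI)
          then obtain n where n: "n \<in> F" "n \<in> ?S j0" by blast
          have n': "n < i" if "i \<in> ?L j" for i
            using supp_fst_avg_less_rest[OF L1 \<open>j0 < j\<close> n(2) that] .
          have nL: "n \<in> L" using supp_fst_avg_subset[OF R1] inf_subsets_subset[OF R] n(2) by blast
          then have "s \<le> n" unfolding s_def by (rule Inf_nat_le)
          let ?G = "F \<inter> ?S j"
          have G: "finite ?G" using F(1) by simp
          have nG: "\<forall>i\<in>?G. n < i" using n' supp_fst_avg_subset[OF R1] by blast
          \<comment> \<open>\<open>n\<close> need not be the least point of \<open>F\<close>, and
            \<open>F\<close> may have further points outside \<open>?G\<close>; closure under
            subsequences removes them from the list.\<close>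
          have "sorted_list_of_set (insert n ?G) = n # sorted_list_of_set ?G"
            using G nG by (intro sorted_distinct_set_unique) (auto simp: less_imp_le simp del: sorted_list_of_set_insert_remove)
          moreover have "subseq (sorted_list_of_set (insert n ?G)) (sorted_list_of_set F)"
            using F(1) n(1) by (intro subseq_sorted_list_of_set) auto
          ultimately have "subseq (map \<phi> (n # sorted_list_of_set ?G)) (map \<phi> (sorted_list_of_set F))"
            by (metis subseq_map)
          then have "subseq ((t @ [\<phi> n]) @ map \<phi> (sorted_list_of_set ?G)) (t @ map \<phi> (sorted_list_of_set F))"
            by (simp add: subseq_append')
          then have G': "?G \<in> label_family T (t @ [\<phi> n]) \<phi>"
            unfolding label_family_def using sub[OF F(2)] G by blast
          have Inf_R: "Inf (?L j) \<in> ?L j" using Inf_in_inf_subsets[OF R] .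
          have "Inf (?L j) \<in> M'" "n \<in> M'"
            using Inf_R nL inf_subsets_subset[OF R] inf_subsets_subset[OF L] by blast+
          then have "R n (Inf (?L j))" using M'(2) n'[OF Inf_R] by blast
          moreover have "?L j \<in> inf_subsets M1" using R L M'(1) inf_subsets_trans by blast
          ultimately have "pairing (fst_avg \<eta> (?L j)) (indicator ?G) \<le> 1 / (real n + 1)"
            using G' unfolding R_def by blast
          also have "pairing (fst_avg \<eta> (?L j)) (indicator ?G) = ?p j"
            by (rule pairing_cong) (auto simp: g indicator_def)
          also have "1 / (real n + 1) \<le> 1 / real s"
            using s \<open>s \<le> n\<close> by (intro divide_left_mono) auto
          finally show ?thesis using j by simp
        qed
      qed
      have "(\<Sum>j<s. ?p j) \<le> (\<Sum>j<s. (if j = j0 then 1 else 0) + 1 / real s)"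
        using p by (rule sum_mono)
      also have "\<dots> \<le> 2" using s by (simp add: sum.distrib)
      finally show "pairing (fst_avg (ord_succ \<eta>) L) g \<le> 2 / real (Inf L)"
        unfolding pairing_succ[OF L1] using s by (intro divide_right_mono) (auto simp: s_def)
    qed simp
    then show "\<exists>M' \<in> inf_subsets M. unif_null (ord_succ \<eta>) M' (indicators (label_family T t \<phi>))"
      using M'(1) M1(1) inf_subsets_trans by blast
  qed
qed

end


section \<open>Separation of convex sets\<close>

text \<open>Asking the inequality for all \<open>c > 0\<close> already yields equality, through
  \<open>1 / c\<close>, and it is the form that infima satisfy most directly.\<close>

definition sublinear :: "('a::real_vector \<Rightarrow> real) \<Rightarrow> bool"
  where "sublinear p \<longleftrightarrow> (\<forall>x y. p (x + y) \<le> p x + p y) \<and> (\<forall>c>0. \<forall>x. p (c *\<^sub>R x) \<le> c * p x)"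

lemma sublinear_add: "sublinear p \<Longrightarrow> p (x + y) \<le> p x + p y"
  by (simp add: sublinear_def)

lemma sublinear_scale:
  assumes "sublinear p" "c > 0"
  shows "p (c *\<^sub>R x) = c * p x"
proof (rule antisym)
  show "p (c *\<^sub>R x) \<le> c * p x" using assms by (simp add: sublinear_def)
  have "p ((1 / c) *\<^sub>R c *\<^sub>R x) \<le> (1 / c) * p (c *\<^sub>R x)"
    using assms unfolding sublinear_def by (metis zero_less_divide_1_iff)
  then show "c * p x \<le> p (c *\<^sub>R x)" using assms by (simp add: field_simps)
qed

lemma sublinear_0: "sublinear p \<Longrightarrow> p 0 = 0"
  using sublinear_scale[of p 2 0] by simp

lemma sublinear_ge_minus: "sublinear p \<Longrightarrow> - p (- x) \<le> p x"
  using sublinear_add[of p x "- x"] by (simp add: sublinear_0)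

text \<open>Lowering \<open>q\<close> along the ray of \<open>y\<close> gives a sublinear
  \<open>r\<close> below \<open>q\<close>. Minimality forces \<open>r = q\<close>, and
  \<open>t = 1\<close> then says that \<open>q\<close> is superadditive.\<close>

lemma minimal_sublinear_linear:
  assumes q: "sublinear q" and min: "\<And>r. sublinear r \<Longrightarrow> r \<le> q \<Longrightarrow> r = q"
  shows "linear q"
proof -
  have le: "q x + q y \<le> q (x + y)" for x y
  proof -
    define r where "r x = (INF t\<in>{0..}. q (x + t *\<^sub>R y) - t * q y)" for x
    have ty: "q (t *\<^sub>R y) = t * q y" if "t \<ge> 0" for t
      using that sublinear_scale[OF q] sublinear_0[OF q] by (cases "t = 0") auto
    have lower: "- q (- x) \<le> q (x + t *\<^sub>R y) - t * q y" if "t \<ge> 0" for x t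
      using sublinear_add[OF q, of "x + t *\<^sub>R y" "- x"] ty[OF that] by simp
    then have bdd: "bdd_below ((\<lambda>t. q (x + t *\<^sub>R y) - t * q y) ` {0..})" for x
      by (intro bdd_belowI2) auto
    have r_le: "r x \<le> q (x + t *\<^sub>R y) - t * q y" if "t \<ge> 0" for x t
      unfolding r_def using bdd that by (intro cINF_lower) auto
    have r_ge: "c \<le> r x" if "\<And>t. t \<ge> 0 \<Longrightarrow> c \<le> q (x + t *\<^sub>R y) - t * q y" for x c
      unfolding r_def using that by (intro cINF_greatest) auto
    have "sublinear r"
      unfolding sublinear_def
    proof (intro conjI allI impI)
      fix x x'
      have "r (x + x') - (q (x' + t' *\<^sub>R y) - t' * q y) \<le> r x" if t': "t' \<ge> 0" for t'
      proof (rule r_ge)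
        fix t :: real assume t: "t \<ge> 0"
        have "r (x + x') \<le> q ((x + x') + (t + t') *\<^sub>R y) - (t + t') * q y"
          using t t' by (intro r_le) auto
        also have "(x + x') + (t + t') *\<^sub>R y = (x + t *\<^sub>R y) + (x' + t' *\<^sub>R y)"
          by (simp add: algebra_simps)
        also have "q \<dots> \<le> q (x + t *\<^sub>R y) + q (x' + t' *\<^sub>R y)" by (rule sublinear_add[OF q])
        finally show "r (x + x') - (q (x' + t' *\<^sub>R y) - t' * q y) \<le> q (x + t *\<^sub>R y) - t * q y"
          by (simp add: algebra_simps)
      qed
      then have "r (x + x') - r x \<le> r x'" by (intro r_ge) (simp add: algebra_simps)
      then show "r (x + x') \<le> r x + r x'" by simp
    next
      fix c :: real and x assume c: "c > 0"
      have "r (c *\<^sub>R x) / c \<le> r x"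
      proof (rule r_ge)
        fix t :: real assume t: "t \<ge> 0"
        have "r (c *\<^sub>R x) \<le> q (c *\<^sub>R x + (c * t) *\<^sub>R y) - c * t * q y" using c t by (intro r_le) auto
        also have "c *\<^sub>R x + (c * t) *\<^sub>R y = c *\<^sub>R (x + t *\<^sub>R y)" by (simp add: algebra_simps)
        also have "q \<dots> = c * q (x + t *\<^sub>R y)" using sublinear_scale[OF q c] .
        finally show "r (c *\<^sub>R x) / c \<le> q (x + t *\<^sub>R y) - t * q y" using c by (simp add: field_simps)
      qed
      then show "r (c *\<^sub>R x) \<le> c * r x" using c by (simp add: field_simps)
    qed
    moreover have "r \<le> q" using r_le[of 0] by (auto simp: le_fun_def)
    ultimately have "r = q" by (rule min)
    then show ?thesis using r_le[of 1 x] by simp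
  qed
  have add: "q (x + y) = q x + q y" for x y using le sublinear_add[OF q] by (simp add: antisym)
  have "q (c *\<^sub>R x) = c * q x" for c x
  proof -
    have neg: "q (- x) = - q x" for x using add[of x "- x"] sublinear_0[OF q] by simp
    consider "c > 0" | "c = 0" | "- c > 0" by linarith
    then show ?thesis
    proof cases
      case 3
      then show ?thesis using sublinear_scale[OF q 3, of x] neg[of "c *\<^sub>R x"] by simp
    qed (use sublinear_scale[OF q] sublinear_0[OF q] in auto)
  qed
  then show ?thesis using add by (intro linearI) auto
qed

text \<open>Zorn's lemma downwards. The pointwise infimum of a chain is finite because
  \<open>- p (- x)\<close> bounds it from below, and subadditive because two members of a chain can
  be replaced by the smaller one.\<close>

theorem Hahn_Banach_sublinear:
  assumes p: "sublinear p"
  obtains f where "linear f" "\<And>x. f x \<le> p x"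
proof -
  let ?A = "{q. sublinear q \<and> q \<le> p}"
  let ?P = "\<lambda>a b :: 'a \<Rightarrow> real. b \<le> a"
  have "\<exists>m\<in>?A. \<forall>a\<in>?A. ?P m a \<longrightarrow> a = m"
  proof (rule predicate_Zorn)
    show "partial_order_on ?A (relation_of ?P ?A)"
      by (rule partial_order_on_relation_ofI) auto
    fix C assume C: "C \<in> Chains (relation_of ?P ?A)"
    have CA: "sublinear q" "q \<le> p" if "q \<in> C" for q
      using C that by (auto simp: Chains_def relation_of_def)
    have chain: "q \<le> q' \<or> q' \<le> q" if "q \<in> C" "q' \<in> C" for q q'
      using C that by (auto simp: Chains_def relation_of_def)
    show "\<exists>u\<in>?A. \<forall>a\<in>C. ?P a u"
    proof (cases "C = {}")
      case True
      then show ?thesis using p by auto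
    next
      case False
      define u where "u x = (INF q\<in>C. q x)" for x
      have "- p (- x) \<le> q x" if "q \<in> C" for q x
        using sublinear_ge_minus[OF CA(1)[OF that], of x] CA(2)[OF that] unfolding le_fun_def
        by (meson le_minus_iff neg_le_iff_le order_trans)
      then have u_le: "u x \<le> q x" if "q \<in> C" for q x
        unfolding u_def using that by (intro cINF_lower bdd_belowI2) auto
      have u_ge: "c \<le> u x" if "\<And>q. q \<in> C \<Longrightarrow> c \<le> q x" for x c
        unfolding u_def using that False by (intro cINF_greatest) auto
      have "sublinear u"
        unfolding sublinear_def
      proof (intro conjI allI impI)
        fix x y
        have "u (x + y) \<le> q x + q' y" if qq': "q \<in> C" "q' \<in> C" for q q'
        proof -
          obtain q0 where q0: "q0 \<in> C" "q0 \<le> q" "q0 \<le> q'" using chain[OF qq'] qq' by blast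
          have "u (x + y) \<le> q0 x + q0 y" using u_le[OF q0(1)] sublinear_add[OF CA(1)[OF q0(1)]]
            by (meson order_trans)
          then show ?thesis using q0 unfolding le_fun_def by (meson add_mono order_trans)
        qed
        then have "u (x + y) - q' y \<le> u x" if "q' \<in> C" for q'
          using that by (intro u_ge) (simp add: algebra_simps)
        then have "u (x + y) - u x \<le> u y" by (intro u_ge) (simp add: algebra_simps)
        then show "u (x + y) \<le> u x + u y" by simp
      next
        fix c :: real and x assume c: "c > 0"
        have "u (c *\<^sub>R x) / c \<le> u x"
        proof (rule u_ge)
          fix q assume "q \<in> C"
          then show "u (c *\<^sub>R x) / c \<le> q x"
            using u_le[of q "c *\<^sub>R x"] sublinear_scale[OF CA(1) c] c by (simp add: field_simps)
        qed
        then show "u (c *\<^sub>R x) \<le> c * u x" using c by (simp add: field_simps)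
      qed
      moreover have "u \<le> p"
        using False u_le CA(2) unfolding le_fun_def by (meson ex_in_conv order_trans)
      ultimately show ?thesis using u_le by (intro bexI[of _ u]) (auto simp: le_fun_def)
    qed
  qed
  then obtain q where q: "sublinear q" "q \<le> p" "\<And>r. sublinear r \<Longrightarrow> r \<le> q \<Longrightarrow> r = q"
    by (auto intro: order_trans)
  show thesis using that[of q] minimal_sublinear_linear[OF q(1,3)] q(2) by (auto simp: le_fun_def)
qed

text \<open>The functional \<open>p\<close> encodes both goals: a linear \<open>f\<close> below it
  satisfies \<open>f y \<le> norm y\<close> by \<open>t = 0\<close>, and
  \<open>f (- c) \<le> - \<delta>\<close> by \<open>y = - c\<close> and \<open>t = 1\<close>. The
  bound on the norms keeps \<open>p\<close> finite, and convexity makes it subadditive.\<close>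

lemma separate_convex_from_0:
  fixes C :: "'a::real_normed_vector set"
  assumes C: "convex C" "C \<noteq> {}" and \<delta>: "\<And>c. c \<in> C \<Longrightarrow> \<delta> \<le> norm c"
  obtains f :: "'a \<Rightarrow>\<^sub>L real" where "norm f \<le> 1" "\<And>c. c \<in> C \<Longrightarrow> \<delta> \<le> f c"
proof -
  let ?h = "\<lambda>y (t, c). norm (y + t *\<^sub>R c) - t * \<delta>"
  define p where "p y = (INF tc\<in>{0..} \<times> C. ?h y tc)" for y :: 'a
  obtain c0 where c0: "c0 \<in> C" using C(2) by blast
  have "- norm y \<le> norm (y + t *\<^sub>R c) - t * \<delta>" if "t \<ge> 0" "c \<in> C" for y t c
  proof -
    have "t * \<delta> \<le> norm (t *\<^sub>R c)" using that \<delta> by (simp add: mult_left_mono)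
    also have "\<dots> \<le> norm (y + t *\<^sub>R c) + norm y"
      using norm_triangle_ineq4[of "y + t *\<^sub>R c" y] by simp
    finally show ?thesis by simp
  qed
  then have bdd: "bdd_below (?h y ` ({0..} \<times> C))" for y by (intro bdd_belowI2) auto
  have p_le: "p y \<le> norm (y + t *\<^sub>R c) - t * \<delta>" if "t \<ge> 0" "c \<in> C" for y t c
    unfolding p_def using cINF_lower[OF bdd, of "(t, c)" y] that by simp
  have p_ge: "a \<le> p y" if "\<And>t c. t \<ge> 0 \<Longrightarrow> c \<in> C \<Longrightarrow> a \<le> norm (y + t *\<^sub>R c) - t * \<delta>" for y a
    unfolding p_def using that C(2) by (intro cINF_greatest) auto
  have "sublinear p"
    unfolding sublinear_def
  proof (intro conjI allI impI)
    fix x y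
    have *: "p (x + y) \<le> (norm (x + t *\<^sub>R c) - t * \<delta>) + (norm (y + s *\<^sub>R d) - s * \<delta>)"
      if tc: "t \<ge> 0" "c \<in> C" "s \<ge> 0" "d \<in> C" for t c s d
    proof -
      obtain e where e: "e \<in> C" "(t + s) *\<^sub>R e = t *\<^sub>R c + s *\<^sub>R d"
      proof (cases "t + s = 0")
        case True
        then have "t = 0" "s = 0" using tc by auto
        then show ?thesis using that[of c] tc by simp
      next
        case False
        then have pos: "t + s > 0" using tc by simp
        have "(t / (t + s)) *\<^sub>R c + (s / (t + s)) *\<^sub>R d \<in> C"
          using tc pos by (intro convexD[OF C(1)]) (auto simp: divide_simps)
        moreover have "(t + s) *\<^sub>R ((t / (t + s)) *\<^sub>R c + (s / (t + s)) *\<^sub>R d) = t *\<^sub>R c + s *\<^sub>R d"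
          using False by (simp add: scaleR_add_right)
        ultimately show ?thesis using that by blast
      qed
      have "p (x + y) \<le> norm ((x + y) + (t + s) *\<^sub>R e) - (t + s) * \<delta>"
        using tc e by (intro p_le) auto
      also have "(x + y) + (t + s) *\<^sub>R e = (x + t *\<^sub>R c) + (y + s *\<^sub>R d)"
        unfolding e(2) by simp
      also have "norm \<dots> \<le> norm (x + t *\<^sub>R c) + norm (y + s *\<^sub>R d)" by (rule norm_triangle_ineq)
      finally show ?thesis by (simp add: algebra_simps)
    qed
    have "p (x + y) - (norm (y + s *\<^sub>R d) - s * \<delta>) \<le> p x" if "s \<ge> 0" "d \<in> C" for s d
      using *[OF _ _ that] by (intro p_ge) (simp add: algebra_simps)
    then have "p (x + y) - p x \<le> p y" by (intro p_ge) (simp add: algebra_simps)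
    then show "p (x + y) \<le> p x + p y" by simp
  next
    fix a :: real and x assume a: "a > 0"
    have "p (a *\<^sub>R x) / a \<le> p x"
    proof (rule p_ge)
      fix t c assume tc: "t \<ge> (0::real)" "c \<in> C"
      have "p (a *\<^sub>R x) \<le> norm (a *\<^sub>R x + (a * t) *\<^sub>R c) - a * t * \<delta>" using a tc by (intro p_le) auto
      also have "a *\<^sub>R x + (a * t) *\<^sub>R c = a *\<^sub>R (x + t *\<^sub>R c)" by (simp add: scaleR_add_right)
      also have "norm \<dots> = a * norm (x + t *\<^sub>R c)" using a by simp
      finally show "p (a *\<^sub>R x) / a \<le> norm (x + t *\<^sub>R c) - t * \<delta>" using a by (simp add: field_simps)
    qed
    then show "p (a *\<^sub>R x) \<le> a * p x" using a by (simp add: field_simps)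
  qed
  then obtain f where f: "linear f" "\<And>x. f x \<le> p x" using Hahn_Banach_sublinear by blast
  have f_norm: "f x \<le> norm x" for x using f(2)[of x] p_le[of 0 c0 x] c0 by simp
  have abs_f: "\<bar>f x\<bar> \<le> norm x" for x
    using f_norm[of x] f_norm[of "- x"] linear_neg[OF f(1)] by simp
  have bl: "bounded_linear f"
    using f(1) abs_f by (intro bounded_linear.intro) (auto simp: bounded_linear_axioms_def intro!: exI[of _ 1])
  show thesis
  proof (rule that[of "Blinfun f"])
    show "norm (Blinfun f) \<le> 1"
      using abs_f by (intro norm_blinfun_bound) (auto simp: bounded_linear_Blinfun_apply[OF bl])
    fix c assume "c \<in> C"
    then have "f (- c) \<le> - \<delta>" using f(2)[of "- c"] p_le[of 1 c "- c"] by simp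
    then show "\<delta> \<le> Blinfun f c" using linear_neg[OF f(1)] by (simp add: bounded_linear_Blinfun_apply[OF bl])
  qed
qed

lemma norming_functional:
  fixes u :: "'a::real_normed_vector"
  obtains f :: "'a \<Rightarrow>\<^sub>L real" where "norm f \<le> 1" "norm u \<le> f u"
  using separate_convex_from_0[of "{u}" "norm u"] by auto

lemma blinfun_le_norm:
  fixes f :: "'a::real_normed_vector \<Rightarrow>\<^sub>L real"
  assumes "norm f \<le> 1"
  shows "\<bar>f x\<bar> \<le> norm x"
  using norm_blinfun[of f x] mult_right_mono[OF assms norm_ge_zero[of x]] by simp


section \<open>Weak cluster points in reflexive spaces\<close>

definition is_weak_cluster :: "(nat \<Rightarrow> 'a::real_normed_vector) \<Rightarrow> 'a \<Rightarrow> bool"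
  where "is_weak_cluster z x0 \<longleftrightarrow> (\<forall>(\<Phi> :: ('a \<Rightarrow>\<^sub>L real) set) e N. finite \<Phi> \<longrightarrow> e > 0 \<longrightarrow>
    (\<exists>n\<ge>N. \<forall>f\<in>\<Phi>. \<bar>blinfun_apply f (z n) - blinfun_apply f x0\<bar> < e))"

lemma is_weak_clusterD:
  fixes \<Phi> :: "('a::real_normed_vector \<Rightarrow>\<^sub>L real) set"
  assumes "is_weak_cluster z x0" "finite \<Phi>" "e > 0"
  shows "\<exists>n\<ge>N. \<forall>f\<in>\<Phi>. \<bar>blinfun_apply f (z n) - blinfun_apply f x0\<bar> < e"
  using assms unfolding is_weak_cluster_def by simp

text \<open>The evaluations at the points \<open>z n\<close> lie in a product of compact intervals.
  A cluster point there is linear and bounded, since each such condition involves finitely many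
  coordinates, and reflexivity represents it by a vector.\<close>

lemma weak_cluster_point:
  fixes z :: "nat \<Rightarrow> 'a::real_normed_vector"
  assumes refl: "reflexive_space TYPE('a)" and bd: "\<And>n. norm (z n) \<le> B"
  obtains x0 where "is_weak_cluster z x0"
proof -
  have B: "B \<ge> 0" using bd[of 0] norm_ge_zero order_trans by blast
  define K where "K = PiE (UNIV :: ('a \<Rightarrow>\<^sub>L real) set) (\<lambda>f. {- (norm f * B)..norm f * B})"
  have "compact K"
    unfolding K_def compactin_euclidean_iff[symmetric] euclidean_product_topology[symmetric]
    by (subst compactin_PiE) (auto simp: compactin_euclidean_iff)
  define ev where "ev n = (\<lambda>f :: 'a \<Rightarrow>\<^sub>L real. blinfun_apply f (z n))" for n
  have "\<bar>blinfun_apply f (z n)\<bar> \<le> norm f * B" for f :: "'a \<Rightarrow>\<^sub>L real" and n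
    using norm_blinfun[of f "z n"] mult_left_mono[OF bd[of n] norm_ge_zero[of f]] by simp
  then have "ev n \<in> K" for n by (auto simp: K_def ev_def abs_le_iff minus_le_iff)
  then have "eventually (\<lambda>x. x \<in> K) (filtermap ev sequentially)"
    by (simp add: eventually_filtermap)
  moreover have "filtermap ev sequentially \<noteq> bot" by (simp add: filtermap_bot_iff)
  ultimately obtain \<Lambda> where \<Lambda>: "inf (nhds \<Lambda>) (filtermap ev sequentially) \<noteq> bot"
    using \<open>compact K\<close> unfolding compact_filter by blast
  have cluster: "\<exists>n\<ge>N. \<forall>f\<in>\<Phi>. \<bar>blinfun_apply f (z n) - \<Lambda> f\<bar> < e" if \<Phi>: "finite \<Phi>" "e > 0" for \<Phi> e N
  proof (rule ccontr)
    assume neg: "\<not> ?thesis"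
    let ?U = "{g. \<forall>f\<in>\<Phi>. g f \<in> ball (\<Lambda> f) e}"
    have "open ?U" using product_topology_basis'[OF \<Phi>(1), of "\<lambda>f. ball (\<Lambda> f) e" id] by simp
    then have "eventually (\<lambda>g. g \<in> ?U) (nhds \<Lambda>)"
      using \<Phi>(2) by (intro eventually_nhds_in_open) auto
    moreover have "ev n \<notin> ?U" if "n \<ge> N" for n
      using neg that by (auto simp: ev_def dist_real_def abs_minus_commute)
    then have "eventually (\<lambda>g. g \<notin> ?U) (filtermap ev sequentially)"
      unfolding eventually_filtermap eventually_sequentially by blast
    ultimately have "eventually (\<lambda>g. False) (inf (nhds \<Lambda>) (filtermap ev sequentially))"
      unfolding eventually_inf by (intro exI[of _ "\<lambda>g. g \<in> ?U"] exI[of _ "\<lambda>g. g \<notin> ?U"]) auto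
    then show False using \<Lambda> by (simp add: trivial_limit_def)
  qed
  \<comment> \<open>One identity covers additivity and homogeneity. It is tested at three
    coordinates simultaneously, with \<open>e\<close> chosen so that the weighted errors stay below
    \<open>D\<close>.\<close>
  have lin: "\<Lambda> h = a * \<Lambda> f + b * \<Lambda> g"
    if h: "\<And>x. blinfun_apply h x = a * blinfun_apply f x + b * blinfun_apply g x" for a b f g h
  proof (rule ccontr)
    assume neq: "\<Lambda> h \<noteq> a * \<Lambda> f + b * \<Lambda> g"
    define D where "D = \<bar>\<Lambda> h - (a * \<Lambda> f + b * \<Lambda> g)\<bar>"
    define e where "e = D / (1 + \<bar>a\<bar> + \<bar>b\<bar>)"
    have "D > 0" using neq by (simp add: D_def)
    then have "e > 0" by (simp add: e_def add_pos_nonneg)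
    then obtain n where n: "\<forall>k\<in>{f, g, h}. \<bar>blinfun_apply k (z n) - \<Lambda> k\<bar> < e"
      using cluster[of "{f, g, h}" e 0] by auto
    have "\<Lambda> h - (a * \<Lambda> f + b * \<Lambda> g) =
      - (h (z n) - \<Lambda> h) + a * (f (z n) - \<Lambda> f) + b * (g (z n) - \<Lambda> g)"
      by (simp add: h algebra_simps)
    then have "D \<le> \<bar>h (z n) - \<Lambda> h\<bar> + \<bar>a\<bar> * \<bar>f (z n) - \<Lambda> f\<bar> + \<bar>b\<bar> * \<bar>g (z n) - \<Lambda> g\<bar>"
      unfolding D_def by (simp flip: abs_mult)
    also have "\<dots> < e + \<bar>a\<bar> * e + \<bar>b\<bar> * e"
      using n by (intro add_less_le_mono mult_left_mono) (auto intro: less_imp_le)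
    also have "\<dots> = (1 + \<bar>a\<bar> + \<bar>b\<bar>) * e" by (simp add: algebra_simps)
    also have "\<dots> = D" using add_pos_nonneg[of 1 "\<bar>a\<bar> + \<bar>b\<bar>"] by (simp add: e_def)
    finally show False by simp
  qed
  have bound: "\<bar>\<Lambda> f\<bar> \<le> norm f * B" for f
  proof (rule field_le_epsilon)
    fix e :: real assume "e > 0"
    then obtain n where n: "\<bar>blinfun_apply f (z n) - \<Lambda> f\<bar> < e" using cluster[of "{f}" e 0] by auto
    then show "\<bar>\<Lambda> f\<bar> \<le> norm f * B + e"
      using \<open>\<And>f n. \<bar>blinfun_apply f (z n)\<bar> \<le> norm f * B\<close>[of f n] by linarith
  qed
  have bl: "bounded_linear \<Lambda>"
  proof (rule bounded_linear_intro)
    show "\<Lambda> (f + g) = \<Lambda> f + \<Lambda> g" for f g using lin[of "f + g" 1 f 1 g] by (simp add: plus_blinfun.rep_eq)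
    show "\<Lambda> (r *\<^sub>R f) = r *\<^sub>R \<Lambda> f" for r f using lin[of "r *\<^sub>R f" r f 0 f] by (simp add: scaleR_blinfun.rep_eq)
    show "norm (\<Lambda> f) \<le> norm f * B" for f using bound by simp
  qed
  obtain x0 where x0: "canonical_embedding x0 = Blinfun \<Lambda>"
    using refl unfolding reflexive_space_def by (metis surj_def)
  have "\<Lambda> f = blinfun_apply f x0" for f
    using canonical_embedding_apply[of x0 f] by (simp add: x0 bounded_linear_Blinfun_apply[OF bl])
  then have "is_weak_cluster z x0" using cluster unfolding is_weak_cluster_def by simp
  then show thesis by (rule that)
qed

text \<open>A norm substitute for weak nullness: a norm limit of convex combinations with supports tending
  to infinity must be 0.\<close>

definition mazur_on :: "nat set \<Rightarrow> (nat \<Rightarrow> 'a::real_normed_vector) \<Rightarrow> bool"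
  where "mazur_on M w \<longleftrightarrow> (\<forall>k\<in>M. \<forall>u \<in> convex hull (w ` (M \<inter> {..k})). \<forall>v \<in> convex hull (w ` (M \<inter> {k<..})).
    norm u - 1 / (real k + 1) \<le> norm (u - v))"

lemma mazur_onD:
  assumes "mazur_on M w" "k \<in> M" "u \<in> convex hull (w ` (M \<inter> {..k}))" "v \<in> convex hull (w ` (M \<inter> {k<..}))"
  shows "norm u - 1 / (real k + 1) \<le> norm (u - v)"
  using assms unfolding mazur_on_def by blast

text \<open>For each \<open>k\<close>, finitely many functionals norm the hull of an initial segment
  up to \<open>2 * \<tau> k\<close>, and later points are chosen where these functionals are at most
  \<open>\<tau> k\<close>. The total loss \<open>3 * \<tau> k\<close> is the error in
  \<open>mazur_on\<close>.\<close>

lemma mazur_sequence: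
  fixes z :: "nat \<Rightarrow> 'a::real_normed_vector"
  assumes refl: "reflexive_space TYPE('a)" and bd: "\<And>n. norm (z n) \<le> B"
  obtains x0 M where "M \<in> inf_subsets {1..}" "mazur_on M (\<lambda>i. z i - x0)"
proof -
  obtain x0 where "is_weak_cluster z x0"
    using weak_cluster_point[OF refl bd] .
  note x0 = is_weak_clusterD[OF this]
  define w where "w i = z i - x0" for i
  define \<tau> where "\<tau> k = 1 / (3 * (real k + 1))" for k
  have \<tau>: "\<tau> k > 0" for k by (simp add: \<tau>_def)
  \<comment> \<open>The hull runs over all indices up to \<open>k\<close>, since \<open>M\<close> is
    chosen only afterwards. One \<open>\<tau> k\<close> accounts for the change of the norm from
    \<open>u\<close> to a point of a finite net, the other for the change of the functional.\<close>
  have "\<exists>\<Phi> :: ('a \<Rightarrow>\<^sub>L real) set. finite \<Phi> \<and> (\<forall>f\<in>\<Phi>. norm f \<le> 1) \<and>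
    (\<forall>u \<in> convex hull (w ` {..k}). \<exists>f\<in>\<Phi>. norm u - 2 * \<tau> k \<le> blinfun_apply f u)" for k
  proof -
    have "compact (convex hull (w ` {..k}))" by (intro finite_imp_compact_convex_hull) auto
    then obtain C where C: "finite C" "convex hull (w ` {..k}) \<subseteq> (\<Union>x\<in>C. ball x (\<tau> k))"
      using compact_eq_totally_bounded \<tau> by metis
    have "\<forall>x. \<exists>f :: 'a \<Rightarrow>\<^sub>L real. norm f \<le> 1 \<and> norm x \<le> blinfun_apply f x" using norming_functional by metis
    then obtain F :: "'a \<Rightarrow> 'a \<Rightarrow>\<^sub>L real" where F: "\<And>x. norm (F x) \<le> 1" "\<And>x. norm x \<le> blinfun_apply (F x) x" by metis
    show ?thesis
    proof (intro exI[of _ "F ` C"] conjI ballI)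
      fix u assume "u \<in> convex hull (w ` {..k})"
      then obtain x where x: "x \<in> C" "dist x u < \<tau> k" using C by auto
      have "\<bar>blinfun_apply (F x) (u - x)\<bar> < \<tau> k"
        using blinfun_le_norm[OF F(1)] x(2) by (metis dist_commute dist_norm le_less_trans)
      moreover have "blinfun_apply (F x) u = blinfun_apply (F x) x + blinfun_apply (F x) (u - x)" by (simp add: blinfun.diff_right)
      moreover have "norm u - \<tau> k \<le> norm x"
        using x(2) norm_triangle_ineq3[of u x] by (simp add: dist_norm norm_minus_commute)
      ultimately have "norm u - 2 * \<tau> k \<le> blinfun_apply (F x) u" using F(2)[of x] by linarith
      then show "\<exists>f\<in>F ` C. norm u - 2 * \<tau> k \<le> blinfun_apply f u" using x(1) by blast
    qed (use C F in auto)
  qed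
  then obtain \<Phi> where \<Phi>: "\<And>k. finite (\<Phi> k)" "\<And>k f. f \<in> \<Phi> k \<Longrightarrow> norm f \<le> 1"
    "\<And>k u. u \<in> convex hull (w ` {..k}) \<Longrightarrow> \<exists>f\<in>\<Phi> k. norm u - 2 * \<tau> k \<le> blinfun_apply f u"
    by metis
  have "\<exists>m>n. m \<in> {1..} \<and> (\<forall>i\<le>n. \<forall>f\<in>\<Phi> i. blinfun_apply f (w m) \<le> \<tau> i)" for n
  proof -
    obtain m where m: "m \<ge> Suc n" "\<forall>f\<in>(\<Union>i\<le>n. \<Phi> i). \<bar>blinfun_apply f (z m) - blinfun_apply f x0\<bar> < \<tau> n"
      using x0[of "\<Union>i\<le>n. \<Phi> i" "\<tau> n" "Suc n"] \<Phi>(1) \<tau> by blast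
    have "\<tau> n \<le> \<tau> i" if "i \<le> n" for i using that by (simp add: \<tau>_def divide_simps)
    then show ?thesis using m by (intro exI[of _ m]) (fastforce simp: w_def blinfun.diff_right)
  qed
  then obtain M where M: "M \<in> inf_subsets {1..}"
    "\<And>k m. k \<in> M \<Longrightarrow> m \<in> M \<Longrightarrow> k < m \<Longrightarrow> \<forall>f\<in>\<Phi> k. blinfun_apply f (w m) \<le> \<tau> k"
    using greedy_subset[of "{1..}" "\<lambda>k m. \<forall>f\<in>\<Phi> k. blinfun_apply f (w m) \<le> \<tau> k"] by blast
  have "norm u - 1 / (real k + 1) \<le> norm (u - v)"
    if k: "k \<in> M" and u: "u \<in> convex hull (w ` (M \<inter> {..k}))" and v: "v \<in> convex hull (w ` (M \<inter> {k<..}))"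
    for k u v
  proof -
    have "u \<in> convex hull (w ` {..k})" using u hull_mono[of "w ` (M \<inter> {..k})" "w ` {..k}"] by blast
    then obtain f where f: "f \<in> \<Phi> k" "norm u - 2 * \<tau> k \<le> f u" using \<Phi>(3) by blast
    have "convex hull (w ` (M \<inter> {k<..})) \<subseteq> {x. f x \<le> \<tau> k}"
    proof (rule hull_minimal)
      show "w ` (M \<inter> {k<..}) \<subseteq> {x. f x \<le> \<tau> k}" using M(2)[OF k] f(1) by auto
      show "convex {x. f x \<le> \<tau> k}"
        unfolding convex_def by (auto simp: blinfun.add_right blinfun.scaleR_right intro: convex_bound_le)
    qed
    then have "f v \<le> \<tau> k" using v by blast
    moreover have "f u - f v \<le> norm (u - v)"
      using blinfun_le_norm[OF \<Phi>(2)[OF f(1)], of "u - v"] by (simp add: blinfun.diff_right)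
    moreover have "3 * \<tau> k = 1 / (real k + 1)"
      unfolding \<tau>_def by (metis mult.right_neutral mult_divide_mult_cancel_left times_divide_eq_right zero_neq_numeral)
    ultimately show ?thesis using f(2) by linarith
  qed
  then have "mazur_on M w" unfolding mazur_on_def by blast
  then show thesis using that[OF M(1), of x0] unfolding w_def by blast
qed

lemma convex_hull_image_finite:
  fixes z :: "nat \<Rightarrow> 'a::real_vector"
  assumes "u \<in> convex hull (z ` A)"
  obtains n where "\<And>m. n \<le> m \<Longrightarrow> u \<in> convex hull (z ` (A \<inter> {..<m}))"
proof -
  obtain S c where S: "finite S" "S \<subseteq> z ` A" "\<forall>x\<in>S. 0 \<le> c x" "sum c S = 1" "(\<Sum>v\<in>S. c v *\<^sub>R v) = u"
    using assms unfolding convex_hull_explicit by blast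
  obtain A' where A': "A' \<subseteq> A" "finite A'" "S = z ` A'" using finite_subset_image[OF S(1,2)] by blast
  obtain n where n: "\<forall>i\<in>A'. i < n" using A'(2)[unfolded finite_nat_set_iff_bounded] by blast
  have "u \<in> convex hull (z ` (A \<inter> {..<m}))" if "n \<le> m" for m
  proof -
    have "S \<subseteq> z ` (A \<inter> {..<m})" using A' n that by fastforce
    then show ?thesis using S unfolding convex_hull_explicit by blast
  qed
  then show thesis using that by blast
qed

text \<open>The easy half of James' criterion. By separation, the weak cluster point is a norm limit
  of convex combinations of every tail; \<open>u\<close> involves finitely many terms, and
  \<open>v\<close> is taken from the tail after them.\<close>

lemma reflexive_not_separated:
  fixes z :: "nat \<Rightarrow> 'a::real_normed_vector"
  assumes refl: "reflexive_space TYPE('a)" and bd: "\<And>n. norm (z n) \<le> B" and e: "e > 0"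
  obtains j u v where "u \<in> convex hull (z ` {..<j})" "v \<in> convex hull (z ` {j..})" "norm (u - v) < e"
proof -
  obtain x0 where "is_weak_cluster z x0"
    using weak_cluster_point[OF refl bd] .
  note x0 = is_weak_clusterD[OF this]
  have near: "\<exists>v \<in> convex hull (z ` {j..}). norm (v - x0) < e / 2" for j
  proof (rule ccontr)
    assume neg: "\<not> ?thesis"
    let ?C = "(\<lambda>v. v - x0) ` (convex hull (z ` {j..}))"
    have "convex ?C" by (intro convex_translation_subtract convex_convex_hull)
    moreover have "?C \<noteq> {}" by simp
    moreover have "e / 2 \<le> norm c" if "c \<in> ?C" for c using neg that by (auto simp: not_less)
    ultimately obtain f :: "'a \<Rightarrow>\<^sub>L real" where f: "\<And>c. c \<in> ?C \<Longrightarrow> e / 2 \<le> f c"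
      using separate_convex_from_0 by blast
    obtain n where n: "n \<ge> j" "\<bar>f (z n) - f x0\<bar> < e / 2" using x0[of "{f}" "e / 2" j] e half_gt_zero by blast
    have "z n \<in> convex hull (z ` {j..})" using n(1) by (intro hull_inc) auto
    then have "e / 2 \<le> f (z n - x0)" using f by blast
    then show False using n(2) unfolding blinfun.diff_right by linarith
  qed
  obtain u where u: "u \<in> convex hull (z ` {0..})" "norm (u - x0) < e / 2" using near by blast
  obtain j where j: "u \<in> convex hull (z ` ({0..} \<inter> {..<j}))" using convex_hull_image_finite[OF u(1)] by blast
  obtain v where v: "v \<in> convex hull (z ` {j..})" "norm (v - x0) < e / 2" using near by blast
  have "norm (u - v) \<le> norm (u - x0) + norm (v - x0)"
    using norm_triangle_ineq4[of "u - x0" "v - x0"] by simp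
  then show thesis using that[of u j v] j u v by (simp add: atLeast_0 )
qed

section \<open>The Banach--Saks index\<close>

lemma cesaro_summable_if_tendsto:
  fixes y :: "nat \<Rightarrow> 'a::real_normed_vector"
  assumes "y \<longlonglongrightarrow> l"
  shows "cesaro_summable y"
proof -
  have "(\<lambda>n. (1 / real n) *\<^sub>R (\<Sum>k=1..n. y k)) \<longlonglongrightarrow> l"
  proof (rule LIMSEQ_I)
    fix e :: real assume e: "e > 0"
    then obtain N where N: "\<And>k. k \<ge> N \<Longrightarrow> norm (y k - l) < e / 2"
      using LIMSEQ_D[OF assms, of "e / 2"] by auto
    define C where "C = (\<Sum>k=1..N. norm (y k - l))"
    obtain n0 where n0: "2 * C / e < real n0" using reals_Archimedean2 by blast
    have "norm ((1 / real n) *\<^sub>R (\<Sum>k=1..n. y k) - l) < e" if n: "n \<ge> max 1 n0" for n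
    proof -
      have n_pos: "real n > 0" using n by simp
      have "(\<Sum>k=1..n. y k) - real n *\<^sub>R l = (\<Sum>k=1..n. y k - l)"
        by (simp add: sum_subtractf sum_constant_scaleR)
      moreover have "(1 / real n) *\<^sub>R (\<Sum>k=1..n. y k) - l = (1 / real n) *\<^sub>R ((\<Sum>k=1..n. y k) - real n *\<^sub>R l)"
        using n_pos by (simp add: scaleR_diff_right)
      ultimately have "norm ((1 / real n) *\<^sub>R (\<Sum>k=1..n. y k) - l) = norm (\<Sum>k=1..n. y k - l) / real n"
        by simp
      also have "norm (\<Sum>k=1..n. y k - l) \<le> (\<Sum>k=1..n. norm (y k - l))" by (rule norm_sum)
      also have "\<dots> \<le> (\<Sum>k=1..n. (if k \<le> N then norm (y k - l) else 0) + e / 2)"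
        using N e by (intro sum_mono) (auto simp: not_le less_imp_le)
      also have "\<dots> = (\<Sum>k\<in>{1..n} \<inter> {..N}. norm (y k - l)) + real n * (e / 2)"
        by (simp add: sum.distrib sum.If_cases atMost_def)
      also have "(\<Sum>k\<in>{1..n} \<inter> {..N}. norm (y k - l)) \<le> C"
        unfolding C_def by (rule sum_mono2) auto
      also have "C < real n * (e / 2)"
      proof -
        have "2 * C / e < real n" using n0 n by simp
        then show ?thesis using e by (simp add: field_simps)
      qed
      finally show ?thesis using n_pos by (simp add: divide_right_mono field_simps)
    qed
    then show "\<exists>no. \<forall>n\<ge>no. norm ((1 / real n) *\<^sub>R (\<Sum>k=1..n. y k) - l) < e" by blast
  qed
  then show ?thesis unfolding cesaro_summable_def convergent_def by blast
qed

lemma weighted_sum_eq: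
  assumes "finite (supp a)" "supp a \<subseteq> {1..}"
  shows "weighted_sum a x = (\<Sum>i\<in>supp a. a i *\<^sub>R x i)"
proof -
  have "weighted_sum a x = infsum (\<lambda>i. a i *\<^sub>R x i) (supp a)"
    unfolding weighted_sum_def using assms(2) by (intro infsum_cong_neutral) (auto simp: supp_def)
  then show ?thesis using assms(1) by simp
qed

lemma ra_summable_cong:
  assumes "\<And>i. i \<ge> 1 \<Longrightarrow> x i = y i"
  shows "ra_summable lad M \<zeta> x = ra_summable lad M \<zeta> y"
proof -
  have "weighted_sum a x = weighted_sum a y" for a
    unfolding weighted_sum_def by (rule infsum_cong) (simp add: assms)
  then show ?thesis unfolding ra_summable_def by simp
qed

definition dual_ball_images :: "(nat \<Rightarrow> 'a::real_normed_vector) \<Rightarrow> (nat \<Rightarrow> real) set"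
  where "dual_ball_images w = {\<lambda>i. blinfun_apply f (w i) | f :: 'a \<Rightarrow>\<^sub>L real. norm f \<le> 1}"

definition level_family :: "(nat \<Rightarrow> 'a::real_normed_vector) \<Rightarrow> real \<Rightarrow> nat set set"
  where "level_family w \<epsilon> = {F. finite F \<and> (\<exists>f :: 'a \<Rightarrow>\<^sub>L real. norm f \<le> 1 \<and> (\<forall>n\<in>F. \<epsilon> \<le> blinfun_apply f (w n)))}"

lemma hereditary_level_family: "hereditary (level_family w \<epsilon>)"
  unfolding hereditary_def level_family_def using finite_subset by blast

lemma dual_ball_images_le:
  assumes "g \<in> dual_ball_images w" "\<And>i. norm (w i) \<le> B"
  shows "g i \<le> B"
proof -
  obtain f :: "'a \<Rightarrow>\<^sub>L real" where f: "norm f \<le> 1" "g = (\<lambda>i. blinfun_apply f (w i))"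
    using assms(1) unfolding dual_ball_images_def by blast
  show ?thesis using blinfun_le_norm[OF f(1), of "w i"] assms(2)[of i] by (simp add: f(2))
qed

section \<open>Trees of lists with separated convex hulls\<close>

lemma convex_hull_ge:
  fixes f :: "'a::real_normed_vector \<Rightarrow>\<^sub>L real"
  assumes "u \<in> convex hull S" "\<And>x. x \<in> S \<Longrightarrow> c \<le> f x"
  shows "c \<le> f u"
proof -
  have "convex {x. c \<le> f x}"
  proof (rule convexI)
    fix x y and a b :: real
    assume "x \<in> {x. c \<le> f x}" "y \<in> {x. c \<le> f x}" and ab: "0 \<le> a" "0 \<le> b" "a + b = 1"
    then have "a * c + b * c \<le> a * f x + b * f y" by (intro add_mono mult_left_mono) auto
    moreover have "a * c + b * c = c" using ab by (simp flip: distrib_right)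
    ultimately show "a *\<^sub>R x + b *\<^sub>R y \<in> {x. c \<le> f x}"
      by (simp add: blinfun.add_right blinfun.scaleR_right)
  qed
  then have "convex hull S \<subseteq> {x. c \<le> f x}" using assms(2) by (intro hull_minimal) auto
  then show ?thesis using assms(1) by blast
qed

text \<open>The labels are indices of vectors, which keeps the tree countable. The norm bound makes
  every infinite branch a bounded sequence. Splits with an empty part impose nothing, as the hull is
  empty.\<close>

definition separated_lists :: "(nat \<Rightarrow> 'a::real_normed_vector) \<Rightarrow> real \<Rightarrow> real \<Rightarrow> nat list set"
  where "separated_lists d \<epsilon> B = {s. (\<forall>i\<in>set s. norm (d i) \<le> B) \<and>
    (\<forall>p q. s = p @ q \<longrightarrow> (\<forall>u \<in> convex hull (d ` set p). \<forall>v \<in> convex hull (d ` set q). \<epsilon> \<le> norm (u - v)))}"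

text \<open>A split of the subsequence extends to a split of the whole list, with larger
  hulls.\<close>

lemma separated_lists_subseq:
  assumes "s \<in> separated_lists d \<epsilon> B" "subseq s' s"
  shows "s' \<in> separated_lists d \<epsilon> B"
proof -
  have sub: "set a \<subseteq> set b" if "subseq a b" for a b :: "nat list"
    using that set_nths_subset[of b] unfolding subseq_conv_nths by blast
  have "\<epsilon> \<le> norm (u - v)" if s': "s' = p @ q" and uv: "u \<in> convex hull (d ` set p)" "v \<in> convex hull (d ` set q)"
    for p q u v
  proof -
    obtain p' q' where "s = p' @ q'" "subseq p p'" "subseq q q'"
      using assms(2) list_emb_appendD unfolding s' by blast
    moreover from this have "u \<in> convex hull (d ` set p')" "v \<in> convex hull (d ` set q')"
      using uv sub hull_mono[of "d ` set p" "d ` set p'"] hull_mono[of "d ` set q" "d ` set q'"]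
      by (meson image_mono in_mono)+
    ultimately show ?thesis using assms(1) unfolding separated_lists_def by blast
  qed
  then show ?thesis using assms sub[OF assms(2)] unfolding separated_lists_def by blast
qed

lemma wf_separated_lists:
  fixes d :: "nat \<Rightarrow> 'a::real_normed_vector"
  assumes refl: "reflexive_space TYPE('a)" and \<epsilon>: "\<epsilon> > 0"
  shows "wf {(t @ [i], t) | t i. t @ [i] \<in> separated_lists d \<epsilon> B}"
  unfolding wf_iff_no_infinite_down_chain
proof
  let ?T = "separated_lists d \<epsilon> B"
  assume "\<exists>g. \<forall>n. (g (Suc n), g n) \<in> {(t @ [i], t) | t i. t @ [i] \<in> ?T}"
  then obtain g where "\<forall>n. (g (Suc n), g n) \<in> {(t @ [i], t) | t i. t @ [i] \<in> ?T}" by blast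
  then have "\<exists>t i. g (Suc n) = t @ [i] \<and> g n = t \<and> t @ [i] \<in> ?T" for n by blast
  then have "\<exists>i. g (Suc n) = g n @ [i] \<and> g (Suc n) \<in> ?T" for n by metis
  then obtain l where l: "\<And>n. g (Suc n) = g n @ [l n]" "\<And>n. g (Suc n) \<in> ?T" by metis
  have "g n = g 0 @ map l [0..<n]" for n by (induction n) (simp_all add: l(1))
  \<comment> \<open>A descending chain may begin at a nonempty list \<open>g 0\<close>; closure
    under subsequences discards it.\<close>
  then have T: "map l [0..<n] \<in> ?T" for n
  proof -
    have "subseq (map l [0..<Suc n]) (g (Suc n))"
      using \<open>\<And>n. g n = g 0 @ map l [0..<n]\<close>[of "Suc n"] by (metis subseq_drop_many subseq_order.order_refl)
    then have "map l [0..<Suc n] \<in> ?T" using separated_lists_subseq l(2) by blast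
    then show ?thesis by (rule separated_lists_subseq) (simp add: subseq_rev_drop_many)
  qed
  define z where "z n = d (l n)" for n
  have "norm (z n) \<le> B" for n using T[of "Suc n"] by (simp add: separated_lists_def z_def)
  then obtain j u v where uv: "u \<in> convex hull (z ` {..<j})" "v \<in> convex hull (z ` {j..})" "norm (u - v) < \<epsilon>"
    using reflexive_not_separated[OF refl _ \<epsilon>] by metis
  obtain n0 where n0: "\<And>m. n0 \<le> m \<Longrightarrow> v \<in> convex hull (z ` ({j..} \<inter> {..<m}))"
    using convex_hull_image_finite[OF uv(2)] by blast
  define m where "m = max j n0"
  have "{j..} \<inter> {..<m} = {j..<m}" by auto
  then have v: "v \<in> convex hull (z ` {j..<m})" using n0[of m] by (simp add: m_def)
  have "map l [0..<m] = map l [0..<j] @ map l [j..<m]"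
    using upt_add_eq_append[of 0 j "m - j"] by (simp add: m_def flip: map_append)
  moreover have "d ` set (map l [0..<j]) = z ` {..<j}" "d ` set (map l [j..<m]) = z ` {j..<m}"
    by (auto simp: z_def image_image)
  moreover have "\<epsilon> \<le> norm (u - v)"
    if "map l [0..<m] = p @ q" "u \<in> convex hull (d ` set p)" "v \<in> convex hull (d ` set q)" for p q
    using T[of m] that unfolding separated_lists_def by blast
  ultimately have "\<epsilon> \<le> norm (u - v)" using uv(1) v by metis
  then show False using uv(3) by simp
qed

text \<open>On the hull of the first part the witness \<open>f\<close> forces norm at least
  \<epsilon>, and \<open>mazur_on\<close> turns this into distance from the later hull with a loss
  of at most \<open>\<epsilon> / 2\<close>. Subtracting \<open>x0\<close> from both vectors does not
  change their difference, so the conclusion depends on the labels alone.\<close>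

lemma level_family_separated:
  fixes d :: "nat \<Rightarrow> 'a::real_normed_vector"
  assumes bd: "\<And>i. norm (d (\<phi> i)) \<le> B"
    and mazur: "mazur_on M (\<lambda>i. d (\<phi> i) - x0)"
    and F: "F \<in> level_family (\<lambda>i. d (\<phi> i) - x0) \<epsilon>" "F \<subseteq> M" "\<And>i. i \<in> F \<Longrightarrow> 1 / (real i + 1) \<le> \<epsilon> / 2"
  shows "F \<in> label_family (separated_lists d (\<epsilon> / 2) B) [] \<phi>"
proof -
  let ?w = "\<lambda>i. d (\<phi> i) - x0"
  obtain f :: "'a \<Rightarrow>\<^sub>L real" where f: "norm f \<le> 1" "\<And>n. n \<in> F \<Longrightarrow> \<epsilon> \<le> f (?w n)" and fin: "finite F"
    using F(1) unfolding level_family_def by blast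
  have "\<epsilon> / 2 \<le> norm (u - v)"
    if pq: "map \<phi> (sorted_list_of_set F) = p @ q" and uv: "u \<in> convex hull (d ` set p)" "v \<in> convex hull (d ` set q)"
    for p q u v
  proof -
    obtain p' q' where pq': "sorted_list_of_set F = p' @ q'" "p = map \<phi> p'" "q = map \<phi> q'"
      using pq by (auto simp: map_eq_append_conv)
    have F_eq: "F = set p' \<union> set q'" using fin pq'(1) by (metis set_append set_sorted_list_of_set)
    have "p' \<noteq> []" using uv(1) pq'(2) by auto
    define c where "c = last p'"
    have c: "c \<in> set p'" using \<open>p' \<noteq> []\<close> by (simp add: c_def)
    have sorted: "sorted_wrt (<) (p' @ q')"
      using pq'(1) strict_sorted_list_of_set[of F] by simp
    have p'c: "i \<le> c" if "i \<in> set p'" for i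
      using sorted that \<open>p' \<noteq> []\<close> unfolding c_def
      by (cases p' rule: rev_cases) (auto simp: sorted_wrt_append less_imp_le)
    have q'c: "c < i" if "i \<in> set q'" for i
      using sorted that c by (auto simp: sorted_wrt_append)
    have trans: "convex hull (?w ` A) = (\<lambda>y. y - x0) ` (convex hull (d ` \<phi> ` A))" for A
      using convex_hull_translation[of "- x0" "d ` \<phi> ` A"] by (simp add: image_image)
    have u: "u - x0 \<in> convex hull (?w ` set p')" and v: "v - x0 \<in> convex hull (?w ` set q')"
      unfolding trans using uv pq' by auto
    have "norm (u - x0) - 1 / (real c + 1) \<le> norm ((u - x0) - (v - x0))"
    proof (rule mazur_onD[OF mazur])
      show "c \<in> M" using c F_eq F(2) by blast
      show "u - x0 \<in> convex hull (?w ` (M \<inter> {..c}))"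
        using u hull_mono[of "?w ` set p'" "?w ` (M \<inter> {..c})"] p'c F_eq F(2) by blast
      show "v - x0 \<in> convex hull (?w ` (M \<inter> {c<..}))"
        using v hull_mono[of "?w ` set q'" "?w ` (M \<inter> {c<..})"] q'c F_eq F(2) by blast
    qed
    moreover have "\<epsilon> \<le> f (u - x0)"
      using u by (rule convex_hull_ge) (use f(2) F_eq in auto)
    then have "\<epsilon> \<le> norm (u - x0)" using blinfun_le_norm[OF f(1), of "u - x0"] by linarith
    moreover have "1 / (real c + 1) \<le> \<epsilon> / 2" using F(3) c F_eq by blast
    ultimately show ?thesis by simp
  qed
  then show ?thesis using fin bd unfolding label_family_def separated_lists_def by auto
qed

context ladder
begin

section \<open>Existence of an order from which the property holds\<close>

lemma pairing_le_affine:
  assumes L: "L \<in> inf_subsets {1..}" and "\<And>i. i \<in> supp (fst_avg \<zeta> L) \<Longrightarrow> g i \<le> c + b * g' i"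
  shows "pairing (fst_avg \<zeta> L) g \<le> c + b * pairing (fst_avg \<zeta> L) g'"
proof -
  let ?a = "fst_avg \<zeta> L"
  have "pairing ?a g \<le> (\<Sum>i\<in>supp ?a. ?a i * (c + b * g' i))"
    unfolding pairing_def using assms by (intro sum_mono mult_left_mono) auto
  also have "\<dots> = sum ?a (supp ?a) * c + b * pairing ?a g'"
    by (simp add: pairing_def distrib_left sum.distrib sum_distrib_right sum_distrib_left mult.left_commute)
  finally show ?thesis using sum_fst_avg[OF L] by simp
qed

lemma unif_null_indicators_Int:
  assumes M: "M \<in> inf_subsets {1..}" and null: "unif_null \<zeta> M (indicators \<G>)"
    and "\<And>F. F \<in> \<F> \<Longrightarrow> F \<inter> M \<in> \<G>"
  shows "unif_null \<zeta> M (indicators \<F>)"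
  unfolding unif_null_def
proof (intro allI impI)
  fix e :: real assume "e > 0"
  then obtain h where h: "\<And>L g. L \<in> inf_subsets M \<Longrightarrow> h \<le> Inf L \<Longrightarrow> g \<in> indicators \<G> \<Longrightarrow> pairing (fst_avg \<zeta> L) g \<le> e"
    using unif_nullE[OF null] by blast
  have "pairing (fst_avg \<zeta> L) g \<le> e"
    if L: "L \<in> inf_subsets M" "h \<le> Inf L" and g: "g \<in> indicators \<F>" for L g
  proof -
    obtain F where F: "F \<in> \<F>" "g = indicator F" using g unfolding indicators_def by blast
    have "supp (fst_avg \<zeta> L) \<subseteq> M"
      using supp_fst_avg_subset[OF inf_subsets_trans[OF L(1) M]] inf_subsets_subset[OF L(1)] by blast
    then have "pairing (fst_avg \<zeta> L) g = pairing (fst_avg \<zeta> L) (indicator (F \<inter> M))"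
      by (intro pairing_cong) (auto simp: F indicator_def)
    then show ?thesis using h[OF L] assms(3)[OF F(1)] by (simp add: indicators_def)
  qed
  then show "\<exists>h. \<forall>L \<in> inf_subsets M. h \<le> Inf L \<longrightarrow> (\<forall>g\<in>indicators \<F>. pairing (fst_avg \<zeta> L) g \<le> e)"
    by blast
qed

text \<open>Values below \<open>1 / real (Suc k)\<close> contribute at most \<open>e / 2\<close>;
  the remaining ones are at most \<open>B\<close> and sit on a member of the level family.\<close>

lemma unif_null_dual_ball_images:
  fixes w :: "nat \<Rightarrow> 'a::real_normed_vector"
  assumes M: "M \<in> inf_subsets {1..}" and B: "\<And>i. norm (w i) \<le> B"
    and null: "\<And>k. unif_null \<zeta> M (indicators (level_family w (1 / real (Suc k))))"
  shows "unif_null \<zeta> M (dual_ball_images w)"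
  unfolding unif_null_def
proof (intro allI impI)
  fix e :: real assume e: "e > 0"
  have B0: "B \<ge> 0" using B[of 0] norm_ge_zero order_trans by blast
  obtain k where k: "1 / real (Suc k) < e / 2" using nat_approx_posE[of "e / 2"] e by auto
  \<comment> \<open>The denominator has \<open>B + 1\<close> in place of \<open>B\<close> to allow
    \<open>B = 0\<close>.\<close>
  have "e / (2 * (B + 1)) > 0" using e B0 by simp
  then obtain h where h: "\<And>L g. L \<in> inf_subsets M \<Longrightarrow> h \<le> Inf L \<Longrightarrow>
    g \<in> indicators (level_family w (1 / real (Suc k))) \<Longrightarrow> pairing (fst_avg \<zeta> L) g \<le> e / (2 * (B + 1))"
    using unif_nullE[OF null] by blast
  have "pairing (fst_avg \<zeta> L) g \<le> e"
    if L: "L \<in> inf_subsets M" "h \<le> Inf L" and g: "g \<in> dual_ball_images w" for L g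
  proof -
    have L1: "L \<in> inf_subsets {1..}" using L(1) M inf_subsets_trans by blast
    obtain f :: "'a \<Rightarrow>\<^sub>L real" where f: "norm f \<le> 1" "g = (\<lambda>i. blinfun_apply f (w i))"
      using g unfolding dual_ball_images_def by blast
    define F where "F = {i \<in> supp (fst_avg \<zeta> L). 1 / real (Suc k) \<le> g i}"
    have "F \<in> level_family w (1 / real (Suc k))"
      unfolding level_family_def F_def f(2) using f(1) finite_supp_fst_avg[OF L1] by auto
    then have p: "pairing (fst_avg \<zeta> L) (indicator F) \<le> e / (2 * (B + 1))"
      using h[OF L] by (simp add: indicators_def)
    have "pairing (fst_avg \<zeta> L) g \<le> e / 2 + B * pairing (fst_avg \<zeta> L) (indicator F)"
    proof (rule pairing_le_affine[OF L1])
      fix i assume i: "i \<in> supp (fst_avg \<zeta> L)"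
      show "g i \<le> e / 2 + B * indicator F i"
      proof (cases "i \<in> F")
        case True
        then show ?thesis using dual_ball_images_le[OF g B, of i] e by simp
      next
        case False
        then show ?thesis using i k by (simp add: F_def)
      qed
    qed
    also have "\<dots> \<le> e / 2 + B * (e / (2 * (B + 1)))" using p B0 by (intro add_left_mono mult_left_mono)
    also have "\<dots> \<le> e" using e B0 by (simp add: divide_simps) (simp add: algebra_simps)
    finally show ?thesis .
  qed
  then show "\<exists>h. \<forall>L \<in> inf_subsets M. h \<le> Inf L \<longrightarrow> (\<forall>g\<in>dual_ball_images w. pairing (fst_avg \<zeta> L) g \<le> e)"
    by blast
qed

lemma unif_null_dual_ball_images_dense:
  fixes w :: "nat \<Rightarrow> 'a::real_normed_vector"
  assumes M: "M \<in> inf_subsets {1..}" and B: "\<And>i. norm (w i) \<le> B"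
    and dense: "\<And>k M1. M1 \<in> inf_subsets M \<Longrightarrow>
      \<exists>M2 \<in> inf_subsets M1. unif_null \<zeta> M2 (indicators (level_family w (1 / real (Suc k))))"
  shows "\<exists>M' \<in> inf_subsets M. unif_null \<zeta> M' (dual_ball_images w)"
proof -
  let ?P = "\<lambda>k M'. unif_null \<zeta> M' (indicators (level_family w (1 / real (Suc k))))"
  obtain M' where M': "M' \<in> inf_subsets M" "\<And>k. ?P k M'"
  proof (rule pseudo_intersection[of M ?P])
    show "infinite M" using M by (rule inf_subsets_infinite)
    show "?P k M2" if "?P k M1" "finite (M2 - M1)" for k M1 M2 using that unif_null_mono by blast
  qed (use dense in auto)
  then show ?thesis using unif_null_dual_ball_images[OF inf_subsets_trans[OF M'(1) M] B M'(2)] by blast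
qed

lemma sum_fst_avg_diff:
  assumes L: "L \<in> inf_subsets {1..}"
  shows "weighted_sum (fst_avg \<zeta> L) x - x0 = (\<Sum>i\<in>supp (fst_avg \<zeta> L). fst_avg \<zeta> L i *\<^sub>R (x i - x0))"
proof -
  have "supp (fst_avg \<zeta> L) \<subseteq> {1..}" using supp_fst_avg_subset[OF L] inf_subsets_subset[OF L] by blast
  then show ?thesis
    using sum_fst_avg[OF L] finite_supp_fst_avg[OF L]
    by (simp add: weighted_sum_eq scaleR_diff_right sum_subtractf flip: scaleR_sum_left)
qed

lemma blinfun_sum_fst_avg:
  "blinfun_apply f (\<Sum>i\<in>supp (fst_avg \<zeta> L). fst_avg \<zeta> L i *\<^sub>R w i) = pairing (fst_avg \<zeta> L) (\<lambda>i. blinfun_apply f (w i))"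
  by (simp add: blinfun.sum_right blinfun.scaleR_right pairing_def)

text \<open>More than Cesaro convergence holds: the averages themselves tend to \<open>x0\<close> in
  norm. After \<open>n\<close> supports are removed the minimum is at least \<open>n\<close>, and a
  norming functional turns the distance from \<open>x0\<close> into a pairing.\<close>

lemma ra_summable_if_unif_null:
  fixes x :: "nat \<Rightarrow> 'a::real_normed_vector"
  assumes M: "M \<in> inf_subsets {1..}" and null: "unif_null \<zeta> M (dual_ball_images (\<lambda>i. x i - x0))"
  shows "ra_summable lad M \<zeta> x"
  unfolding ra_summable_def
proof (rule cesaro_summable_if_tendsto[where l = x0])
  have "(\<lambda>n. weighted_sum (ra lad \<zeta> M (Suc n)) x) \<longlonglongrightarrow> x0"
  proof (rule LIMSEQ_I)
    fix e :: real assume "e > 0"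
    then have "e / 2 > 0" by simp
    then obtain h where h: "\<And>L g. L \<in> inf_subsets M \<Longrightarrow> h \<le> Inf L \<Longrightarrow>
      g \<in> dual_ball_images (\<lambda>i. x i - x0) \<Longrightarrow> pairing (fst_avg \<zeta> L) g \<le> e / 2"
      using unif_nullE[OF null] by blast
    have "norm (weighted_sum (ra lad \<zeta> M (Suc n)) x - x0) < e" if "n \<ge> h" for n
    proof -
      let ?L = "rest \<zeta> M n"
      have L1: "?L \<in> inf_subsets {1..}" using rest_in_inf_subsets'[OF M] .
      define v where "v = weighted_sum (fst_avg \<zeta> ?L) x - x0"
      obtain f :: "'a \<Rightarrow>\<^sub>L real" where f: "norm f \<le> 1" "norm v \<le> f v" using norming_functional by blast
      have "f v = pairing (fst_avg \<zeta> ?L) (\<lambda>i. f (x i - x0))"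
        unfolding v_def sum_fst_avg_diff[OF L1] blinfun_sum_fst_avg ..
      also have "\<dots> \<le> e / 2"
      proof (rule h)
        show "?L \<in> inf_subsets M" using rest_in_inf_subsets[OF M] .
        show "h \<le> Inf ?L" using Inf_rest_ge[OF M, of n \<zeta>] that by linarith
        show "(\<lambda>i. f (x i - x0)) \<in> dual_ball_images (\<lambda>i. x i - x0)"
          unfolding dual_ball_images_def using f(1) by blast
      qed
      finally show ?thesis using f(2) \<open>e > 0\<close> by (simp add: ra_eq_fst_avg[OF M] v_def)
    qed
    then show "\<exists>no. \<forall>n\<ge>no. norm (weighted_sum (ra lad \<zeta> M (Suc n)) x - x0) < e" by blast
  qed
  then show "(\<lambda>n. weighted_sum (ra lad \<zeta> M n) x) \<longlonglongrightarrow> x0" by (rule LIMSEQ_imp_Suc)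
qed

theorem banach_saks_eventually:
  assumes sep: "separable_space (euclidean :: 'a::real_normed_vector topology)"
    and refl: "reflexive_space TYPE('a)"
  shows "\<exists>\<xi>. \<forall>\<zeta>\<ge>\<xi>. banach_saks lad \<zeta> TYPE('a)"
proof -
  obtain D :: "'a set" where D: "countable D" "closure D = UNIV"
    using sep by (auto simp: separable_space_def)
  then have "D \<noteq> {}" by auto
  define d where "d = from_nat_into D"
  have dense: "\<exists>n. norm (d n - x) < e" if e: "e > 0" for x e
  proof -
    have "x \<in> closure D" using D by simp
    then obtain y where "y \<in> D" "dist y x < e" using e unfolding closure_approachable by blast
    then show ?thesis unfolding d_def using from_nat_into_surj[OF D(1)] by (metis dist_norm)
  qed
  \<comment> \<open>One tree for each tolerance and each norm bound, hence countably many orders to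
    dominate. Half of the tolerance is reserved for the error in \<open>mazur_on\<close>.\<close>
  define T where "T k B = separated_lists d (1 / real (Suc k) / 2) (real B)" for k B :: nat
  have "\<exists>\<xi>. \<forall>\<phi>. \<forall>M \<in> inf_subsets {1..}. \<exists>M' \<in> inf_subsets M.
    unif_null \<xi> M' (indicators (label_family (T k B) [] \<phi>))" for k B
    unfolding T_def using wf_separated_lists[OF refl] separated_lists_subseq
    by (intro unif_null_label_family) auto
  then obtain \<Xi> where \<Xi>: "\<And>k B \<phi> M. M \<in> inf_subsets {1..} \<Longrightarrow> \<exists>M' \<in> inf_subsets M.
    unif_null (\<Xi> k B) M' (indicators (label_family (T k B) [] \<phi>))" by metis
  obtain \<xi> where \<xi>: "\<And>k B. \<Xi> k B < \<xi>"
    using bounded_countable_ordinal[of "range (case_prod \<Xi>)"] by auto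
  show ?thesis
    unfolding banach_saks_def
  proof (intro exI[of _ \<xi>] allI impI)
    fix \<zeta> and x :: "nat \<Rightarrow> 'a" assume \<zeta>: "\<xi> \<le> \<zeta>" and bd: "bounded (x ` {1..})"
    obtain Bx where Bx: "\<And>i. i \<ge> 1 \<Longrightarrow> norm (x i) \<le> Bx"
      using bd unfolding bounded_iff by auto
    \<comment> \<open>Index 0 is redirected to 1, because nothing is known about
      \<open>x 0\<close>.\<close>
    have "\<exists>m. norm (d m - x (max 1 i)) < 1 / real (Suc i)" for i by (rule dense) simp
    then obtain \<phi> where \<phi>: "\<And>i. norm (d (\<phi> i) - x (max 1 i)) < 1 / real (Suc i)" by metis
    obtain B :: nat where B: "Bx + 1 \<le> real B" using real_arch_simple by blast
    have bdB: "norm (d (\<phi> i)) \<le> real B" for i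
    proof -
      have "norm (d (\<phi> i)) \<le> norm (d (\<phi> i) - x (max 1 i)) + norm (x (max 1 i))"
        using norm_triangle_sub[of "d (\<phi> i)" "x (max 1 i)"] by simp
      moreover have "1 / real (Suc i) \<le> 1" by simp
      moreover have "norm (x (max 1 i)) \<le> Bx" by (rule Bx) simp
      ultimately show ?thesis using \<phi>[of i] B by linarith
    qed
    obtain x0 M where M: "M \<in> inf_subsets {1..}" and mazur:
      "mazur_on M (\<lambda>i. d (\<phi> i) - x0)"
      using mazur_sequence[of "\<lambda>i. d (\<phi> i)" "real B", OF refl bdB] by blast
    define w where "w i = d (\<phi> i) - x0" for i
    have Bw: "norm (w i) \<le> real B + norm x0" for i
      unfolding w_def using norm_triangle_ineq4[of "d (\<phi> i)" x0] bdB[of i] by linarith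
    have "\<exists>M' \<in> inf_subsets M. unif_null \<zeta> M' (dual_ball_images w)"
    proof (rule unif_null_dual_ball_images_dense[OF M Bw])
      fix k M1 assume M1: "M1 \<in> inf_subsets M"
      \<comment> \<open>From this index on, \<open>1 / (real i + 1)\<close> is at most half of the
        tolerance \<open>1 / real (Suc k)\<close>.\<close>
      define N where "N = 2 * Suc k"
      have "infinite (M1 - {..<N})" using inf_subsets_infinite[OF M1] by simp
      then have M1': "M1 - {..<N} \<in> inf_subsets M1" by (intro inf_subsetsI) auto
      then obtain M2 where M2: "M2 \<in> inf_subsets (M1 - {..<N})"
        "unif_null (\<Xi> k B) M2 (indicators (label_family (T k B) [] \<phi>))"
        using \<Xi> inf_subsets_trans M1 M by meson
      have M2M1: "M2 \<in> inf_subsets M1" using M2(1) M1' inf_subsets_trans by blast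
      then have M2M: "M2 \<in> inf_subsets M" using M1 inf_subsets_trans by blast
      then have M21: "M2 \<in> inf_subsets {1..}" using M inf_subsets_trans by blast
      have "unif_null (\<Xi> k B) M2 (indicators (level_family w (1 / real (Suc k))))"
      proof (rule unif_null_indicators_Int[OF M21 M2(2)])
        fix F assume "F \<in> level_family w (1 / real (Suc k))"
        then have F: "F \<inter> M2 \<in> level_family (\<lambda>i. d (\<phi> i) - x0) (1 / real (Suc k))"
          using hereditaryD[OF hereditary_level_family] unfolding w_def by blast
        show "F \<inter> M2 \<in> label_family (T k B) [] \<phi>"
          unfolding T_def
        proof (rule level_family_separated[where d = d and \<phi> = \<phi>, OF bdB mazur F])
          show "F \<inter> M2 \<subseteq> M" using inf_subsets_subset[OF M2M] by blast
          fix i assume "i \<in> F \<inter> M2"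
          then have "N \<le> i" using inf_subsets_subset[OF M2(1)] by auto
          then have "2 * real (Suc k) \<le> real i + 1" unfolding N_def by linarith
          then have "1 / (real i + 1) \<le> 1 / (2 * real (Suc k))" by (intro divide_left_mono) auto
          then show "1 / (real i + 1) \<le> 1 / real (Suc k) / 2" by (simp add: mult.commute)
        qed
      qed
      moreover have "\<Xi> k B \<le> \<zeta>" using \<xi>[of k B] \<zeta> by simp
      ultimately have "\<exists>M3 \<in> inf_subsets M2. unif_null \<zeta> M3 (indicators (level_family w (1 / real (Suc k))))"
        using unif_null_increasing[OF _ M21, where C = 1] indicators_le_1 by blast
      then show "\<exists>M2 \<in> inf_subsets M1. unif_null \<zeta> M2 (indicators (level_family w (1 / real (Suc k))))"
        using M2M1 inf_subsets_trans by blast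
    qed
    then obtain M' where M': "M' \<in> inf_subsets M" "unif_null \<zeta> M' (dual_ball_images w)" by blast
    have M'1: "M' \<in> inf_subsets {1..}" using M'(1) M inf_subsets_trans by blast
    \<comment> \<open>Back from the labels to \<open>x\<close>: at index \<open>i\<close> the two
      differ by less than \<open>1 / real (Suc i)\<close>, uniformly over the dual ball, which is
      negligible once the minimum of \<open>L\<close> is large.\<close>
    have "unif_null \<zeta> M' (dual_ball_images (\<lambda>i. x i - x0))"
      unfolding unif_null_def
    proof (intro allI impI)
      fix e :: real assume e: "e > 0"
      then have "e / 2 > 0" by simp
      then obtain h where h: "\<And>L g. L \<in> inf_subsets M' \<Longrightarrow> h \<le> Inf L \<Longrightarrow>
        g \<in> dual_ball_images w \<Longrightarrow> pairing (fst_avg \<zeta> L) g \<le> e / 2" using unif_nullE[OF M'(2)] by blast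
      obtain m where m: "1 / real (Suc m) < e / 2" using nat_approx_posE[of "e / 2"] e by auto
      have "pairing (fst_avg \<zeta> L) g \<le> e"
        if L: "L \<in> inf_subsets M'" "max h m \<le> Inf L" and g: "g \<in> dual_ball_images (\<lambda>i. x i - x0)" for L g
      proof -
        have L1: "L \<in> inf_subsets {1..}" using L(1) M'1 inf_subsets_trans by blast
        obtain f :: "'a \<Rightarrow>\<^sub>L real" where f: "norm f \<le> 1" "g = (\<lambda>i. f (x i - x0))"
          using g unfolding dual_ball_images_def by blast
        have "pairing (fst_avg \<zeta> L) g \<le> e / 2 + 1 * pairing (fst_avg \<zeta> L) (\<lambda>i. f (w i))"
        proof (rule pairing_le_affine[OF L1])
          fix i assume "i \<in> supp (fst_avg \<zeta> L)"
          then have "i \<in> L" using supp_fst_avg_subset[OF L1] by blast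
          then have i: "i \<ge> 1" "m \<le> i" using inf_subsets_subset[OF L1] Inf_nat_le[of i L] L(2) by auto
          have "f (x i - x0) - f (w i) = f (x i - d (\<phi> i))" by (simp add: w_def blinfun.diff_right)
          also have "\<dots> \<le> norm (d (\<phi> i) - x i)"
            using blinfun_le_norm[OF f(1), of "x i - d (\<phi> i)"] by (simp add: norm_minus_commute)
          also have "\<dots> \<le> 1 / real (Suc i)" using \<phi>[of i] i by (simp add: max_absorb2)
          also have "\<dots> \<le> 1 / real (Suc m)" using i by (intro divide_left_mono) auto
          finally show "g i \<le> e / 2 + 1 * f (w i)" using m by (simp add: f(2))
        qed
        moreover have "(\<lambda>i. f (w i)) \<in> dual_ball_images w" using f(1) unfolding dual_ball_images_def by blast
        then have "pairing (fst_avg \<zeta> L) (\<lambda>i. f (w i)) \<le> e / 2" using h L by auto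
        ultimately show ?thesis by linarith
      qed
      then show "\<exists>h. \<forall>L \<in> inf_subsets M'. h \<le> Inf L \<longrightarrow>
        (\<forall>g\<in>dual_ball_images (\<lambda>i. x i - x0). pairing (fst_avg \<zeta> L) g \<le> e)" by blast
    qed
    then show "\<exists>L \<in> inf_subsets {1..}. ra_summable lad L \<zeta> x"
      using ra_summable_if_unif_null[OF M'1] M'1 by blast
  qed
qed

section \<open>Monotonicity of the property in the order\<close>

lemma rest_add: "rest \<xi> (rest \<xi> L k) j = rest \<xi> L (k + j)"
  by (induction j) simp_all

text \<open>
  With \<open>C n\<close> the Cesaro means of the averages (minus \<open>x0\<close>) and \<open>l\<close> their limit, the means \<open>D k\<close> over
  \<open>{k..<2 * k}\<close> converge to \<open>l\<close> as well. The property \<open>mazur_on\<close> for \<open>C n\<close> and \<open>D k\<close>, with \<open>k\<close> far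
  beyond \<open>n\<close>, forces \<open>l = 0\<close>; but \<open>D k\<close> lives on the support of a single average of order \<open>\<xi> + 1\<close>, so
  \<open>norm (D k) \<ge> \<epsilon>\<close>.
\<close>

lemma not_ra_summable_if_spreads_into:
  fixes x :: "nat \<Rightarrow> 'a::real_normed_vector"
  assumes mazur: "mazur_on M (\<lambda>i. x i - x0)"
    and \<epsilon>: "\<epsilon> > 0"
    and \<phi>: "strict_mono \<phi>" "\<And>i. \<phi> i \<in> M"
    and into: "\<And>L. L \<in> inf_subsets {1..} \<Longrightarrow>
      \<phi> ` supp (fst_avg (ord_succ \<xi>) L) \<in> level_family (\<lambda>i. x i - x0) \<epsilon>"
    and L: "L \<in> inf_subsets {1..}"
  shows "\<not> ra_summable lad L \<xi> (\<lambda>i. x (\<phi> i))"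
proof
  assume "ra_summable lad L \<xi> (\<lambda>i. x (\<phi> i))"
  then obtain l' where l': "(\<lambda>n. (1 / real n) *\<^sub>R (\<Sum>k=1..n. weighted_sum (ra lad \<xi> L k) (\<lambda>i. x (\<phi> i)))) \<longlonglongrightarrow> l'"
    unfolding ra_summable_def cesaro_summable_def convergent_def by blast
  define w where "w i = x (\<phi> i) - x0" for i
  let ?a = "\<lambda>j. fst_avg \<xi> (rest \<xi> L j)"
  note R1 = rest_in_inf_subsets'[OF L, of \<xi>]
  define v where "v j = (\<Sum>i\<in>supp (?a j). ?a j i *\<^sub>R w i)" for j
  have v: "weighted_sum (ra lad \<xi> L (Suc j)) (\<lambda>i. x (\<phi> i)) = v j + x0" for j
    using sum_fst_avg_diff[OF R1[of j], of \<xi> "\<lambda>i. x (\<phi> i)" x0]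
    by (simp add: ra_eq_fst_avg[OF L] v_def w_def algebra_simps)
  have v_hull: "v j \<in> convex hull (w ` supp (?a j))" for j
    unfolding v_def using sum_fst_avg[OF R1] fst_avg_nonneg[OF R1] finite_supp_fst_avg[OF R1]
    by (intro convex_sum convex_convex_hull) (auto intro: hull_inc)
  define C where "C n = (1 / real n) *\<^sub>R (\<Sum>j<n. v j)" for n
  define D where "D k = (1 / real k) *\<^sub>R (\<Sum>j\<in>{k..<2 * k}. v j)" for k
  define l where "l = l' - x0"
  have "C \<longlonglongrightarrow> l"
  proof (rule Lim_transform_eventually)
    show "(\<lambda>n. (1 / real n) *\<^sub>R (\<Sum>k=1..n. weighted_sum (ra lad \<xi> L k) (\<lambda>i. x (\<phi> i))) - x0) \<longlonglongrightarrow> l"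
      unfolding l_def by (intro tendsto_diff l' tendsto_const)
    show "\<forall>\<^sub>F n in sequentially. (1 / real n) *\<^sub>R (\<Sum>k=1..n. weighted_sum (ra lad \<xi> L k) (\<lambda>i. x (\<phi> i))) - x0 = C n"
      using eventually_gt_at_top[of 0]
    proof eventually_elim
      case (elim n)
      have "(\<Sum>k=1..n. weighted_sum (ra lad \<xi> L k) (\<lambda>i. x (\<phi> i))) = (\<Sum>j<n. v j + x0)"
        by (simp add: sum.atLeast1_atMost_eq v)
      also have "\<dots> = (\<Sum>j<n. v j) + real n *\<^sub>R x0" by (simp add: sum.distrib sum_constant_scaleR)
      finally show ?case using elim by (simp add: C_def scaleR_add_right)
    qed
  qed
  have D: "D k = 2 *\<^sub>R C (2 * k) - C k" if "k > 0" for k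
  proof -
    have "(\<Sum>j<2 * k. v j) = (\<Sum>j<k. v j) + (\<Sum>j\<in>{k..<2 * k}. v j)"
      using sum.atLeastLessThan_concat[of 0 k "2 * k" v] by (simp add: atLeast0LessThan)
    then show ?thesis using that by (simp add: C_def D_def scaleR_add_right)
  qed
  have "(\<lambda>k. C (2 * k)) \<longlonglongrightarrow> l"
    using LIMSEQ_subseq_LIMSEQ[OF \<open>C \<longlonglongrightarrow> l\<close>, of "\<lambda>k. 2 * k"] by (simp add: strict_mono_def o_def)
  then have "(\<lambda>k. 2 *\<^sub>R C (2 * k) - C k) \<longlonglongrightarrow> 2 *\<^sub>R l - l"
    using \<open>C \<longlonglongrightarrow> l\<close> by (intro tendsto_intros)
  then have "D \<longlonglongrightarrow> 2 *\<^sub>R l - l"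
  proof (rule Lim_transform_eventually[of "\<lambda>k. 2 *\<^sub>R C (2 * k) - C k"])
    show "\<forall>\<^sub>F k in sequentially. 2 *\<^sub>R C (2 * k) - C k = D k"
      using eventually_gt_at_top[of 0] by eventually_elim (simp add: D)
  qed
  then have D_lim: "D \<longlonglongrightarrow> l" by (simp add: scaleR_2)
  have "norm (C n) - 1 / real n \<le> norm (C n - l)" if n: "n > 0" for n
  proof -
    let ?U = "\<Union>j<n. supp (?a j)"
    have U: "finite ?U" using R1 by simp
    have inU: "Inf (rest \<xi> L (n - 1)) \<in> ?U" using n Inf_in_supp_fst_avg[OF R1] by (intro UN_I[of "n - 1"]) auto
    \<comment> \<open>The last point used by the first \<open>n\<close> averages. It separates their
      supports from those in \<open>D k\<close> for \<open>k \<ge> n\<close>, and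
      \<open>n \<le> c \<le> \<phi> c\<close> brings the error of \<open>mazur_on\<close> at
      \<open>\<phi> c\<close> below \<open>1 / real n\<close>.\<close>
    define c where "c = Max ?U"
    have cU: "c \<in> ?U" unfolding c_def using U inU by (intro Max_in) auto
    have "n \<le> Inf L + (n - 1)" using Inf_ge_1[OF L] by linarith
    also have "\<dots> \<le> Inf (rest \<xi> L (n - 1))" using Inf_rest_ge[OF L] .
    also have "\<dots> \<le> c" unfolding c_def using U inU by (rule Max_ge)
    finally have "n \<le> c" .
    have C_hull: "C n \<in> convex hull ((\<lambda>i. x i - x0) ` (M \<inter> {..\<phi> c}))"
      unfolding C_def scaleR_sum_right
    proof (intro convex_sum convex_convex_hull)
      fix j assume j: "j \<in> {..<n}"
      have "w ` supp (?a j) \<subseteq> (\<lambda>i. x i - x0) ` (M \<inter> {..\<phi> c})"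
      proof
        fix y assume "y \<in> w ` supp (?a j)"
        then obtain i where i: "i \<in> supp (?a j)" "y = x (\<phi> i) - x0" by (auto simp: w_def)
        have "i \<le> c" unfolding c_def using U i(1) j by (intro Max_ge) auto
        then have "\<phi> i \<le> \<phi> c" using \<phi>(1) by (simp add: strict_mono_less_eq)
        then show "y \<in> (\<lambda>i. x i - x0) ` (M \<inter> {..\<phi> c})" using i(2) \<phi>(2) by blast
      qed
      then show "v j \<in> convex hull ((\<lambda>i. x i - x0) ` (M \<inter> {..\<phi> c}))"
        using v_hull hull_mono by blast
    qed (use n in auto)
    have "norm (C n) - 1 / real n \<le> norm (C n - D k)" if k: "k \<ge> n" for k
    proof -
      have D_hull: "D k \<in> convex hull ((\<lambda>i. x i - x0) ` (M \<inter> {\<phi> c<..}))"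
        unfolding D_def scaleR_sum_right
      proof (intro convex_sum convex_convex_hull)
        fix j assume j: "j \<in> {k..<2 * k}"
        have "w ` supp (?a j) \<subseteq> (\<lambda>i. x i - x0) ` (M \<inter> {\<phi> c<..})"
        proof
          fix y assume "y \<in> w ` supp (?a j)"
          then obtain i where i: "i \<in> supp (?a j)" "y = x (\<phi> i) - x0" by (auto simp: w_def)
          obtain j' where j': "j' < n" "c \<in> supp (?a j')" using cU by blast
          have "i \<in> rest \<xi> L j" using i(1) supp_fst_avg_subset[OF R1] by blast
          moreover have "j' < j" using j'(1) k j by simp
          ultimately have "c < i" using supp_fst_avg_less_rest[OF L _ j'(2)] by blast
          then have "\<phi> c < \<phi> i" using \<phi>(1) by (simp add: strict_mono_less)
          then show "y \<in> (\<lambda>i. x i - x0) ` (M \<inter> {\<phi> c<..})" using i(2) \<phi>(2) by blast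
        qed
        then show "v j \<in> convex hull ((\<lambda>i. x i - x0) ` (M \<inter> {\<phi> c<..}))"
          using v_hull hull_mono by blast
      qed (use n k in auto)
      have "n \<le> \<phi> c" using \<open>n \<le> c\<close> strict_mono_imp_increasing[OF \<phi>(1), of c] by linarith
      then have "1 / (real (\<phi> c) + 1) \<le> 1 / real n" using n by (intro divide_left_mono) auto
      then show ?thesis using mazur_onD[OF mazur \<phi>(2) C_hull D_hull] by linarith
    qed
    then show ?thesis
      by (intro Lim_bounded2[OF tendsto_norm[OF tendsto_diff[OF tendsto_const D_lim]], of n]) auto
  qed
  moreover have "(\<lambda>n. norm (C n) - 1 / real n) \<longlonglongrightarrow> norm l - 0"
    using \<open>C \<longlonglongrightarrow> l\<close> by (intro tendsto_intros lim_1_over_n)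
  moreover have "(\<lambda>n. norm (C n - l)) \<longlonglongrightarrow> norm (l - l)"
    using \<open>C \<longlonglongrightarrow> l\<close> by (intro tendsto_intros)
  ultimately have "norm l - 0 \<le> norm (l - l)"
    by (intro LIMSEQ_le[of _ "norm l - 0" _ "norm (l - l)"]) (auto intro!: exI[of _ 1])
  then have "l = 0" by simp
  have "\<epsilon> \<le> norm (D k)" if k: "k > 0" for k
  proof -
    let ?L = "rest \<xi> L k"
    obtain f :: "'a \<Rightarrow>\<^sub>L real" where f: "norm f \<le> 1"
      "\<And>i. i \<in> supp (fst_avg (ord_succ \<xi>) ?L) \<Longrightarrow> \<epsilon> \<le> f (w i)"
      using into[OF R1[of k]] unfolding level_family_def w_def by blast
    have "\<epsilon> \<le> f (D k)"
    proof (rule convex_hull_ge)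
      show "D k \<in> convex hull (\<Union>j\<in>{k..<2 * k}. w ` supp (?a j))"
        unfolding D_def scaleR_sum_right
      proof (intro convex_sum convex_convex_hull)
        fix j assume "j \<in> {k..<2 * k}"
        then show "v j \<in> convex hull (\<Union>j\<in>{k..<2 * k}. w ` supp (?a j))"
          using v_hull[of j] hull_mono[of "w ` supp (?a j)" "\<Union>j\<in>{k..<2 * k}. w ` supp (?a j)"] by blast
      qed (use k in auto)
      fix y assume "y \<in> (\<Union>j\<in>{k..<2 * k}. w ` supp (?a j))"
      then obtain j i where j: "k \<le> j" "j < 2 * k" and i: "i \<in> supp (?a j)" "y = w i" by auto
      \<comment> \<open>\<open>Inf ?L\<close> exceeds \<open>k\<close>, so the \<open>k\<close>
        averages in \<open>D k\<close> are among the first \<open>Inf ?L\<close> averages along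
        \<open>?L\<close>; these make up the first average of order \<xi> + 1 along
        \<open>?L\<close>.\<close>
      have "j - k < Inf ?L" using Inf_rest_ge[OF L, of k \<xi>] j Inf_ge_1[OF L] by linarith
      moreover have "rest \<xi> ?L (j - k) = rest \<xi> L j" using j by (simp add: rest_add)
      ultimately have "i \<in> supp (fst_avg (ord_succ \<xi>) ?L)"
        unfolding supp_fst_avg_succ[OF regular R1[of k]] using i(1) by (intro UN_I[of "j - k"]) auto
      then show "\<epsilon> \<le> f y" using f(2) i(2) by simp
    qed
    then show ?thesis using blinfun_le_norm[OF f(1), of "D k"] by linarith
  qed
  then have "\<epsilon> \<le> norm l"
    by (intro Lim_bounded2[OF tendsto_norm[OF D_lim], of 1]) auto
  then show False using \<epsilon> \<open>l = 0\<close> by simp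
qed

lemma banach_saks_imp_unif_null:
  fixes x :: "nat \<Rightarrow> 'a::real_normed_vector"
  assumes refl: "reflexive_space TYPE('a)" and bs: "banach_saks lad \<xi> TYPE('a)"
    and bd: "\<And>i. norm (x i) \<le> B"
  shows "\<exists>x0. \<exists>M \<in> inf_subsets {1..}. unif_null (ord_succ \<xi>) M (dual_ball_images (\<lambda>i. x i - x0))"
proof -
  obtain x0 M where M: "M \<in> inf_subsets {1..}" and mazur:
    "mazur_on M (\<lambda>i. x i - x0)"
    using mazur_sequence[of x B, OF refl bd] by blast
  let ?w = "\<lambda>i. x i - x0"
  have Bw: "norm (?w i) \<le> B + norm x0" for i
    using norm_triangle_ineq4[of "x i" x0] bd[of i] by linarith
  have "\<exists>M' \<in> inf_subsets M. unif_null (ord_succ \<xi>) M' (dual_ball_images ?w)"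
  proof (rule unif_null_dual_ball_images_dense[OF M Bw], rule ccontr)
    fix k M1 assume M1: "M1 \<in> inf_subsets M"
    let ?F = "level_family ?w (1 / real (Suc k))"
    assume "\<not> (\<exists>M2\<in>inf_subsets M1. unif_null (ord_succ \<xi>) M2 (indicators ?F))"
    then have "large (ord_succ \<xi>) M1 ?F" unfolding large_def by blast
    then obtain M2 where M2: "M2 \<in> inf_subsets M1" "spreads_into (ord_succ \<xi>) M2 ?F"
      using dichotomy[OF hereditary_level_family] inf_subsets_trans[OF M1 M] by blast
    obtain h where h: "\<And>L \<psi>. L \<in> inf_subsets {1..} \<Longrightarrow> strict_mono_on (supp (fst_avg (ord_succ \<xi>) L)) \<psi> \<Longrightarrow>
      (\<And>i. i \<in> supp (fst_avg (ord_succ \<xi>) L) \<Longrightarrow> \<psi> i \<in> M2 \<and> h i \<le> \<psi> i) \<Longrightarrow>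
      \<psi> ` supp (fst_avg (ord_succ \<xi>) L) \<in> ?F"
      using M2(2) unfolding spreads_into_def by blast
    have unb: "\<exists>m\<in>M2. b < m" for b
      using inf_subsets_infinite[OF M2(1)] infinite_nat_iff_unbounded by blast
    \<comment> \<open>Since \<phi> dominates the growth bound everywhere, its restriction to any
      support is an admissible spread. So one subsequence is bad for every \<open>L\<close> at once,
      which is what refuting the Banach-Saks property takes.\<close>
    have "\<exists>\<phi>. \<forall>n. (\<phi> n \<in> M2 \<and> h n \<le> \<phi> n) \<and> \<phi> n < \<phi> (Suc n)"
    proof (rule dependent_nat_choice)
      show "\<exists>m. m \<in> M2 \<and> h 0 \<le> m" using unb[of "h 0"] less_imp_le by blast
      show "\<exists>y. (y \<in> M2 \<and> h (Suc n) \<le> y) \<and> m < y" for m n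
        using unb[of "max m (h (Suc n))"] by (auto intro: less_imp_le)
    qed
    then obtain \<phi> where \<phi>: "\<And>n. \<phi> n \<in> M2" "\<And>n. h n \<le> \<phi> n" "\<And>n. \<phi> n < \<phi> (Suc n)" by blast
    have mono: "strict_mono \<phi>" using \<phi>(3) by (rule strict_monoI_Suc)
    have "\<phi> i \<in> M" for i
      using \<phi>(1) inf_subsets_subset[OF M2(1)] inf_subsets_subset[OF M1] by blast
    moreover have "\<phi> ` supp (fst_avg (ord_succ \<xi>) L) \<in> ?F" if "L \<in> inf_subsets {1..}" for L
      using h[OF that, of \<phi>] mono \<phi> by (simp add: strict_mono_on_def strict_mono_def)
    ultimately have "\<not> ra_summable lad L \<xi> (\<lambda>i. x (\<phi> i))" if "L \<in> inf_subsets {1..}" for L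
      using not_ra_summable_if_spreads_into[OF mazur _ mono, of "1 / real (Suc k)"] that by simp
    moreover have "bounded ((\<lambda>i. x (\<phi> i)) ` {1..})" using bd unfolding bounded_iff by blast
    ultimately show False using bs unfolding banach_saks_def by blast
  qed
  then show ?thesis using M inf_subsets_trans by blast
qed

theorem banach_saks_increasing:
  assumes refl: "reflexive_space TYPE('a::real_normed_vector)" and bs: "banach_saks lad \<xi> TYPE('a)"
    and "\<xi> \<le> \<zeta>"
  shows "banach_saks lad \<zeta> TYPE('a)"
proof (cases "\<xi> = \<zeta>")
  case False
  then have \<zeta>: "ord_succ \<xi> \<le> \<zeta>" using assms(3) by (simp add: ord_succ_le_iff)
  show ?thesis
    unfolding banach_saks_def
  proof (intro allI impI)
    fix x :: "nat \<Rightarrow> 'a" assume bd: "bounded (x ` {1..})"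
    \<comment> \<open>Boundedness of \<open>x\<close> is assumed only from index 1 on, and
      summability does not see index 0.\<close>
    define y where "y i = x (max 1 i)" for i
    obtain B where "\<And>i. i \<ge> 1 \<Longrightarrow> norm (x i) \<le> B" using bd unfolding bounded_iff by auto
    then have B: "norm (y i) \<le> B" for i by (simp add: y_def)
    obtain x0 M where M: "M \<in> inf_subsets {1..}" "unif_null (ord_succ \<xi>) M (dual_ball_images (\<lambda>i. y i - x0))"
      using banach_saks_imp_unif_null[where x = y, OF refl bs B] by blast
    have "norm (y i - x0) \<le> B + norm x0" for i
      using norm_triangle_ineq4[of "y i" x0] B[of i] by linarith
    then obtain M' where M': "M' \<in> inf_subsets M" "unif_null \<zeta> M' (dual_ball_images (\<lambda>i. y i - x0))"
      using unif_null_increasing[OF \<zeta> M, of "B + norm x0"] dual_ball_images_le by blast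
    have "M' \<in> inf_subsets {1..}" using M'(1) M(1) inf_subsets_trans by blast
    moreover from this have "ra_summable lad M' \<zeta> y" using M'(2) by (rule ra_summable_if_unif_null)
    moreover have "ra_summable lad M' \<zeta> y = ra_summable lad M' \<zeta> x"
      by (rule ra_summable_cong) (simp add: y_def max_absorb2)
    ultimately show "\<exists>L \<in> inf_subsets {1..}. ra_summable lad L \<zeta> x" by blast
  qed
qed (use bs in simp)

end

theorem corollary2p4p15:
  fixes lad :: "countable_ordinal \<Rightarrow> nat \<Rightarrow> countable_ordinal"
  assumes "ladder_system lad"
    and "separable_space (euclidean :: 'a::banach topology)"
    and "reflexive_space TYPE('a)"
  shows "\<exists>!\<xi>. (\<forall>\<zeta>\<ge>\<xi>. banach_saks lad \<zeta> TYPE('a)) \<and> (\<forall>\<zeta><\<xi>. \<not> banach_saks lad \<zeta> TYPE('a))"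
proof -
  interpret ladder lad by unfold_locales (fact assms(1))
  let ?P = "\<lambda>\<xi>. banach_saks lad \<xi> TYPE('a)"
  define \<xi>0 where "\<xi>0 = (LEAST \<xi>. ?P \<xi>)"
  have "\<exists>\<xi>. ?P \<xi>" using banach_saks_eventually[OF assms(2,3)] by blast
  then have "?P \<xi>0" unfolding \<xi>0_def by (rule LeastI_ex)
  show ?thesis
  proof (rule ex1I[of _ \<xi>0])
    show "(\<forall>\<zeta>\<ge>\<xi>0. ?P \<zeta>) \<and> (\<forall>\<zeta><\<xi>0. \<not> ?P \<zeta>)"
    proof (intro conjI allI impI)
      show "?P \<zeta>" if "\<zeta> \<ge> \<xi>0" for \<zeta>
        using banach_saks_increasing[OF assms(3) \<open>?P \<xi>0\<close> that] .
      show "\<not> ?P \<zeta>" if "\<zeta> < \<xi>0" for \<zeta>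
        using that unfolding \<xi>0_def by (rule not_less_Least)
    qed
    fix \<xi> assume \<xi>: "(\<forall>\<zeta>\<ge>\<xi>. ?P \<zeta>) \<and> (\<forall>\<zeta><\<xi>. \<not> ?P \<zeta>)"
    then show "\<xi> = \<xi>0"
      using \<open>?P \<xi>0\<close> Least_le[of ?P \<xi>] unfolding \<xi>0_def by (meson antisym not_le order_refl)
  qed
qed

end
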